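(* Let $\{F_t\}_{t\ge0}$ be a nice Feller process on $\mathbb{R}^d$, $d\ge 1$, with symbol $q(x,\xi)$. If $\operatorname{Re}\mathbb{E}^{0}[e^{i\langle\xi,F_t\rangle}]\ge 0$ for all $t\ge0$ and all $\xi\in\mathbb{R}^d$, and $$\int_{\{|\xi|<r\}}\frac{d\xi}{\sup_{x\in\mathbb{R}^d}|q(x,\xi)|}=\infty\quad\text{for some } r>0,$$ then $\{F_t\}_{t\ge0}$ is recurrent.
   Context: A Feller process $\{F_t\}_{t\ge0}$ on $\mathbb{R}^d$ is a Markov process with state space $(\mathbb{R}^d,\mathcal{B}(\mathbb{R}^d))$, with laws $\mathbb{P}^x$ and expectations $\mathbb{E}^x$ (starting point $x\in\mathbb{R}^d$), whose semigroup $P_tf(x)=\mathbb{E}^x[f(F_t)]$ maps $C_\infty(\mathbb{R}^d)$ (continuous functions vanishing at infinity, with the supremum norm) into itself and is strongly continuous there; it is strong Markov with càdlàg paths. Let $(\mathcal{A},\mathcal{D}_{\mathcal{A}})$ be its (Feller) generator. Condition (C1): $C_c^\infty(\mathbb{R}^d)\subseteq\mathcal{D}_{\mathcal{A}}$. Under (C1), for $f\in C_c^\infty(\mathbb{R}^d)$, $\mathcal{A}f(x)=-\int_{\mathbb{R}^d}q(x,\xi)e^{i\langle\xi,x\rangle}\hat f(\xi)\,d\xi$ with $\hat f(\xi)=(2\pi)^{-d}\int e^{-i\langle\xi,x\rangle}f(x)\,dx$, where the function $q:\mathbb{R}^d\times\mathbb{R}^d\to\mathbb{C}$, called the symbol,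 has for each $x$ the form $$q(x,\xi)=a(x)-i\langle\xi,b(x)\rangle+\tfrac12\langle\xi,c(x)\xi\rangle-\int_{\mathbb{R}^d}\left(e^{i\langle\xi,y\rangle}-1-i\langle\xi,y\rangle1_{\{|y|\le1\}}\right)\nu(x,dy),$$ with $a\ge0$, $b(x)\in\mathbb{R}^d$, $c(x)$ a symmetric nonnegative definite $d\times d$ matrix (all Borel measurable in $x$) and $\nu(x,dy)$ a Borel kernel (the Lévy measure) with $\nu(x,\{0\})=0$, $\int\min\{1,|y|^2\}\nu(x,dy)<\infty$. Condition (C2): there is $C\ge0$ with $\sup_x|q(x,\xi)|\le C(1+|\xi|^2)$ for all $\xi$. Condition (C3): $q(x,0)=a(x)=0$ for all $x$. The process is $\varphi$-irreducible, for a $\sigma$-finite measure $\varphi$ on $\mathcal{B}(\mathbb{R}^d)$, if $\varphi(B)>0$ implies $\int_0^\infty\mathbb{P}^x(F_t\in B)\,dt>0$ for all $x$; then there is a maximal irreducibility measure $\psi$ (i.e. the process is $\bar\varphi$-irreducible iff $\bar\varphi\ll\psi$). Condition (C4): the process is irreducible and its maximal irreducibility measure $\psi$ satisfies $\psi(O)>0$ for every nonempty open set $O\subseteq\mathbb{R}^d$. A nice Feller process is a Feller process satisfying (C1)-(C4). It is recurrent if $\psi(B)>0$ implies $\int_0^\infty\mathbb{P}^x(F_t\in B)\,dt=\infty$ for all $x\in\mathbb{R}^d$. Convention: $1/0=\infty$ in integrands. *)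

theory Defs
  imports "HOL-Probability.Probability" "HOL-Probability.Stopping_Time"
begin

text \<open>
  A process is given by a measurable space \<open>M\<close> (only \<open>space M\<close> and \<open>sets M\<close> matter), laws
  \<open>P x\<close> on it, and random variables \<open>F t\<close>; the time index is \<open>real\<close>, and only \<open>t \<ge> 0\<close>
  is ever used. The state space is \<open>real ^ 'n\<close>, so \<open>d = CARD('n) \<ge> 1\<close> is arbitrary.
\<close>

section \<open>Markov processes\<close>

definition hit_prob ::
    "(real ^ 'n \<Rightarrow> 'w measure) \<Rightarrow> (real \<Rightarrow> 'w \<Rightarrow> real ^ 'n) \<Rightarrow> real \<Rightarrow> real ^ 'n \<Rightarrow> (real ^ 'n) set \<Rightarrow> ennreal"
  where "hit_prob P F t x B = emeasure (P x) {\<omega> \<in> space (P x). F t \<omega> \<in> B}"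

text \<open>
  The index set is \<open>[0, \<infinity>]\<close>, so that \<^const>\<open>stopping_time\<close> and \<^const>\<open>filtration.pre_sigma\<close>
  apply to stopping times with values in \<open>[0, \<infinity>]\<close>.
\<close>

definition natural_filtration ::
    "'w measure \<Rightarrow> (real \<Rightarrow> 'w \<Rightarrow> real ^ 'n) \<Rightarrow> ennreal \<Rightarrow> 'w measure"
  where "natural_filtration M F t =
    sigma (space M) {F u -` B \<inter> space M | u B. 0 \<le> u \<and> ennreal u \<le> t \<and> B \<in> sets borel}"

lemma filtration_natural_filtration: "filtration (space M) (natural_filtration M F)"
proof
  show "space (natural_filtration M F i) = space M" for i
    unfolding natural_filtration_def by (rule space_measure_of) auto
  show "sets (natural_filtration M F i) \<subseteq> sets (natural_filtration M F j)" if "i \<le> j" for i j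
    unfolding natural_filtration_def using that
    by (subst (1 2) sets_measure_of) (auto intro!: sigma_sets_mono' intro: order_trans)
qed

definition markov_process ::
    "'w measure \<Rightarrow> (real ^ 'n \<Rightarrow> 'w measure) \<Rightarrow> (real \<Rightarrow> 'w \<Rightarrow> real ^ 'n) \<Rightarrow> bool"
  where "markov_process M P F \<longleftrightarrow>
    (\<forall>x. prob_space (P x) \<and> sets (P x) = sets M) \<and>
    (\<forall>t\<ge>0. F t \<in> M \<rightarrow>\<^sub>M borel) \<and>
    (\<forall>t\<ge>0. \<forall>B\<in>sets borel. (\<lambda>x. hit_prob P F t x B) \<in> borel_measurable borel) \<and>
    (\<forall>x. AE \<omega> in P x. F 0 \<omega> = x) \<and>
    (\<forall>x. \<forall>s\<ge>0. \<forall>t\<ge>0. \<forall>A\<in>sets (natural_filtration M F (ennreal s)). \<forall>B\<in>sets borel.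
      emeasure (P x) {\<omega> \<in> A. F (s + t) \<omega> \<in> B}
        = (\<integral>\<^sup>+ \<omega>\<in>A. hit_prob P F t (F s \<omega>) B \<partial>P x))"

definition strong_markov ::
    "'w measure \<Rightarrow> (real ^ 'n \<Rightarrow> 'w measure) \<Rightarrow> (real \<Rightarrow> 'w \<Rightarrow> real ^ 'n) \<Rightarrow> bool"
  where "strong_markov M P F \<longleftrightarrow>
    (\<forall>x T. stopping_time (natural_filtration M F) T \<longrightarrow>
      (\<forall>A\<in>sets (filtration.pre_sigma (space M) (natural_filtration M F) T).
        \<forall>t\<ge>0. \<forall>B\<in>sets borel.
          emeasure (P x) {\<omega> \<in> A. T \<omega> < \<infinity> \<and> F (enn2real (T \<omega>) + t) \<omega> \<in> B}
            = (\<integral>\<^sup>+ \<omega>\<in>{\<omega> \<in> A. T \<omega> < \<infinity>}. hit_prob P F t (F (enn2real (T \<omega>)) \<omega>) B \<partial>P x)))"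

definition cadlag_paths :: "'w measure \<Rightarrow> (real \<Rightarrow> 'w \<Rightarrow> real ^ 'n) \<Rightarrow> bool"
  where "cadlag_paths M F \<longleftrightarrow>
    (\<forall>\<omega>\<in>space M.
      (\<forall>t\<ge>0. ((\<lambda>s. F s \<omega>) \<longlongrightarrow> F t \<omega>) (at_right t)) \<and>
      (\<forall>t>0. \<exists>l. ((\<lambda>s. F s \<omega>) \<longlongrightarrow> l) (at_left t)))"

section \<open>Feller processes and their generators\<close>

definition C_infinity :: "(real ^ 'n \<Rightarrow> real) set"
  where "C_infinity = {f. continuous_on UNIV f \<and> (f \<longlongrightarrow> 0) at_infinity}"

definition transition_semigroup ::
    "(real ^ 'n \<Rightarrow> 'w measure) \<Rightarrow> (real \<Rightarrow> 'w \<Rightarrow> real ^ 'n) \<Rightarrow> real \<Rightarrow> (real ^ 'n \<Rightarrow> real) \<Rightarrow> real ^ 'n \<Rightarrow> real"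
  where "transition_semigroup P F t f x = (\<integral>\<omega>. f (F t \<omega>) \<partial>P x)"

text \<open>Convergence in the supremum norm is expressed by \<^const>\<open>uniform_limit\<close> on \<open>UNIV\<close>.\<close>

definition feller_process ::
    "'w measure \<Rightarrow> (real ^ 'n \<Rightarrow> 'w measure) \<Rightarrow> (real \<Rightarrow> 'w \<Rightarrow> real ^ 'n) \<Rightarrow> bool"
  where "feller_process M P F \<longleftrightarrow>
    markov_process M P F \<and> strong_markov M P F \<and> cadlag_paths M F \<and>
    (\<forall>t\<ge>0. \<forall>f\<in>C_infinity. transition_semigroup P F t f \<in> C_infinity) \<and>
    (\<forall>f\<in>C_infinity. uniform_limit UNIV (\<lambda>t. transition_semigroup P F t f) f (at_right 0))"

definition generates ::
    "(real ^ 'n \<Rightarrow> 'w measure) \<Rightarrow> (real \<Rightarrow> 'w \<Rightarrow> real ^ 'n) \<Rightarrow> (real ^ 'n \<Rightarrow> real) \<Rightarrow> (real ^ 'n \<Rightarrow> real) \<Rightarrow> bool"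
  where "generates P F f g \<longleftrightarrow>
    f \<in> C_infinity \<and> g \<in> C_infinity \<and>
    uniform_limit UNIV (\<lambda>t x. (transition_semigroup P F t f x - f x) / t) g (at_right 0)"

definition generator_domain ::
    "(real ^ 'n \<Rightarrow> 'w measure) \<Rightarrow> (real \<Rightarrow> 'w \<Rightarrow> real ^ 'n) \<Rightarrow> (real ^ 'n \<Rightarrow> real) set"
  where "generator_domain P F = {f. \<exists>g. generates P F f g}"

definition generator ::
    "(real ^ 'n \<Rightarrow> 'w measure) \<Rightarrow> (real \<Rightarrow> 'w \<Rightarrow> real ^ 'n) \<Rightarrow> (real ^ 'n \<Rightarrow> real) \<Rightarrow> real ^ 'n \<Rightarrow> real"
  where "generator P F f = (THE g. generates P F f g)"

lemma generator_eqI: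
  assumes "generates P F f g"
  shows "generator P F f = g"
  unfolding generator_def
proof (rule the_equality[where P = "generates P F f", OF assms])
  fix h assume h: "generates P F f h"
  show "h = g"
  proof
    fix x
    have lims: "((\<lambda>t. (transition_semigroup P F t f x - f x) / t) \<longlongrightarrow> h x) (at_right 0)"
      "((\<lambda>t. (transition_semigroup P F t f x - f x) / t) \<longlongrightarrow> g x) (at_right 0)"
      using h assms unfolding generates_def by (auto dest: tendsto_uniform_limitI[where x = x])
    then show "h x = g x"
      by (rule tendsto_unique[OF trivial_limit_at_right_real])
  qed
qed

text \<open>
  A function is \<open>C\<^sup>k\<^sup>+\<^sup>1\<close> iff it is differentiable and all its directional derivatives
  are \<open>C\<^sup>k\<close>.
\<close>

fun C_k :: "nat \<Rightarrow> (real ^ 'n \<Rightarrow> real) \<Rightarrow> bool"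
  where
    "C_k 0 f \<longleftrightarrow> continuous_on UNIV f"
  | "C_k (Suc k) f \<longleftrightarrow>
      (\<forall>x. f differentiable at x) \<and> (\<forall>v. C_k k (\<lambda>x. frechet_derivative f (at x) v))"

definition C_c_smooth :: "(real ^ 'n \<Rightarrow> real) set"
  where "C_c_smooth = {f. (\<forall>k. C_k k f) \<and> compact (closure {x. f x \<noteq> 0})}"

section \<open>The symbol\<close>

definition fourier :: "(real ^ 'n \<Rightarrow> real) \<Rightarrow> real ^ 'n \<Rightarrow> complex"
  where "fourier f \<xi> =
    complex_of_real (1 / (2 * pi) ^ CARD('n)) *
      (\<integral>x. iexp (- (\<xi> \<bullet> x)) * complex_of_real (f x) \<partial>lborel)"

definition levy_khintchine ::
    "real \<Rightarrow> real ^ 'n \<Rightarrow> real ^ 'n ^ 'n \<Rightarrow> (real ^ 'n) measure \<Rightarrow> real ^ 'n \<Rightarrow> complex"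
  where "levy_khintchine a b c \<nu> \<xi> =
    complex_of_real a - \<i> * complex_of_real (\<xi> \<bullet> b)
      + complex_of_real (\<xi> \<bullet> (c *v \<xi>)) / 2
      - (\<integral>y. iexp (\<xi> \<bullet> y) - 1
               - \<i> * complex_of_real ((\<xi> \<bullet> y) * indicator {y. norm y \<le> 1} y) \<partial>\<nu>)"

definition levy_characteristics ::
    "(real ^ 'n \<Rightarrow> real) \<Rightarrow> (real ^ 'n \<Rightarrow> real ^ 'n) \<Rightarrow> (real ^ 'n \<Rightarrow> real ^ 'n ^ 'n)
      \<Rightarrow> (real ^ 'n \<Rightarrow> (real ^ 'n) measure) \<Rightarrow> bool"
  where "levy_characteristics a b c \<nu> \<longleftrightarrow>
    a \<in> borel_measurable borel \<and> b \<in> borel_measurable borel \<and> c \<in> borel_measurable borel \<and>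
    (\<forall>x. 0 \<le> a x) \<and>
    (\<forall>x. transpose (c x) = c x \<and> (\<forall>v. 0 \<le> v \<bullet> (c x *v v))) \<and>
    (\<forall>x. sets (\<nu> x) = sets borel) \<and>
    (\<forall>B\<in>sets borel. (\<lambda>x. emeasure (\<nu> x) B) \<in> borel_measurable borel) \<and>
    (\<forall>x. emeasure (\<nu> x) {0} = 0) \<and>
    (\<forall>x. (\<integral>\<^sup>+ y. ennreal (min 1 ((norm y)\<^sup>2)) \<partial>\<nu> x) < \<infinity>)"

definition has_symbol ::
    "(real ^ 'n \<Rightarrow> 'w measure) \<Rightarrow> (real \<Rightarrow> 'w \<Rightarrow> real ^ 'n) \<Rightarrow> (real ^ 'n \<Rightarrow> real ^ 'n \<Rightarrow> complex) \<Rightarrow> bool"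
  where "has_symbol P F q \<longleftrightarrow>
    (\<exists>a b c \<nu>. levy_characteristics a b c \<nu> \<and>
      (\<forall>x \<xi>. q x \<xi> = levy_khintchine (a x) (b x) (c x) (\<nu> x) \<xi>)) \<and>
    (\<forall>f\<in>C_c_smooth. \<forall>x.
      complex_of_real (generator P F f x)
        = - (\<integral>\<xi>. q x \<xi> * iexp (\<xi> \<bullet> x) * fourier f \<xi> \<partial>lborel))"

text \<open>With values in \<^typ>\<open>ennreal\<close>, where \<open>1 / 0 = \<infinity>\<close>.\<close>

definition sup_symbol :: "(real ^ 'n \<Rightarrow> real ^ 'n \<Rightarrow> complex) \<Rightarrow> real ^ 'n \<Rightarrow> ennreal"
  where "sup_symbol q \<xi> = (SUP x. ennreal (cmod (q x \<xi>)))"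

section \<open>Irreducibility and recurrence\<close>

definition occupation ::
    "(real ^ 'n \<Rightarrow> 'w measure) \<Rightarrow> (real \<Rightarrow> 'w \<Rightarrow> real ^ 'n) \<Rightarrow> real ^ 'n \<Rightarrow> (real ^ 'n) set \<Rightarrow> ennreal"
  where "occupation P F x B = (\<integral>\<^sup>+ t\<in>{0..}. hit_prob P F t x B \<partial>lborel)"

definition irreducible_wrt ::
    "(real ^ 'n \<Rightarrow> 'w measure) \<Rightarrow> (real \<Rightarrow> 'w \<Rightarrow> real ^ 'n) \<Rightarrow> (real ^ 'n) measure \<Rightarrow> bool"
  where "irreducible_wrt P F \<phi> \<longleftrightarrow>
    (\<forall>B\<in>sets borel. emeasure \<phi> B > 0 \<longrightarrow> (\<forall>x. occupation P F x B > 0))"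

text \<open>
  Note the argument order of \<^const>\<open>absolutely_continuous\<close>: \<open>absolutely_continuous \<psi> \<phi>\<close>
  means \<open>\<phi> \<lless> \<psi>\<close>. Taking \<open>\<phi> = \<psi>\<close> shows that the process is \<open>\<psi>\<close>-irreducible.
\<close>

definition maximal_irreducibility_measure ::
    "(real ^ 'n \<Rightarrow> 'w measure) \<Rightarrow> (real \<Rightarrow> 'w \<Rightarrow> real ^ 'n) \<Rightarrow> (real ^ 'n) measure \<Rightarrow> bool"
  where "maximal_irreducibility_measure P F \<psi> \<longleftrightarrow>
    sets \<psi> = sets borel \<and> sigma_finite_measure \<psi> \<and>
    (\<forall>\<phi>. sets \<phi> = sets borel \<and> sigma_finite_measure \<phi> \<longrightarrow>
      (irreducible_wrt P F \<phi> \<longleftrightarrow> absolutely_continuous \<psi> \<phi>))"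

text \<open>
  Maximal irreducibility measures of one process have the same null sets. In the definitions
  below, which only depend on the null sets of \<open>\<psi>\<close>, \<open>\<psi>\<close> may therefore be
  quantified existentially.
\<close>

lemma maximal_irreducibility_measure_null_sets:
  assumes "maximal_irreducibility_measure P F \<psi>" "maximal_irreducibility_measure P F \<psi>'"
  shows "null_sets \<psi> = null_sets \<psi>'"
  using assms unfolding maximal_irreducibility_measure_def absolutely_continuous_def
  by (intro equalityI) blast+

definition recurrent ::
    "(real ^ 'n \<Rightarrow> 'w measure) \<Rightarrow> (real \<Rightarrow> 'w \<Rightarrow> real ^ 'n) \<Rightarrow> bool"
  where "recurrent P F \<longleftrightarrow>
    (\<exists>\<psi>. maximal_irreducibility_measure P F \<psi> \<and>
      (\<forall>B\<in>sets borel. emeasure \<psi> B > 0 \<longrightarrow> (\<forall>x. occupation P F x B = \<infinity>)))"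

section \<open>Nice Feller processes\<close>

definition nice_feller_process ::
    "'w measure \<Rightarrow> (real ^ 'n \<Rightarrow> 'w measure) \<Rightarrow> (real \<Rightarrow> 'w \<Rightarrow> real ^ 'n)
      \<Rightarrow> (real ^ 'n \<Rightarrow> real ^ 'n \<Rightarrow> complex) \<Rightarrow> bool"
  where "nice_feller_process M P F q \<longleftrightarrow>
    feller_process M P F \<and>
    C_c_smooth \<subseteq> generator_domain P F \<and> has_symbol P F q \<and>
    (\<exists>C\<ge>0. \<forall>\<xi>. sup_symbol q \<xi> \<le> ennreal (C * (1 + (norm \<xi>)\<^sup>2))) \<and>
    \<comment> \<open>by the Levy-Khintchine form, \<open>q x 0 = a x\<close>\<close>
    (\<forall>x. q x 0 = 0) \<and>
    (\<exists>\<psi>. maximal_irreducibility_measure P F \<psi> \<and>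
      (\<forall>U. open U \<and> U \<noteq> {} \<longrightarrow> emeasure \<psi> U > 0))"

end

theory Submission
  imports Defs "HOL-Real_Asymp.Real_Asymp"
begin

text \<open>
  Truncating \<open>x \<mapsto> cos (\<xi> \<bullet> x)\<close> by smooth cutoffs and applying Dynkin's formula gives
  \<open>Re E\<^sup>0[exp (i \<langle>\<xi>, F\<^sub>t\<rangle>)] \<ge> 1 - t sup\<^sub>x |q(x, \<xi>)|\<close>, so integrating this nonnegative quantity over
  \<open>t \<ge> 0\<close> yields at least a constant times \<open>1 / sup\<^sub>x |q(x, \<xi>)|\<close>. Integrating further over \<open>\<xi>\<close> against a
  Fejer kernel, whose Fourier transform is bounded with compact support, shows that the process
  started at \<open>0\<close> spends infinite expected time in some cube.

  If the process were not recurrent, a maximum principle along the chain \<open>P\<^sub>T, P\<^sub>2\<^sub>T, \<dots>\<close> would give a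
  compact set \<open>C\<close> with \<open>\<psi>(C) > 0\<close> and bounded potential. By irreducibility and the Feller property the
  sets \<open>{x. \<integral>\<^sub>0\<^sup>n P\<^sub>t(x, C) dt \<ge> 1 / n}\<close> are closed and cover the space, so by Baire's theorem one of
  them contains a ball, which then has bounded potential as well. As \<open>\<psi>\<close> charges balls, the same
  argument with open covers makes the potential of every compact set bounded, a contradiction.
\<close>

section \<open>Potentials of a Feller semigroup\<close>

text \<open>All of the argument is carried by the one-time laws of the process, which is why the
  locale \<open>feller_kernels\<close> keeps only a family of transition kernels
  \<open>K t x\<close>.

  The analytic obstacle is that the cosine does not vanish at infinity, so the generator cannot act
  on it. Its truncation at scale k has a Fourier transform concentrated within distance of order 1/k
  of \<xi> and -\<xi>, so the generator of the truncation averages the symbol near these two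
  frequencies. The symbol may grow quadratically, hence the averaging weight needs an integrable
  second moment; four derivatives of the bump in each coordinate provide it. The mass of that weight
  is computed by Fejer summation, so the Fejer kernel is used twice.

  The hypothesis on the sign of the real part is needed at all frequencies, because the Fejer kernel
  also charges those outside the ball of radius r.

  On the side of potentials, everything known is local: a finite potential at one point and an
  infinite one at 0. The bounds are therefore made uniform in the starting point before the two are
  compared.\<close>

lemma C_infinityI:
  fixes f :: "real ^ 'n \<Rightarrow> real"
  assumes "continuous_on UNIV f" and "\<And>x. norm x > R \<Longrightarrow> f x = 0"
  shows "f \<in> C_infinity"
proof -
  have "eventually (\<lambda>x. f x = 0) at_infinity"
    unfolding eventually_at_infinity using assms(2)
    by (metis gt_ex less_le_trans)
  then show ?thesis
    using assms(1) by (simp add: C_infinity_def tendsto_eventually)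
qed

lemma C_infinity_bounded:
  fixes f :: "real ^ 'n \<Rightarrow> real"
  assumes "f \<in> C_infinity"
  obtains B where "B > 0" "\<And>x. \<bar>f x\<bar> \<le> B"
proof -
  have cont: "continuous_on UNIV f" and lim: "(f \<longlongrightarrow> 0) at_infinity"
    using assms by (auto simp: C_infinity_def)
  from tendstoD[OF lim, of 1] obtain R where R: "\<And>x. norm x \<ge> R \<Longrightarrow> \<bar>f x\<bar> < 1"
    by (auto simp: eventually_at_infinity)
  have "compact (f ` cball 0 R)"
    by (intro compact_continuous_image continuous_on_subset[OF cont]) auto
  then obtain C where C: "\<And>y. y \<in> f ` cball 0 R \<Longrightarrow> \<bar>y\<bar> \<le> C"
    by (metis compact_imp_bounded bounded_real)
  have "\<bar>f x\<bar> \<le> \<bar>C\<bar> + 1" for x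
  proof (cases "norm x \<ge> R")
    case True then show ?thesis using R[of x] by linarith
  next
    case False then show ?thesis using C[of "f x"] by fastforce
  qed
  then show ?thesis by (intro that[of "\<bar>C\<bar> + 1"]) auto
qed

lemma C_infinity_measurable [measurable_dest]:
  "f \<in> C_infinity \<Longrightarrow> f \<in> borel_measurable borel"
  by (auto simp: C_infinity_def intro: borel_measurable_continuous_onI)

lemma C_infinity_continuous: "f \<in> C_infinity \<Longrightarrow> continuous_on A f"
  by (auto simp: C_infinity_def intro: continuous_on_subset)

text \<open>The Feller property speaks of continuous functions only, so indicators of closed sets
  are approached from above by these piecewise linear functions of the distance.\<close>

definition tent :: "(real ^ 'n) set \<Rightarrow> real \<Rightarrow> real ^ 'n \<Rightarrow> real"
  where "tent A n x = max 0 (1 - n * infdist x A)"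

lemma tent_in_C_infinity:
  assumes "bounded A" "A \<noteq> {}" "n > 0"
  shows "tent A n \<in> C_infinity"
proof -
  obtain R where R: "\<And>x. x \<in> A \<Longrightarrow> norm x \<le> R" using assms(1) by (auto simp: bounded_iff)
  show ?thesis
  proof (rule C_infinityI[of _ "R + 1 / n"])
    show "continuous_on UNIV (tent A n)"
      unfolding tent_def by (intro continuous_intros)
    fix x :: "real ^ 'a" assume x: "norm x > R + 1 / n"
    have "1 / n \<le> dist x a" if "a \<in> A" for a
      using R[OF that] x norm_triangle_ineq2[of x a] by (simp add: dist_norm)
    then have "1 / n \<le> infdist x A"
      using assms(2) by (auto simp: infdist_def intro!: cINF_greatest)
    then show "tent A n x = 0"
      using assms(3) by (simp add: tent_def field_simps max_def)
  qed
qed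

lemma tent_bounds: "n \<ge> 0 \<Longrightarrow> 0 \<le> tent A n x" "n \<ge> 0 \<Longrightarrow> tent A n x \<le> 1"
  by (auto simp: tent_def infdist_nonneg)

lemma tent_tendsto:
  assumes "closed A" "A \<noteq> {}"
  shows "(\<lambda>n. tent A (real (Suc n)) x) \<longlonglongrightarrow> indicator A x"
proof (cases "x \<in> A")
  case True then show ?thesis by (simp add: tent_def)
next
  case False
  then have d: "infdist x A > 0"
    using assms by (metis infdist_nonneg in_closed_iff_infdist_zero order_less_le)
  obtain N where N: "1 / infdist x A < real N" using reals_Archimedean2 by blast
  have "eventually (\<lambda>n. tent A (real (Suc n)) x = 0) sequentially"
    using eventually_ge_at_top[of N]
  proof eventually_elim
    case (elim n)
    then have "1 / infdist x A < real (Suc n)" using N by linarith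
    then show ?case using d by (simp add: tent_def field_simps max_def)
  qed
  then show ?thesis using False by (simp add: tendsto_eventually)
qed

lemma tent_ge_indicator: "indicator A x \<le> tent A n x"
  by (auto simp: tent_def indicator_def)

text \<open>Prepares the joint measurability of the kernels: compact sets are stable under
  intersection, and their indicators are limits of tents, which vanish at infinity.\<close>

lemma borel_eq_compact: "sets (borel :: (real ^ 'n) measure) = sigma_sets UNIV (Collect compact)"
proof -
  have "borel = sigma UNIV ((\<lambda>x. x) ` Collect (compact :: (real ^ 'n) set \<Rightarrow> bool))"
  proof (rule borel_eq_sigmaI1[OF borel_eq_atLeastAtMost])
    fix X :: "(real ^ 'n) set" assume "X \<in> range (\<lambda>(a, b). {a..b})"
    then have "compact X" by (auto simp: interval_cbox)
    then show "X \<in> sets (sigma UNIV ((\<lambda>x. x) ` Collect compact))" by simp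
  qed (auto intro: borel_compact)
  from arg_cong[OF this, of sets] show ?thesis by simp
qed

lemma emeasure_lborel_atLeastLessThan_finite [simp]: "emeasure lborel {0..<T::real} < \<top>"
  by (cases "0 \<le> T") auto

lemma emeasure_lborel_atLeastLessThan_neq_top [simp]: "emeasure lborel {0..<T::real} \<noteq> \<top>"
  by (rule less_imp_neq) simp

text \<open>Inner regularity applies to finite measures, so \<open>M\<close> is first restricted to
  a piece \<open>F i\<close> of finite measure that meets \<open>A\<close> in positive mass.\<close>

lemma positive_measure_compact_subset:
  fixes M :: "'a::{second_countable_topology, complete_space} measure"
  assumes sets[measurable_cong]: "sets M = sets borel" and sf: "sigma_finite_measure M"
    and A: "A \<in> sets borel" and pos: "emeasure M A > 0"
  obtains C where "compact C" "C \<subseteq> A" "emeasure M C > 0"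
proof -
  obtain F :: "nat \<Rightarrow> 'a set" where F: "range F \<subseteq> sets M" "(\<Union>i. F i) = space M" "\<And>i. emeasure M (F i) \<noteq> \<infinity>"
    using sigma_finite_measure.sigma_finite[OF sf] by metis
  have FM: "F i \<in> sets M" for i using F(1) by auto
  have AM: "A \<in> sets M" using A sets by simp
  have "\<exists>i. emeasure M (F i \<inter> A) \<noteq> 0"
  proof (rule ccontr)
    assume "\<nexists>i. emeasure M (F i \<inter> A) \<noteq> 0"
    then have "emeasure M (\<Union>i. F i \<inter> A) = 0"
      using FM AM by (intro emeasure_UN_eq_0) auto
    moreover have "(\<Union>i. F i \<inter> A) = A" using F(2) sets.sets_into_space[OF AM] by auto
    ultimately show False using pos by simp
  qed
  then obtain i where i: "emeasure M (F i \<inter> A) \<noteq> 0" by blast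
  define N where "N = density M (indicator (F i))"
  have N: "emeasure N B = emeasure M (F i \<inter> B)" if "B \<in> sets M" for B
    unfolding N_def using FM[of i] that
    by (simp add: emeasure_density indicator_inter_arith[symmetric] Int_commute)
  have "emeasure N (space N) \<noteq> \<infinity>"
    using N[of "space M"] F(3)[of i] FM[of i] sets.sets_into_space[OF FM[of i]]
    by (simp add: N_def Int_absorb2)
  then have "emeasure N A = (SUP K\<in>{K. K \<subseteq> A \<and> compact K}. emeasure N K)"
    using sets A by (intro inner_regular) (auto simp: N_def)
  moreover have "0 < emeasure N A" using i N[OF AM] by (simp add: zero_less_iff_neq_zero)
  ultimately obtain C where C: "C \<subseteq> A" "compact C" "0 < emeasure N C"
    by (auto simp: less_SUP_iff)
  have "C \<in> sets M" using C(2) sets by (simp add: borel_compact)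
  with C(3) N have "0 < emeasure M (F i \<inter> C)" by simp
  also have "\<dots> \<le> emeasure M C" using \<open>C \<in> sets M\<close> by (intro emeasure_mono) auto
  finally show ?thesis using that C by blast
qed

section \<open>Feller transition kernels: contraction, continuity, joint measurability\<close>

locale feller_kernels =
  fixes K :: "real \<Rightarrow> real ^ 'n \<Rightarrow> (real ^ 'n) measure"
  assumes prob_K: "0 \<le> t \<Longrightarrow> prob_space (K t x)"
    and meas_K: "0 \<le> t \<Longrightarrow> K t \<in> borel \<rightarrow>\<^sub>M subprob_algebra borel"
    and chapman_kolmogorov: "0 \<le> s \<Longrightarrow> 0 \<le> t \<Longrightarrow> K (s + t) x = K s x \<bind> K t"
    and initial: "K 0 x = return borel x"
    and feller: "0 \<le> t \<Longrightarrow> f \<in> C_infinity \<Longrightarrow> (\<lambda>x. \<integral>y. f y \<partial>K t x) \<in> C_infinity"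
    and strongly_continuous:
      "f \<in> C_infinity \<Longrightarrow> uniform_limit UNIV (\<lambda>t x. \<integral>y. f y \<partial>K t x) f (at_right 0)"
begin

lemma sets_K: "0 \<le> t \<Longrightarrow> sets (K t x) = sets borel"
  using sets_kernel[OF meas_K, of t x] by simp

lemma space_K: "0 \<le> t \<Longrightarrow> space (K t x) = UNIV"
  using sets_eq_imp_space_eq[OF sets_K] by simp

lemma measurable_K: "0 \<le> t \<Longrightarrow> f \<in> borel_measurable borel \<Longrightarrow> f \<in> borel_measurable (K t x)"
  using measurable_cong_sets[OF sets_K refl] by blast

lemma emeasure_K_UNIV: "0 \<le> t \<Longrightarrow> emeasure (K t x) UNIV = 1"
  using prob_space.emeasure_space_1[OF prob_K] space_K by metis

lemma integrable_K:
  fixes f :: "real ^ 'n \<Rightarrow> 'b::{second_countable_topology, banach}"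
  assumes "0 \<le> t" "f \<in> borel_measurable borel" "\<And>y. norm (f y) \<le> B"
  shows "integrable (K t x) f"
proof -
  interpret prob_space "K t x" using prob_K assms(1) .
  show ?thesis using assms measurable_K by (intro integrable_const_bound[of _ B]) auto
qed

lemma integral_K_bound:
  fixes f :: "real ^ 'n \<Rightarrow> real"
  assumes "0 \<le> t" "f \<in> borel_measurable borel" "\<And>y. \<bar>f y\<bar> \<le> B"
  shows "\<bar>\<integral>y. f y \<partial>K t x\<bar> \<le> B"
proof -
  interpret prob_space "K t x" using prob_K assms(1) .
  have "integrable (K t x) f" using assms by (intro integrable_K) auto
  moreover have "- B \<le> f y" "f y \<le> B" for y using assms(3)[of y] by auto
  ultimately have "expectation f \<le> B" "- B \<le> expectation f"
    by (auto intro: integral_le_const integral_ge_const)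
  then show ?thesis by (intro abs_leI) auto
qed

lemma integral_K_add:
  fixes f :: "real ^ 'n \<Rightarrow> real"
  assumes st: "0 \<le> s" "0 \<le> t" and f: "f \<in> borel_measurable borel" "\<And>y. \<bar>f y\<bar> \<le> B"
  shows "(\<integral>y. f y \<partial>K (s + t) x) = (\<integral>y. (\<integral>z. f z \<partial>K t y) \<partial>K s x)"
proof -
  interpret prob_space "K s x" using prob_K st(1) .
  have Kt: "K t \<in> K s x \<rightarrow>\<^sub>M subprob_algebra borel"
    using meas_K[OF st(2)] measurable_cong_sets[OF sets_K[OF st(1)] refl] by blast
  have "(\<integral>y. f y \<partial>K (s + t) x) = (\<integral>y. f y \<partial>join (distr (K s x) (subprob_algebra borel) (K t)))"
    using space_K[OF st(1)] by (simp add: chapman_kolmogorov[OF st] bind_nonempty''[OF Kt])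
  also have "\<dots> = (\<integral>N. (\<integral>z. f z \<partial>N) \<partial>distr (K s x) (subprob_algebra borel) (K t))"
    using f Kt emeasure_K_UNIV[OF st(2)]
    by (intro integral_join[where N = borel and B = B and B' = 1] finite_measure_distr)
      (auto simp: AE_distr_iff space_K[OF st(2)])
  also have "\<dots> = (\<integral>y. (\<integral>z. f z \<partial>K t y) \<partial>K s x)"
    using f by (intro integral_distr Kt) auto
  finally show ?thesis .
qed

lemma nn_integral_K_add:
  assumes st: "0 \<le> s" "0 \<le> t" and f: "f \<in> borel_measurable borel"
  shows "(\<integral>\<^sup>+y. f y \<partial>K (s + t) x) = (\<integral>\<^sup>+y. (\<integral>\<^sup>+z. f z \<partial>K t y) \<partial>K s x)"
proof -
  have "K t \<in> K s x \<rightarrow>\<^sub>M subprob_algebra borel"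
    using meas_K[OF st(2)] measurable_cong_sets[OF sets_K[OF st(1)] refl] by blast
  from nn_integral_bind[OF f this] show ?thesis by (simp add: chapman_kolmogorov[OF st])
qed

text \<open>By Chapman-Kolmogorov the difference is \<open>K s\<close> applied to the increment over
  time \<open>t - s\<close> started at time 0, and averaging over a probability measure cannot
  increase the supremum norm. Hence \<open>d\<close> depends neither on \<open>s\<close> nor on
  \<open>x\<close>.\<close>

lemma uniformly_continuous_semigroup:
  assumes f: "f \<in> C_infinity" and "0 < e"
  obtains d where "0 < d"
    "\<And>s t x. 0 \<le> s \<Longrightarrow> s \<le> t \<Longrightarrow> t - s < d \<Longrightarrow> \<bar>(\<integral>y. f y \<partial>K t x) - (\<integral>y. f y \<partial>K s x)\<bar> \<le> e"
proof -
  obtain B where B: "B > 0" "\<And>x. \<bar>f x\<bar> \<le> B" using C_infinity_bounded[OF f] by metis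
  from uniform_limitD[OF strongly_continuous[OF f] \<open>0 < e\<close>]
  obtain d where d: "d > 0" "\<And>t x. 0 < t \<Longrightarrow> t < d \<Longrightarrow> \<bar>(\<integral>y. f y \<partial>K t x) - f x\<bar> < e"
    by (auto simp: eventually_at_right[of 0 1] dist_real_def)
  show ?thesis
  proof (rule that[OF d(1)])
    fix s t x assume st: "0 \<le> s" "s \<le> t" "t - s < d"
    show "\<bar>(\<integral>y. f y \<partial>K t x) - (\<integral>y. f y \<partial>K s x)\<bar> \<le> e"
    proof (cases "s = t")
      case False
      have Pf: "(\<lambda>y. \<integral>z. f z \<partial>K (t - s) y) \<in> C_infinity" using st f by (intro feller) auto
      have "(\<integral>y. f y \<partial>K t x) = (\<integral>y. (\<integral>z. f z \<partial>K (t - s) y) \<partial>K s x)"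
        using integral_K_add[of s "t - s" f B x] st f B by auto
      moreover have "integrable (K s x) (\<lambda>y. \<integral>z. f z \<partial>K (t - s) y)"
        using st f B Pf by (intro integrable_K[where B = B]) (auto intro!: integral_K_bound)
      moreover have "integrable (K s x) f" using st f B by (intro integrable_K[where B = B]) auto
      ultimately have "(\<integral>y. f y \<partial>K t x) - (\<integral>y. f y \<partial>K s x)
          = (\<integral>y. ((\<integral>z. f z \<partial>K (t - s) y) - f y) \<partial>K s x)"
        by simp
      moreover have "\<bar>\<integral>y. ((\<integral>z. f z \<partial>K (t - s) y) - f y) \<partial>K s x\<bar> \<le> e"
        using st False d(2)[of "t - s"] f Pf by (intro integral_K_bound) (auto intro: less_imp_le)
      ultimately show ?thesis by simp
    qed (use \<open>0 < e\<close> in simp)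
  qed
qed

text \<open>Continuity in time is uniform in the starting point, so it combines with continuity in
  the starting point at the fixed time \<open>t\<close>: move the time first, at the moved point,
  then the point.\<close>

lemma continuous_semigroup:
  assumes f: "f \<in> C_infinity"
  shows "continuous_on ({0..} \<times> UNIV) (\<lambda>(t, x). \<integral>y. f y \<partial>K t x)"
proof (unfold continuous_on_iff, intro ballI allI impI)
  fix p :: "real \<times> (real ^ 'n)" and e :: real assume "p \<in> {0..} \<times> UNIV" and e: "0 < e"
  then obtain t x where p: "p = (t, x)" and t: "0 \<le> t" by auto
  obtain d where d: "0 < d"
    "\<And>s t x. 0 \<le> s \<Longrightarrow> s \<le> t \<Longrightarrow> t - s < d \<Longrightarrow> \<bar>(\<integral>y. f y \<partial>K t x) - (\<integral>y. f y \<partial>K s x)\<bar> \<le> e/4"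
    using uniformly_continuous_semigroup[OF f, of "e/4"] e by auto
  have "continuous_on UNIV (\<lambda>x. \<integral>y. f y \<partial>K t x)"
    using feller[OF t f] by (rule C_infinity_continuous)
  then obtain d' where d': "d' > 0" "\<And>x'. dist x' x < d' \<Longrightarrow> \<bar>(\<integral>y. f y \<partial>K t x') - (\<integral>y. f y \<partial>K t x)\<bar> < e/2"
    using e unfolding continuous_on_iff dist_real_def by (meson UNIV_I half_gt_zero)
  show "\<exists>d>0. \<forall>p'\<in>{0..} \<times> UNIV. dist p' p < d \<longrightarrow>
      dist (case p' of (t, x) \<Rightarrow> \<integral>y. f y \<partial>K t x) (case p of (t, x) \<Rightarrow> \<integral>y. f y \<partial>K t x) < e"
  proof (intro exI[of _ "min d d'"] conjI ballI impI)
    fix p' :: "real \<times> (real ^ 'n)" assume "p' \<in> {0..} \<times> UNIV" and *: "dist p' p < min d d'"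
    then obtain t' x' where p': "p' = (t', x')" and t': "0 \<le> t'" by auto
    have "\<bar>t' - t\<bar> < d" "dist x' x < d'"
      using * dist_fst_le[of p' p] dist_snd_le[of p' p] by (auto simp: p p' dist_real_def)
    then have "\<bar>(\<integral>y. f y \<partial>K t' x') - (\<integral>y. f y \<partial>K t x')\<bar> \<le> e/4"
      using d(2)[of t t' x'] d(2)[of t' t x'] t t' abs_minus_commute[of "\<integral>y. f y \<partial>K t x'"]
      by (cases "t \<le> t'") auto
    then have "\<bar>(\<integral>y. f y \<partial>K t' x') - (\<integral>y. f y \<partial>K t x)\<bar> < e"
      using d'(2)[OF \<open>dist x' x < d'\<close>] e by linarith
    then show "dist (case p' of (t, x) \<Rightarrow> \<integral>y. f y \<partial>K t x) (case p of (t, x) \<Rightarrow> \<integral>y. f y \<partial>K t x) < e"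
      by (simp add: p p' dist_real_def)
  qed (use d d' in auto)
qed

text \<open>The kernels are constrained only at nonnegative times; clamping the time by
  \<open>max 0 t\<close> gives functions that are continuous, and later measurable, on the whole
  real line.\<close>

lemma continuous_semigroup_max:
  assumes f: "f \<in> C_infinity"
  shows "continuous_on UNIV (\<lambda>(t, x). \<integral>y. f y \<partial>K (max 0 t) x)"
proof -
  have "continuous_on UNIV ((\<lambda>(t, x). \<integral>y. f y \<partial>K t x) \<circ> (\<lambda>(t, x). (max 0 t, x)))"
    by (intro continuous_on_compose continuous_on_subset[OF continuous_semigroup[OF f]])
      (auto intro!: continuous_intros simp: case_prod_unfold)
  then show ?thesis by (simp add: o_def case_prod_unfold)
qed

lemma emeasure_K_eq: "0 \<le> t \<Longrightarrow> emeasure (K t x) A = ennreal (measure (K t x) A)"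
  using prob_K[of t x] by (simp add: finite_measure.emeasure_eq_measure prob_space.finite_measure)

lemma tent_integral_tendsto:
  assumes "0 \<le> t" "compact A" "A \<noteq> {}"
  shows "(\<lambda>n. \<integral>y. tent A (real (Suc n)) y \<partial>K t x) \<longlonglongrightarrow> measure (K t x) A"
proof -
  interpret prob_space "K t x" using prob_K assms(1) .
  have [measurable]: "A \<in> sets (K t x)" using assms sets_K by (auto intro: borel_compact)
  have T: "tent A (real (Suc n)) \<in> borel_measurable (K t x)" for n
    using assms by (intro measurable_K C_infinity_measurable tent_in_C_infinity compact_imp_bounded) auto
  have "(\<lambda>n. \<integral>y. tent A (real (Suc n)) y \<partial>K t x) \<longlonglongrightarrow> (\<integral>y. indicator A y \<partial>K t x)"
    using T assms tent_bounds[of "real (Suc _)" A]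
    by (intro integral_dominated_convergence[where w = "\<lambda>_. 1"])
      (auto intro!: tent_tendsto compact_imp_closed simp del: of_nat_Suc)
  then show ?thesis by simp
qed

text \<open>On compact sets the kernel is a pointwise limit of the jointly continuous integrals of
  tents; an intersection-stable generator is enough for the rest. This is what permits Fubini in
  time and space.\<close>

lemma measurable_K_joint [measurable]:
  "(\<lambda>(t, x). K (max 0 t) x) \<in> borel \<Otimes>\<^sub>M borel \<rightarrow>\<^sub>M subprob_algebra borel"
proof (rule measurable_subprob_algebra_generated[where G = "Collect compact" and \<Omega> = UNIV])
  show "Int_stable (Collect (compact :: (real ^ 'n) set \<Rightarrow> bool))"
    by (auto simp: Int_stable_def)
  fix A :: "(real ^ 'n) set" assume A: "A \<in> Collect compact"
  show "(\<lambda>a. emeasure (case a of (t, x) \<Rightarrow> K (max 0 t) x) A) \<in> borel_measurable (borel \<Otimes>\<^sub>M borel)"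
  proof (cases "A = {}")
    case False
    define u where "u n a = (\<integral>y. tent A (real (Suc n)) y \<partial>K (max 0 (fst a)) (snd a))" for n a
    have "tent A (real (Suc n)) \<in> C_infinity" for n
      using A False by (intro tent_in_C_infinity compact_imp_bounded) auto
    then have "continuous_on UNIV (u n)" for n
      using continuous_semigroup_max[of "tent A (real (Suc n))"] by (simp add: u_def case_prod_unfold)
    then have "u n \<in> borel_measurable (borel \<Otimes>\<^sub>M borel)" for n
      unfolding borel_prod by (rule borel_measurable_continuous_onI)
    moreover have "(\<lambda>n. u n a) \<longlonglongrightarrow> measure (K (max 0 (fst a)) (snd a)) A" for a
      unfolding u_def using A False by (intro tent_integral_tendsto) auto
    ultimately have "(\<lambda>a. measure (K (max 0 (fst a)) (snd a)) A) \<in> borel_measurable (borel \<Otimes>\<^sub>M borel)"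
      by - (rule borel_measurable_LIMSEQ_real[where u = u])
    then show ?thesis by (simp add: case_prod_unfold emeasure_K_eq)
  qed simp
next
  show "sets (borel :: (real ^ 'n) measure) = sigma_sets UNIV (Collect compact)"
    by (rule borel_eq_compact)
qed (auto simp: case_prod_unfold sets_K emeasure_K_UNIV prob_space_imp_subprob_space prob_K)

section \<open>Potential operators and their algebra\<close>

definition transition :: "real \<Rightarrow> (real ^ 'n \<Rightarrow> ennreal) \<Rightarrow> real ^ 'n \<Rightarrow> ennreal"
  where "transition t f x = (\<integral>\<^sup>+y. f y \<partial>K (max 0 t) x)"

text \<open>The time interval is half-open so that consecutive intervals tile \<open>{0..}\<close>
  without overlap.\<close>

definition potential_until :: "real \<Rightarrow> (real ^ 'n \<Rightarrow> ennreal) \<Rightarrow> real ^ 'n \<Rightarrow> ennreal"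
  where "potential_until T f x = (\<integral>\<^sup>+t\<in>{0..<T}. transition t f x \<partial>lborel)"

definition potential :: "(real ^ 'n \<Rightarrow> ennreal) \<Rightarrow> real ^ 'n \<Rightarrow> ennreal"
  where "potential f x = (\<integral>\<^sup>+t\<in>{0..}. transition t f x \<partial>lborel)"

lemma measurable_transition_joint:
  assumes "f \<in> borel_measurable borel"
  shows "(\<lambda>(t, x). transition t f x) \<in> borel_measurable (borel \<Otimes>\<^sub>M borel)"
  using measurable_compose[OF measurable_K_joint nn_integral_measurable_subprob_algebra[OF assms]]
  by (simp add: transition_def case_prod_unfold)

lemma measurable_transition [measurable (raw)]:
  assumes [measurable]: "f \<in> borel_measurable borel" "g \<in> borel_measurable M" "h \<in> borel_measurable M"
  shows "(\<lambda>w. transition (g w) f (h w)) \<in> borel_measurable M"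
proof -
  have "(\<lambda>w. (g w, h w)) \<in> M \<rightarrow>\<^sub>M borel \<Otimes>\<^sub>M borel" by simp
  from measurable_compose[OF this measurable_transition_joint[OF assms(1)]] show ?thesis by simp
qed

lemma measurable_potential_until [measurable]: "f \<in> borel_measurable borel \<Longrightarrow> potential_until T f \<in> borel_measurable borel"
proof -
  assume [measurable]: "f \<in> borel_measurable borel"
  show ?thesis unfolding potential_until_def by measurable
qed

lemma measurable_potential [measurable]: "f \<in> borel_measurable borel \<Longrightarrow> potential f \<in> borel_measurable borel"
proof -
  assume [measurable]: "f \<in> borel_measurable borel"
  show ?thesis unfolding potential_def by measurable
qed

lemma transition_mono: "(\<And>y. f y \<le> g y) \<Longrightarrow> transition t f x \<le> transition t g x"
  unfolding transition_def by (intro nn_integral_mono)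

lemma potential_until_mono: "(\<And>y. f y \<le> g y) \<Longrightarrow> potential_until T f x \<le> potential_until T g x"
  unfolding potential_until_def by (intro nn_integral_mono mult_right_mono transition_mono) auto

lemma potential_mono: "(\<And>y. f y \<le> g y) \<Longrightarrow> potential f x \<le> potential g x"
  unfolding potential_def by (intro nn_integral_mono mult_right_mono transition_mono) auto

lemma potential_until_mono_time: "S \<le> T \<Longrightarrow> potential_until S f x \<le> potential_until T f x"
  unfolding potential_until_def by (intro nn_integral_mono) (auto split: split_indicator)

lemma potential_until_le_potential: "potential_until T f x \<le> potential f x"
  unfolding potential_until_def potential_def by (intro nn_integral_mono) (auto split: split_indicator)

lemma transition_le: "(\<And>y. f y \<le> c) \<Longrightarrow> transition t f x \<le> c"
  using transition_mono[of f "\<lambda>_. c" t x] emeasure_K_UNIV[of "max 0 t" x] space_K[of "max 0 t" x]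
  by (simp add: transition_def)

lemma potential_until_le: "0 \<le> T \<Longrightarrow> (\<And>t. 0 \<le> t \<Longrightarrow> transition t f x \<le> c) \<Longrightarrow> potential_until T f x \<le> ennreal T * c"
proof -
  assume T: "0 \<le> T" and *: "\<And>t. 0 \<le> t \<Longrightarrow> transition t f x \<le> c"
  have "potential_until T f x \<le> (\<integral>\<^sup>+t. c * indicator {0..<T} t \<partial>lborel)"
    unfolding potential_until_def using * by (intro nn_integral_mono) (auto split: split_indicator)
  also have "\<dots> = c * ennreal T" using T by (subst nn_integral_cmult_indicator) auto
  finally show ?thesis by (simp add: mult.commute)
qed

lemma transition_cmult: "f \<in> borel_measurable borel \<Longrightarrow> transition t (\<lambda>y. c * f y) x = c * transition t f x"
  unfolding transition_def by (intro nn_integral_cmult measurable_K) auto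

lemma potential_cmult: "f \<in> borel_measurable borel \<Longrightarrow> potential (\<lambda>y. c * f y) x = c * potential f x"
proof -
  assume f[measurable]: "f \<in> borel_measurable borel"
  show ?thesis unfolding potential_def
    by (simp add: transition_cmult nn_integral_cmult[symmetric] mult.assoc)
qed

lemma transition_add: "f \<in> borel_measurable borel \<Longrightarrow> 0 \<le> s \<Longrightarrow> 0 \<le> t \<Longrightarrow> transition (s + t) f x = transition s (transition t f) x"
  by (simp add: transition_def nn_integral_K_add)

lemma transition_sum:
  assumes [measurable]: "\<And>i. f i \<in> borel_measurable borel"
  shows "transition t (\<lambda>y. \<Sum>i<n. f i y) x = (\<Sum>i<(n::nat). transition t (f i) x)"
  unfolding transition_def by (intro nn_integral_sum measurable_K) auto

lemma potential_until_sum: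
  assumes [measurable]: "\<And>i. f i \<in> borel_measurable borel"
  shows "potential_until T (\<lambda>y. \<Sum>i<n. f i y) x = (\<Sum>i<(n::nat). potential_until T (f i) x)"
  unfolding potential_until_def by (subst nn_integral_sum[symmetric]) (auto simp: transition_sum sum_distrib_right)

lemma transition_Fubini:
  assumes f[measurable]: "f \<in> borel_measurable borel" and [measurable]: "A \<in> sets borel"
    and A: "A \<subseteq> {0..}" and s: "0 \<le> s"
  shows "transition s (\<lambda>y. \<integral>\<^sup>+t\<in>A. transition t f y \<partial>lborel) x = (\<integral>\<^sup>+t\<in>A. transition (s + t) f x \<partial>lborel)"
proof -
  interpret prob_space "K s x" using prob_K s .
  interpret pair_sigma_finite lborel "K s x" by standard
  have [measurable_cong]: "sets (K s x) = sets borel" using sets_K s .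
  have "transition s (\<lambda>y. \<integral>\<^sup>+t\<in>A. transition t f y \<partial>lborel) x = (\<integral>\<^sup>+y. (\<integral>\<^sup>+t. transition t f y * indicator A t \<partial>lborel) \<partial>K s x)"
    using s by (simp add: transition_def[of s])
  also have "\<dots> = (\<integral>\<^sup>+t. (\<integral>\<^sup>+y. transition t f y * indicator A t \<partial>K s x) \<partial>lborel)"
    by (rule Fubini') measurable
  also have "\<dots> = (\<integral>\<^sup>+t. transition (s + t) f x * indicator A t \<partial>lborel)"
    using A s by (intro nn_integral_cong)
      (auto simp: transition_add[OF f s] transition_def[of s] measurable_K nn_integral_multc split: split_indicator)
  finally show ?thesis .
qed

lemma transition_shift:
  assumes f[measurable]: "f \<in> borel_measurable borel" and [measurable]: "A \<in> sets borel"
  shows "(\<integral>\<^sup>+t\<in>A. transition (s + t) f x \<partial>lborel) = (\<integral>\<^sup>+t\<in>(\<lambda>t. t - s) -` A. transition t f x \<partial>lborel)"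
proof -
  have "(\<integral>\<^sup>+t\<in>(\<lambda>t. t - s) -` A. transition t f x \<partial>lborel)
      = (\<integral>\<^sup>+t. transition (s + t) f x * indicator ((\<lambda>t. t - s) -` A) (s + t) \<partial>lborel)"
    using nn_integral_real_affine[of "\<lambda>t. transition t f x * indicator ((\<lambda>t. t - s) -` A) t" 1 s] by simp
  then show ?thesis by (simp add: indicator_def)
qed

lemma transition_potential_until: "f \<in> borel_measurable borel \<Longrightarrow> 0 \<le> s \<Longrightarrow> transition s (potential_until T f) x = (\<integral>\<^sup>+t\<in>{0..<T}. transition (s + t) f x \<partial>lborel)"
  unfolding potential_until_def[abs_def] by (rule transition_Fubini) auto

lemma transition_potential: "f \<in> borel_measurable borel \<Longrightarrow> 0 \<le> s \<Longrightarrow> transition s (potential f) x = (\<integral>\<^sup>+t\<in>{0..}. transition (s + t) f x \<partial>lborel)"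
  unfolding potential_def[abs_def] by (rule transition_Fubini) auto

text \<open>Running the process for time \<open>s\<close> first only discards the occupation that
  takes place before \<open>s\<close>.\<close>

lemma potential_excessive:
  assumes f[measurable]: "f \<in> borel_measurable borel" and s: "0 \<le> s"
  shows "transition s (potential f) x \<le> potential f x"
proof -
  have "transition s (potential f) x = (\<integral>\<^sup>+t\<in>(\<lambda>t. t - s) -` {0..}. transition t f x \<partial>lborel)"
    using transition_potential[OF f s] transition_shift[OF f] by simp
  also have "\<dots> \<le> potential f x"
    unfolding potential_def using s by (intro nn_integral_mono) (auto split: split_indicator)
  finally show ?thesis .
qed

lemma potential_until_add_time:
  assumes f[measurable]: "f \<in> borel_measurable borel" and "0 \<le> S" "0 \<le> T"
  shows "potential_until (S + T) f x = potential_until S f x + transition S (potential_until T f) x"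
proof -
  have "transition S (potential_until T f) x = (\<integral>\<^sup>+t\<in>(\<lambda>t. t - S) -` {0..<T}. transition t f x \<partial>lborel)"
    using transition_potential_until[OF f assms(2)] transition_shift[OF f] by simp
  then have "potential_until S f x + transition S (potential_until T f) x
      = (\<integral>\<^sup>+t. transition t f x * indicator {0..<S} t + transition t f x * indicator ((\<lambda>t. t - S) -` {0..<T}) t \<partial>lborel)"
    unfolding potential_until_def by (simp add: nn_integral_add)
  also have "\<dots> = potential_until (S + T) f x"
    unfolding potential_until_def using assms by (intro nn_integral_cong) (auto split: split_indicator)
  finally show ?thesis by simp
qed

section \<open>Discrete skeletons, maximum principle and comparison of potentials\<close>

lemma potential_until_steps:
  assumes f[measurable]: "f \<in> borel_measurable borel" and T: "0 \<le> T"
  shows "potential_until (real n * T) f x = (\<Sum>k<n. transition (real k * T) (potential_until T f) x)"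
proof (induction n)
  case 0 show ?case by (simp add: potential_until_def)
next
  case (Suc n)
  have "potential_until (real (Suc n) * T) f x = potential_until (real n * T + T) f x" by (simp add: algebra_simps)
  also have "\<dots> = potential_until (real n * T) f x + transition (real n * T) (potential_until T f) x"
    using T by (intro potential_until_add_time) auto
  finally show ?case using Suc by simp
qed

lemma transition_potential_until_commute:
  assumes f[measurable]: "f \<in> borel_measurable borel" and "0 \<le> s"
  shows "transition s (potential_until T f) x = potential_until T (transition s f) x"
  unfolding transition_potential_until[OF assms] unfolding potential_until_def using transition_add[OF f _ assms(2)]
  by (intro nn_integral_cong) (auto simp: add.commute split: split_indicator)

lemma potential_eq_SUP_potential_until:
  assumes f[measurable]: "f \<in> borel_measurable borel" and T: "0 < T"
  shows "potential f x = (SUP n. potential_until (real n * T) f x)"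
proof -
  have "potential f x = (\<integral>\<^sup>+t. (SUP n. transition t f x * indicator {0..<real n * T} t) \<partial>lborel)"
    unfolding potential_def
  proof (intro nn_integral_cong)
    fix t :: real
    obtain n where n: "t / T < real n" using reals_Archimedean2 by blast
    show "transition t f x * indicator {0..} t = (SUP n. transition t f x * indicator {0..<real n * T} t)"
    proof (intro antisym SUP_least)
      have "transition t f x * indicator {0..} t \<le> transition t f x * indicator {0..<real n * T} t"
        using n T by (auto simp: field_simps split: split_indicator)
      then show "transition t f x * indicator {0..} t \<le> (SUP n. transition t f x * indicator {0..<real n * T} t)"
        by (rule SUP_upper2[OF UNIV_I])
    qed (auto split: split_indicator)
  qed
  also have "\<dots> = (SUP n. potential_until (real n * T) f x)"
    unfolding potential_until_def
  proof (intro nn_integral_monotone_convergence_SUP)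
    show "incseq (\<lambda>n t. transition t f x * indicator {0..<real n * T} t)"
      using T by (auto simp: incseq_def le_fun_def split: split_indicator
        intro: less_le_trans mult_right_mono)
  qed simp
  finally show ?thesis .
qed

text \<open>Fubini exchanges the two time integrations; what remains is an average over
  \<open>{0..<T}\<close> of shifted potentials, each at most \<open>potential f x\<close> by
  excessivity.\<close>

lemma potential_potential_until_le:
  assumes f[measurable]: "f \<in> borel_measurable borel" and T: "0 \<le> T"
  shows "potential (potential_until T f) x \<le> ennreal T * potential f x"
proof -
  have "potential (potential_until T f) x = (\<integral>\<^sup>+s. (\<integral>\<^sup>+t. transition (s + t) f x * indicator {0..<T} t * indicator {0..} s \<partial>lborel) \<partial>lborel)"
    unfolding potential_def by (intro nn_integral_cong) (auto simp: transition_potential_until split: split_indicator)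
  also have "\<dots> = (\<integral>\<^sup>+t. (\<integral>\<^sup>+s. transition (s + t) f x * indicator {0..<T} t * indicator {0..} s \<partial>lborel) \<partial>lborel)"
    by (rule lborel_pair.Fubini') measurable
  also have "\<dots> = potential_until T (potential f) x"
    unfolding potential_until_def by (intro nn_integral_cong) (auto simp: transition_potential add.commute split: split_indicator)
  also have "\<dots> \<le> ennreal T * potential f x"
    using T by (intro potential_until_le potential_excessive) auto
  finally show ?thesis .
qed

text \<open>A first-entrance argument in the form of an induction on the number of steps. Outside
  \<open>A\<close> the term at time 0 vanishes, and the remaining sum is one step of the chain
  applied to the shorter sum, which the induction hypothesis bounds at every point.\<close>

lemma maximum_principle:
  assumes h[measurable]: "h \<in> borel_measurable borel" and T: "0 \<le> T"
    and supp: "\<And>x. x \<notin> A \<Longrightarrow> h x = 0"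
    and le: "\<And>x n. x \<in> A \<Longrightarrow> (\<Sum>k<n. transition (real k * T) h x) \<le> m"
  shows "(\<Sum>k<n. transition (real k * T) h x) \<le> m"
proof (induction n arbitrary: x)
  case (Suc n)
  show ?case
  proof (cases "x \<in> A")
    case False
    have "transition (real (Suc k) * T) h x = transition T (transition (real k * T) h) x" for k
      using transition_add[OF h T, of "real k * T" x] T by (simp add: algebra_simps)
    moreover have "transition 0 h x = 0"
      using supp[OF False] by (simp add: transition_def initial nn_integral_return)
    ultimately have "(\<Sum>k<Suc n. transition (real k * T) h x) \<le> transition T (\<lambda>y. \<Sum>k<n. transition (real k * T) h y) x"
      by (subst sum.lessThan_Suc_shift) (simp add: transition_sum)
    also have "\<dots> \<le> m" by (rule transition_le[OF Suc])
    finally show ?thesis .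
  qed (rule le)
qed simp


text \<open>A bound on \<open>potential f\<close> that is known only on \<open>A\<close> becomes a
  bound at every starting point for functions living on \<open>A\<close>. The partial sums of
  \<open>h\<close> along the skeleton of step \<open>T\<close> are dominated by potentials of
  \<open>f\<close>, so the maximum principle applies to them; averaging the skeleton over one period
  recovers continuous time at the cost of the factor \<open>T\<close>.\<close>

lemma bounded_potential_of_support:
  assumes h[measurable]: "h \<in> borel_measurable borel" and T: "0 < T"
    and supp: "\<And>x. x \<notin> A \<Longrightarrow> h x = 0"
    and hQ: "\<And>x. h x \<le> potential_until T f x" and [measurable]: "f \<in> borel_measurable borel"
    and le: "\<And>x. x \<in> A \<Longrightarrow> potential f x \<le> m"
  shows "potential h x \<le> ennreal T * m"
proof -
  have "(\<Sum>k<n. transition (real k * T) h x) \<le> m" for n x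
  proof (rule maximum_principle[OF h _ supp])
    fix x n assume "x \<in> A"
    have "(\<Sum>k<n. transition (real k * T) h x) \<le> (\<Sum>k<n. transition (real k * T) (potential_until T f) x)"
      by (intro sum_mono transition_mono hQ)
    also have "\<dots> = potential_until (real n * T) f x" using T by (simp add: potential_until_steps)
    also have "\<dots> \<le> m" using potential_until_le_potential le[OF \<open>x \<in> A\<close>] by (rule order_trans)
    finally show "(\<Sum>k<n. transition (real k * T) h x) \<le> m" .
  qed (use T in auto)
  then have "potential_until T (\<lambda>y. \<Sum>k<n. transition (real k * T) h y) x \<le> ennreal T * m" for n
    using T by (intro potential_until_le transition_le) auto
  then have "potential_until (real n * T) h x \<le> ennreal T * m" for n
    using T by (simp add: potential_until_steps transition_potential_until_commute potential_until_sum)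
  then show ?thesis
    unfolding potential_eq_SUP_potential_until[OF h T] by (intro SUP_least)
qed

text \<open>The finite horizon provides the integrable majorant: a constant on
  \<open>{0..<T}\<close>.\<close>

lemma potential_until_continuous:
  assumes f: "f \<in> C_infinity" and nn: "\<And>y. 0 \<le> f y"
  shows "continuous_on UNIV (potential_until T (\<lambda>y. ennreal (f y)))"
proof -
  obtain B where B: "B > 0" "\<And>x. \<bar>f x\<bar> \<le> B" using C_infinity_bounded[OF f] by metis
  have transition_eq: "transition t (\<lambda>y. ennreal (f y)) x = ennreal (\<integral>y. f y \<partial>K (max 0 t) x)" for t x
    unfolding transition_def using f B nn
    by (intro nn_integral_eq_integral integrable_K[where B = B]) auto
  have [measurable]: "f \<in> borel_measurable borel" using f by simp
  have bd: "transition t (\<lambda>y. ennreal (f y)) x \<le> ennreal B" for t x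
    using B by (intro transition_le ennreal_leI) (meson abs_le_D1)
  show ?thesis
  proof (intro continuous_on_sequentiallyI)
    fix u :: "nat \<Rightarrow> real ^ 'n" and a assume u: "u \<longlonglongrightarrow> a"
    show "(\<lambda>n. potential_until T (\<lambda>y. ennreal (f y)) (u n)) \<longlonglongrightarrow> potential_until T (\<lambda>y. ennreal (f y)) a"
      unfolding potential_until_def
    proof (rule nn_integral_dominated_convergence[where w = "\<lambda>t. ennreal B * indicator {0..<T} t"])
      show "AE t in lborel. (\<lambda>n. transition t (\<lambda>y. ennreal (f y)) (u n) * indicator {0..<T} t)
          \<longlonglongrightarrow> transition t (\<lambda>y. ennreal (f y)) a * indicator {0..<T} t"
      proof (intro AE_I2)
        fix t :: real
        have "continuous_on UNIV (\<lambda>x. \<integral>y. f y \<partial>K (max 0 t) x)"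
          using feller[OF _ f, of "max 0 t"] C_infinity_continuous by auto
        then have "(\<lambda>n. \<integral>y. f y \<partial>K (max 0 t) (u n)) \<longlonglongrightarrow> (\<integral>y. f y \<partial>K (max 0 t) a)"
          using u by (auto simp: continuous_on_sequentially o_def)
        then show "(\<lambda>n. transition t (\<lambda>y. ennreal (f y)) (u n) * indicator {0..<T} t)
          \<longlonglongrightarrow> transition t (\<lambda>y. ennreal (f y)) a * indicator {0..<T} t"
          unfolding transition_eq by (auto split: split_indicator intro: tendsto_ennrealI)
      qed
      show "(\<integral>\<^sup>+ t. ennreal B * indicator {0..<T} t \<partial>lborel) < \<infinity>"
        by (subst nn_integral_cmult_indicator) (auto simp: ennreal_mult_less_top)
    qed (use bd in \<open>auto intro!: AE_I2 mult_right_mono\<close>)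
  qed
qed

text \<open>Upper semicontinuity: the function is the limit of the continuous potentials of tents,
  all of which lie above it, so the superlevel set is an intersection of closed ones.\<close>

lemma closed_potential_until_ge:
  assumes C: "compact C" "C \<noteq> {}"
  shows "closed {x. c \<le> potential_until T (indicator C) x}"
proof -
  have T: "tent C (real (Suc n)) \<in> C_infinity" for n
    using C by (intro tent_in_C_infinity compact_imp_bounded) auto
  have [measurable]: "C \<in> sets borel" "tent C (real (Suc n)) \<in> borel_measurable borel" for n
    using C T by (auto intro: borel_compact)
  define g where "g n y = ennreal (tent C (real (Suc n)) y)" for n y
  have [measurable]: "g n \<in> borel_measurable borel" for n unfolding g_def by measurable
  have g_le: "g n y \<le> 1" for n y
    unfolding g_def using tent_bounds(2)[of "real (Suc n)" C y] by simp
  have transition_g_le: "transition t (g n) x \<le> 1" for t n x by (intro transition_le g_le)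
  have lim: "(\<lambda>n. potential_until T (g n) x) \<longlonglongrightarrow> potential_until T (indicator C) x" for x
    unfolding potential_until_def
  proof (rule nn_integral_dominated_convergence[where w = "\<lambda>t. indicator {0..<T} t"])
    show "AE t in lborel. (\<lambda>n. transition t (g n) x * indicator {0..<T} t) \<longlonglongrightarrow> transition t (indicator C) x * indicator {0..<T} t"
    proof (intro AE_I2)
      fix t :: real
      interpret prob_space "K (max 0 t) x" by (rule prob_K) simp
      have [measurable_cong]: "sets (K (max 0 t) x) = sets borel" by (rule sets_K) simp
      have "(\<lambda>n. transition t (g n) x) \<longlonglongrightarrow> transition t (indicator C) x"
        unfolding transition_def
      proof (rule nn_integral_dominated_convergence[where w = "\<lambda>_. 1"])
        show "AE y in K (max 0 t) x. (\<lambda>n. g n y) \<longlonglongrightarrow> indicator C y"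
          unfolding g_def using tendsto_ennrealI[OF tent_tendsto[of C]] C
          by (intro AE_I2) (auto simp: compact_imp_closed ennreal_indicator)
      qed (auto simp: g_le emeasure_space_1)
      then show "(\<lambda>n. transition t (g n) x * indicator {0..<T} t) \<longlonglongrightarrow> transition t (indicator C) x * indicator {0..<T} t"
        by (auto split: split_indicator)
    qed
    show "AE t in lborel. transition t (g n) x * indicator {0..<T} t \<le> indicator {0..<T} t" for n
      using transition_g_le[of _ n x] by (auto split: split_indicator)
  qed (auto simp: less_top[symmetric] neq_top_trans less_imp_neq)
  have "potential_until T (indicator C) x \<le> potential_until T (g n) x" for n x
    unfolding g_def using tent_ge_indicator[of C _ "real (Suc n)"]
    by (intro potential_until_mono) (auto simp: ennreal_indicator[symmetric] simp del: of_nat_Suc intro!: ennreal_leI)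
  then have "c \<le> potential_until T (indicator C) x \<longleftrightarrow> (\<forall>n. c \<le> potential_until T (g n) x)" for x
    using lim[of x] by (meson LIMSEQ_le_const order_trans)
  then have "{x. c \<le> potential_until T (indicator C) x} = (\<Inter>n. {x. c \<le> potential_until T (g n) x})" by auto
  moreover have "closed {x. c \<le> potential_until T (g n) x}" for n
    unfolding g_def using tent_bounds(1)[of "real (Suc n)" C]
    by (intro closed_Collect_le continuous_on_const potential_until_continuous T) simp
  ultimately show ?thesis by auto
qed


section \<open>Spreading bounded potentials: the recurrence criterion\<close>

lemma indicator_le_scaled:
  fixes f :: "_ \<Rightarrow> ennreal"
  assumes "0 < n" "\<And>x. x \<in> A \<Longrightarrow> ennreal (1 / real n) \<le> f x"
  shows "indicator A x \<le> of_nat n * f x"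
proof (cases "x \<in> A")
  case True
  have "1 = ennreal (real n * (1 / real n))" using assms(1) by simp
  also have "\<dots> = of_nat n * ennreal (1 / real n)"
    by (subst ennreal_mult) (auto simp: ennreal_of_nat_eq_real_of_nat)
  also have "\<dots> \<le> of_nat n * f x"
    using assms(2)[OF True] by (intro mult_left_mono) auto
  finally show ?thesis using True by simp
qed simp

text \<open>One factor \<open>n\<close> undoes the threshold \<open>1 / n\<close>, the other pays
  for the time horizon \<open>n\<close>.\<close>

lemma potential_indicator_le:
  assumes [measurable]: "f \<in> borel_measurable borel" and "0 < n"
    and A: "\<And>x. x \<in> A \<Longrightarrow> ennreal (1 / real n) \<le> potential_until (real n) f x"
  shows "potential (indicator A) x \<le> of_nat n * (of_nat n * potential f x)"
proof -
  have "potential (indicator A) x \<le> potential (\<lambda>y. of_nat n * potential_until (real n) f y) x"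
    using assms by (intro potential_mono indicator_le_scaled)
  also have "\<dots> = of_nat n * potential (potential_until (real n) f) x" by (intro potential_cmult) measurable
  also have "\<dots> \<le> of_nat n * (ennreal (real n) * potential f x)"
    by (intro mult_left_mono potential_potential_until_le) auto
  finally show ?thesis by (simp add: ennreal_of_nat_eq_real_of_nat)
qed

text \<open>A single index serves as horizon and as inverse threshold; enlarging it relaxes both
  conditions, so a maximum of two indices works.\<close>

lemma potential_until_pos_eventually:
  assumes [measurable]: "f \<in> borel_measurable borel" and "0 < potential f x"
  obtains n where "0 < n" "ennreal (1 / real n) < potential_until (real n) f x"
proof -
  obtain m where m: "0 < potential_until (real m) f x"
    using assms(2) potential_eq_SUP_potential_until[of f 1 x] by (auto simp: less_SUP_iff)
  then obtain z where z: "0 < z" "z < potential_until (real m) f x" using dense by blast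
  then obtain e where e: "0 < e" "ennreal e < potential_until (real m) f x" by (cases z) auto
  obtain k where k: "1 / e < real k" using reals_Archimedean2 by blast
  define n where "n = max m k"
  have "0 < real k" using k e(1) by (meson divide_pos_pos less_trans zero_less_one)
  then have "1 / real n \<le> 1 / real k" by (intro divide_left_mono) (auto simp: n_def)
  also have "\<dots> \<le> e" using k e(1) \<open>0 < real k\<close> by (simp add: field_simps)
  finally have "ennreal (1 / real n) < potential_until (real m) f x"
    using e(2) by (meson ennreal_leI le_less_trans)
  also have "\<dots> \<le> potential_until (real n) f x" by (intro potential_until_mono_time) (simp add: n_def)
  finally show ?thesis using \<open>0 < real k\<close> by (intro that[of n]) (auto simp: n_def max_def)
qed

text \<open>Finiteness at one point is amplified in stages: from a set of positive measure with
  bounded potential to a compact subset of it, to a ball, and to the compact set \<open>S\<close>.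
  Each new set consists of points from which the previous one collects potential at least
  \<open>1 / n\<close> before time \<open>n\<close>, so only finite factors are lost.\<close>

theorem recurrence_criterion:
  assumes sets_psi[measurable_cong]: "sets \<psi> = sets borel" and sf: "sigma_finite_measure \<psi>"
    and irr: "\<And>B x. B \<in> sets borel \<Longrightarrow> emeasure \<psi> B > 0 \<Longrightarrow> potential (indicator B) x > 0"
    and op: "\<And>U. open U \<Longrightarrow> U \<noteq> {} \<Longrightarrow> emeasure \<psi> U > 0"
    and S: "compact S" "potential (indicator S) x0 = \<infinity>"
    and B[measurable]: "B \<in> sets borel" and posB: "emeasure \<psi> B > 0"
  shows "potential (indicator B) x = \<infinity>"
proof (rule ccontr)
  assume fin: "potential (indicator B) x \<noteq> \<infinity>"
  define g where "g = potential (indicator B :: _ \<Rightarrow> ennreal)"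
  have [measurable]: "g \<in> borel_measurable borel" unfolding g_def by measurable
  \<comment> \<open>The first condition bounds the potential on \<open>A n\<close>; the second will
    place a multiple of a finite-horizon potential above the indicator of a subset.\<close>
  define A where "A n = {y. g y \<le> of_nat n \<and> ennreal (1 / real n) \<le> potential_until (real n) (indicator B) y}" for n
  have [measurable]: "A n \<in> sets borel" for n unfolding A_def by measurable
  \<comment> \<open>By excessivity the mean of \<open>g\<close> at any later time is at most
    \<open>g x\<close>, which is finite, so the process started at \<open>x\<close> gives no mass to
    this set; irreducibility then makes it null.\<close>
  have "emeasure \<psi> {y. g y = \<infinity>} = 0"
  proof (rule ccontr)
    assume "emeasure \<psi> {y. g y = \<infinity>} \<noteq> 0"
    then have "0 < potential (indicator {y. g y = \<infinity>}) x"
      by (intro irr) (auto simp: zero_less_iff_neq_zero)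
    moreover have "potential (indicator {y. g y = \<infinity>}) x \<le> 0"
    proof -
      have "transition t (indicator {y. g y = \<infinity>}) x = 0" if "0 \<le> t" for t
      proof -
        have "\<infinity> * transition t (indicator {y. g y = \<infinity>}) x = transition t (\<lambda>y. \<infinity> * indicator {y. g y = \<infinity>} y) x"
          by (intro transition_cmult[symmetric]) measurable
        also have "\<dots> \<le> transition t g x" by (intro transition_mono) (auto split: split_indicator)
        also have "\<dots> \<le> g x" unfolding g_def using that by (intro potential_excessive) measurable
        finally show ?thesis using fin by (auto simp: g_def ennreal_top_mult top_unique split: if_splits)
      qed
      then have "potential (indicator {y. g y = \<infinity>}) x = (\<integral>\<^sup>+t. 0 \<partial>(lborel :: real measure))"
        unfolding potential_def by (intro nn_integral_cong) (auto split: split_indicator)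
      then show ?thesis by simp
    qed
    ultimately show False by simp
  qed
  moreover have "UNIV - {y. g y = \<infinity>} \<subseteq> (\<Union>n. A n)"
  proof
    fix y assume "y \<in> UNIV - {y. g y = \<infinity>}"
    then have "g y \<noteq> \<infinity>" by simp
    then obtain k where k: "g y \<le> of_nat k"
      by (metis ennreal_Ex_less_of_nat infinity_ennreal_def less_imp_le top.not_eq_extremum)
    obtain m where m: "0 < m" "ennreal (1 / real m) < potential_until (real m) (indicator B) y"
      using potential_until_pos_eventually[of "indicator B" y] irr[OF B posB] by auto
    have "g y \<le> of_nat (max k m)" using k by (meson max.cobounded1 of_nat_mono order_trans)
    moreover have "ennreal (1 / real (max k m)) \<le> ennreal (1 / real m)"
      using m(1) by (intro ennreal_leI divide_left_mono) auto
    moreover have "potential_until (real m) (indicator B) y \<le> potential_until (real (max k m)) (indicator B) y"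
      by (intro potential_until_mono_time) auto
    ultimately have "y \<in> A (max k m)" unfolding A_def mem_Collect_eq
      using m(2) by (meson le_less_trans less_imp_le less_le_trans)
    then show "y \<in> (\<Union>n. A n)" by blast
  qed
  moreover have "emeasure \<psi> UNIV > 0" by (rule op) auto
  ultimately have "\<exists>n. emeasure \<psi> (A n) \<noteq> 0"
  proof -
    assume 1: "emeasure \<psi> {y. g y = \<infinity>} = 0" and 2: "UNIV - {y. g y = \<infinity>} \<subseteq> (\<Union>n. A n)"
      and 3: "emeasure \<psi> UNIV > 0"
    show ?thesis
    proof (rule ccontr)
      assume "\<nexists>n. emeasure \<psi> (A n) \<noteq> 0"
      then have "emeasure \<psi> (\<Union>n. A n) = 0" by (intro emeasure_UN_eq_0) auto
      moreover have "emeasure \<psi> UNIV \<le> emeasure \<psi> ({y. g y = \<infinity>} \<union> (\<Union>n. A n))"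
        using 2 by (intro emeasure_mono) auto
      moreover have "\<dots> \<le> emeasure \<psi> {y. g y = \<infinity>} + emeasure \<psi> (\<Union>n. A n)"
        by (intro emeasure_subadditive) auto
      ultimately show False using 1 3 by simp
    qed
  qed
  then obtain n where n: "emeasure \<psi> (A n) > 0" by (auto simp: zero_less_iff_neq_zero)
  then have "A n \<noteq> {}" by auto
  \<comment> \<open>For \<open>n = 0\<close> the threshold \<open>1 / real n\<close> is 0 by
    convention and excludes nothing; it is the bound \<open>g y \<le> 0\<close> that makes
    \<open>A 0\<close> empty.\<close>
  moreover have "g y \<noteq> 0" for y using irr[OF B posB, of y] by (auto simp: g_def)
  ultimately have n0: "0 < n" by (cases n) (auto simp: A_def)
  obtain C where C: "compact C" "C \<subseteq> A n" "emeasure \<psi> C > 0"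
    using positive_measure_compact_subset[OF sets_psi sf _ n] by auto
  have [measurable]: "C \<in> sets borel" using C by (intro borel_compact)
  \<comment> \<open>The three factors come from the threshold \<open>1 / n\<close>, the horizon
    \<open>n\<close> and the bound \<open>n\<close> for \<open>g\<close> on
    \<open>A n\<close>.\<close>
  define M where "M = of_nat n * (ennreal (real n) * (of_nat n :: ennreal))"
  have M_fin: "M < \<infinity>" by (simp add: M_def ennreal_mult_less_top of_nat_less_top)
  have GC: "potential (indicator C) y \<le> M" for y
  proof -
    \<comment> \<open>Cutting off to \<open>A n\<close> gives a function supported where
      \<open>g\<close> is bounded, as the maximum principle demands.\<close>
    define h where "h z = potential_until (real n) (indicator B) z * indicator (A n) z" for z
    have [measurable]: "h \<in> borel_measurable borel" unfolding h_def by measurable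
    have "potential (indicator C) y \<le> potential (\<lambda>z. of_nat n * h z) y"
      using n0 C(2) by (intro potential_mono indicator_le_scaled) (auto simp: h_def A_def)
    also have "\<dots> = of_nat n * potential h y" by (intro potential_cmult) measurable
    also have "potential h y \<le> ennreal (real n) * of_nat n"
    proof (rule bounded_potential_of_support[where A = "A n" and f = "indicator B"])
      show "h z \<le> potential_until (real n) (indicator B) z" for z by (auto simp: h_def split: split_indicator)
      show "potential (indicator B) z \<le> of_nat n" if "z \<in> A n" for z using that by (simp add: A_def g_def)
    qed (use n0 in \<open>auto simp: h_def\<close>)
    finally show ?thesis unfolding M_def by (simp add: mult_left_mono)
  qed
  \<comment> \<open>Shifting the index by one keeps the thresholds away from division by
    zero.\<close>
  define D where "D k = {y. ennreal (1 / real (Suc k)) \<le> potential_until (real (Suc k)) (indicator C) y}" for k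
  have "C \<noteq> {}" using C(3) by auto
  have closed_D: "closed (D k)" for k
    unfolding D_def by (intro closed_potential_until_ge C(1) \<open>C \<noteq> {}\<close>)
  have cover_D: "(\<Union>k. D k) = UNIV"
  proof safe
    fix y
    obtain m where m: "0 < m" "ennreal (1 / real m) < potential_until (real m) (indicator C) y"
      using potential_until_pos_eventually[of "indicator C" y] irr[OF _ C(3)] by auto
    then have "y \<in> D (m - 1)" unfolding D_def by (simp add: less_imp_le del: of_nat_Suc)
    then show "y \<in> (\<Union>k. D k)" by blast
  qed auto
  obtain k where k: "interior (D k) \<noteq> {}"
  proof -
    have "\<exists>k. interior (D k) \<noteq> {}"
    proof (rule ccontr)
      assume *: "\<nexists>k. interior (D k) \<noteq> {}"
      have "(UNIV :: (real ^ 'n) set) \<subseteq> closure (\<Inter>(range (\<lambda>k. - D k)))"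
        using closed_D * by (intro Baire) (auto simp: closure_complement)
      moreover have "(\<Inter>k. - D k) = {}" using cover_D by auto
      ultimately show False by (simp only: closure_empty) auto
    qed
    then show ?thesis using that by blast
  qed
  then obtain c where "c \<in> interior (D k)" by auto
  then obtain r where r: "0 < r" "ball c r \<subseteq> D k" by (meson mem_interior)
  have potential_ball: "potential (indicator (ball c r)) y \<le> of_nat (Suc k) * (of_nat (Suc k) * M)" for y
  proof -
    have "potential (indicator (ball c r)) y \<le> potential (indicator (D k)) y"
      using r(2) by (intro potential_mono) (auto split: split_indicator)
    also have "\<dots> \<le> of_nat (Suc k) * (of_nat (Suc k) * potential (indicator C) y)"
      by (intro potential_indicator_le) (auto simp: D_def simp del: of_nat_Suc)
    also have "\<dots> \<le> of_nat (Suc k) * (of_nat (Suc k) * M)"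
      using GC by (intro mult_left_mono) auto
    finally show ?thesis .
  qed
  \<comment> \<open>With slope \<open>1 / r\<close> the tent is positive exactly on
    \<open>ball c r\<close>. Being continuous, it has continuous finite-horizon potentials, so
    strict superlevel sets are open and compactness of \<open>S\<close> can be used.\<close>
  define f where "f = tent {c} (1 / r)"
  have f: "f \<in> C_infinity" unfolding f_def using r by (intro tent_in_C_infinity) auto
  then have [measurable]: "f \<in> borel_measurable borel" by simp
  have f_nonneg: "0 \<le> f y" for y unfolding f_def using r by (intro tent_bounds) auto
  have f_pos: "0 < f y \<longleftrightarrow> y \<in> ball c r" for y
    unfolding f_def tent_def using r by (auto simp: dist_commute less_max_iff_disj)
  have f_le: "ennreal (f y) \<le> indicator (ball c r) y" for y
    using f_pos[of y] f_nonneg[of y] tent_bounds(2)[of "1 / r" "{c}" y] r(1)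
    by (auto simp: f_def[symmetric] less_le split: split_indicator)
  \<comment> \<open>If the potential of \<open>f\<close> vanished at \<open>y\<close>, then so would
    that of the ball, since \<open>f\<close> is positive there; but the ball has positive
    measure.\<close>
  have potential_f_pos: "0 < potential (\<lambda>y. ennreal (f y)) y" for y
  proof (rule ccontr)
    assume "\<not> 0 < potential (\<lambda>y. ennreal (f y)) y"
    then have "AE t in lborel. transition t (\<lambda>y. ennreal (f y)) y * indicator {0..} t = 0"
      unfolding potential_def by (subst (asm) zero_less_iff_neq_zero) (simp add: nn_integral_0_iff_AE)
    moreover have "transition t (indicator (ball c r)) y = 0" if "transition t (\<lambda>y. ennreal (f y)) y = 0" for t
    proof -
      have [measurable_cong]: "sets (K (max 0 t) y) = sets borel" by (rule sets_K) simp
      have "AE z in K (max 0 t) y. ennreal (f z) = 0"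
        using that by (simp add: transition_def nn_integral_0_iff_AE)
      then have "AE z in K (max 0 t) y. indicator (ball c r) z = (0::ennreal)"
        by eventually_elim (metis f_pos ennreal_eq_0_iff linorder_not_less indicator_simps(2))
      then show ?thesis
        unfolding transition_def by (subst nn_integral_0_iff_AE) (measurable, auto)
    qed
    ultimately have "AE t in lborel. transition t (indicator (ball c r)) y * indicator {0..} t = 0"
      by (auto elim!: eventually_mono)
    then have "potential (indicator (ball c r)) y = 0"
      unfolding potential_def by (subst nn_integral_0_iff_AE) (measurable, simp_all)
    moreover have "0 < potential (indicator (ball c r)) y"
      using r(1) by (intro irr op) auto
    ultimately show False by simp
  qed
  define E where "E m = {y. ennreal (1 / real (Suc m)) < potential_until (real (Suc m)) (\<lambda>y. ennreal (f y)) y}" for m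
  have open_E: "open (E m)" for m
    unfolding E_def by (intro open_Collect_less continuous_on_const potential_until_continuous f f_nonneg)
  have mono_E: "E m \<subseteq> E m'" if "m \<le> m'" for m m'
  proof
    fix y assume "y \<in> E m"
    moreover have "ennreal (1 / real (Suc m')) \<le> ennreal (1 / real (Suc m))"
      using that by (intro ennreal_leI divide_left_mono) auto
    moreover have "potential_until (real (Suc m)) (\<lambda>y. ennreal (f y)) y \<le> potential_until (real (Suc m')) (\<lambda>y. ennreal (f y)) y"
      using that by (intro potential_until_mono_time) auto
    ultimately show "y \<in> E m'" 
      unfolding E_def mem_Collect_eq by (meson le_less_trans less_le_trans)
  qed
  have "S \<subseteq> (\<Union>m. E m)"
  proof
    fix y
    obtain m where m: "0 < m" "ennreal (1 / real m) < potential_until (real m) (\<lambda>y. ennreal (f y)) y"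
      using potential_until_pos_eventually[of "\<lambda>y. ennreal (f y)" y] potential_f_pos by auto
    then have "y \<in> E (m - 1)" unfolding E_def by (simp del: of_nat_Suc)
    then show "y \<in> (\<Union>m. E m)" by blast
  qed
  then obtain I where I: "finite I" "S \<subseteq> (\<Union>m\<in>I. E m)"
    using compactE_image[OF S(1), of UNIV E] open_E by auto
  obtain m where m: "\<And>i. i \<in> I \<Longrightarrow> i \<le> m" using I(1) by (meson finite_nat_set_iff_bounded_le)
  have "S \<subseteq> E m" using I(2) mono_E m by blast
  then have "potential (indicator S) x0 \<le> of_nat (Suc m) * (of_nat (Suc m) * potential (\<lambda>y. ennreal (f y)) x0)"
    by (intro potential_indicator_le) (auto simp: E_def less_imp_le simp del: of_nat_Suc)
  also have "\<dots> \<le> of_nat (Suc m) * (of_nat (Suc m) * (of_nat (Suc k) * (of_nat (Suc k) * M)))"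
    using order_trans[OF potential_mono[OF f_le] potential_ball] by (intro mult_left_mono) auto
  also have "\<dots> < \<infinity>"
    using M_fin by (simp add: ennreal_mult_less_top of_nat_less_top del: of_nat_Suc)
  finally show False using S(2) by simp
qed

end

section \<open>The Fejer kernel\<close>

text \<open>Reduces every transform in d dimensions below to a product of one-dimensional
  ones.\<close>

lemma has_bochner_integral_lborel_prod:
  fixes f :: "'a::euclidean_space \<Rightarrow> real \<Rightarrow> 'b::{real_normed_field, banach, second_countable_topology}"
  assumes f: "\<And>b. b \<in> Basis \<Longrightarrow> has_bochner_integral lborel (f b) (v b)"
  shows "has_bochner_integral lborel (\<lambda>x. \<Prod>b\<in>Basis. f b (x \<bullet> b)) (\<Prod>b\<in>Basis. v b)"
proof -
  interpret product_sigma_finite "\<lambda>_::'a. lborel :: real measure" by standard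
  have int: "integrable lborel (f b)" if "b \<in> Basis" for b
    using f[OF that] by (simp add: has_bochner_integral_iff)
  have [measurable]: "f b \<in> borel_measurable borel" if "b \<in> Basis" for b
    using borel_measurable_integrable[OF int[OF that]] by simp
  have "has_bochner_integral (\<Pi>\<^sub>M b\<in>Basis. lborel) (\<lambda>x. \<Prod>b\<in>Basis. f b (x b)) (\<Prod>b\<in>Basis. v b)"
    using product_integrable_prod[OF _ int, of Basis] product_integral_prod[OF _ int, of Basis] f
    by (auto simp: has_bochner_integral_iff intro!: prod.cong)
  moreover have "(\<Prod>b\<in>Basis. f b (x b)) = (\<Prod>b\<in>Basis. f b ((\<Sum>i\<in>Basis. x i *\<^sub>R i) \<bullet> b))" for x
    by (intro prod.cong) (auto simp: inner_sum_left_Basis)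
  ultimately have "has_bochner_integral (\<Pi>\<^sub>M b\<in>Basis. lborel)
      (\<lambda>x. \<Prod>b\<in>Basis. f b ((\<Sum>i\<in>Basis. x i *\<^sub>R i) \<bullet> b)) (\<Prod>b\<in>Basis. v b)"
    by simp
  then show ?thesis
    by (subst lborel_eq, intro has_bochner_integral_distr) measurable
qed

lemma tendsto_bounded_divide_at_top:
  fixes f :: "real \<Rightarrow> real"
  assumes "\<And>x. \<bar>f x\<bar> \<le> B"
  shows "((\<lambda>x. f x / x) \<longlongrightarrow> 0) at_top"
proof (rule Lim_null_comparison)
  show "eventually (\<lambda>x. norm (f x / x) \<le> B / x) at_top"
    using eventually_gt_at_top[of 0] by eventually_elim (use assms in \<open>auto simp: field_simps\<close>)
  show "((\<lambda>x. B / x) \<longlongrightarrow> 0) at_top" by real_asymp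
qed

text \<open>Integration by parts turns the integral into the Dirichlet integral of
  \<open>sin x / x\<close>, whose limit pi / 2 is known through \<open>Si\<close>; evenness doubles
  it.\<close>

lemma has_bochner_integral_one_minus_cos:
  "has_bochner_integral lborel (\<lambda>x. (1 - cos (c * x)) / x\<^sup>2) (pi * \<bar>c\<bar>)"
proof -
  have main: "has_bochner_integral lborel (\<lambda>x. (1 - cos (c * x)) / x\<^sup>2) (pi * c)" if c: "0 < c" for c :: real
  proof -
    \<comment> \<open>The antiderivative that integration by parts produces on the positive
      half-line.\<close>
    define F where "F x = c * Si (c * x) - (1 - cos (c * x)) / x" for x
    have Si: "((\<lambda>x. Si (c * x)) has_real_derivative sinc (c * x) * c) (at x)" for x
      by (rule DERIV_chain2[OF DERIV_Si]) (auto intro!: derivative_eq_intros)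
    have D: "(F has_real_derivative (1 - cos (c * x)) / x\<^sup>2) (at x)" if "0 < x" for x
    proof -
      have "((\<lambda>x. 1 - cos (c * x)) has_real_derivative c * sin (c * x)) (at x)"
        by (auto intro!: derivative_eq_intros)
      then have "(F has_real_derivative c * (sinc (c * x) * c) - (c * sin (c * x) * x - (1 - cos (c * x)) * 1) / (x * x)) (at x)"
        unfolding F_def using that by (intro DERIV_diff DERIV_cmult Si DERIV_divide DERIV_ident) auto
      moreover have "c * (sinc (c * x) * c) - (c * sin (c * x) * x - (1 - cos (c * x)) * 1) / (x * x) = (1 - cos (c * x)) / x\<^sup>2"
        using that c by (simp add: field_simps power2_eq_square)
      ultimately show ?thesis by simp
    qed
    have Si0: "Si 0 = 0" by (simp add: Si_def zero_ereal_def)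
    have "((\<lambda>x. Si (c * x)) \<longlongrightarrow> Si (c * 0)) (at_right 0)"
      by (intro isCont_tendsto_compose[OF isCont_Si] tendsto_intros)
    moreover have "((\<lambda>x. (1 - cos (c * x)) / x) \<longlongrightarrow> 0) (at_right 0)"
      using c by real_asymp
    ultimately have "(F \<longlongrightarrow> c * Si (c * 0) - 0) (at_right 0)"
      unfolding F_def by (intro tendsto_diff tendsto_mult_left)
    then have lim0: "(F \<longlongrightarrow> 0) (at_right 0)" by (simp add: Si0)
    have "((\<lambda>x. Si (c * x)) \<longlongrightarrow> pi / 2) at_top"
      using c by (intro filterlim_compose[OF Si_at_top] filterlim_tendsto_pos_mult_at_top[OF tendsto_const]) (auto simp: filterlim_ident)
    moreover have "((\<lambda>x. (1 - cos (c * x)) / x) \<longlongrightarrow> 0) at_top"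
    proof (rule tendsto_bounded_divide_at_top)
      show "\<bar>1 - cos (c * x)\<bar> \<le> 2" for x
        using cos_ge_minus_one[of "c * x"] cos_le_one[of "c * x"] by linarith
    qed
    ultimately have "(F \<longlongrightarrow> c * (pi / 2) - 0) at_top"
      unfolding F_def by (intro tendsto_diff tendsto_mult_left)
    then have lim1: "(F \<longlongrightarrow> c * (pi / 2)) at_top" by simp
    have "set_integrable lborel (einterval 0 \<infinity>) (\<lambda>x. (1 - cos (c * x)) / x\<^sup>2)"
      "(LBINT x=0..\<infinity>. (1 - cos (c * x)) / x\<^sup>2) = c * (pi / 2) - 0"
      by (rule interval_integral_FTC_nonneg[of _ _ F]; use D lim0 lim1 in
        \<open>auto simp: ereal_tendsto_simps zero_ereal_def intro!: continuous_intros\<close>)+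
    then have "has_bochner_integral lborel (\<lambda>x. indicator {0<..} x *\<^sub>R ((1 - cos (c * x)) / x\<^sup>2)) (c * (pi / 2))"
      by (simp add: has_bochner_integral_iff set_integrable_def interval_lebesgue_integral_def
          set_lebesgue_integral_def zero_ereal_def)
    \<comment> \<open>The endpoint may be added because the quotient at 0 is 0 by the convention for
      division.\<close>
    then have "has_bochner_integral lborel (\<lambda>x. indicator {0..} x *\<^sub>R ((1 - cos (c * x)) / x\<^sup>2)) (c * (pi / 2))"
      by (rule has_bochner_integral_cong[THEN iffD1, rotated -1]) (auto simp: indicator_def less_le)
    from has_bochner_integral_even_function[OF this] show ?thesis
      by (simp add: mult.commute)
  qed
  show ?thesis
  proof (cases c "0 :: real" rule: linorder_cases)
    case less
    then show ?thesis using main[of "- c"] by simp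
  qed (use main[of c] in auto)
qed

definition fejer :: "real \<Rightarrow> real \<Rightarrow> real"
  where "fejer a x = (sinc (a * x))\<^sup>2"

text \<open>The triangle of height pi / a on the interval from -2a to 2a, written as a second
  difference of the absolute value, the shape in which the computation of the transform delivers
  it.\<close>

definition hat_fun :: "real \<Rightarrow> real \<Rightarrow> real"
  where "hat_fun a y = pi / (4 * a\<^sup>2) * (\<bar>y + 2 * a\<bar> + \<bar>y - 2 * a\<bar> - 2 * \<bar>y\<bar>)"

lemma measurable_fejer [measurable]: "fejer a \<in> borel_measurable borel"
  unfolding fejer_def by measurable

lemma abs_sinc_le_1: "\<bar>sinc x\<bar> \<le> 1"
  using abs_sin_x_le_abs_x[of x] by (auto simp: divide_simps)

lemma fejer_bounds: "0 \<le> fejer a x" "fejer a x \<le> 1"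
  unfolding fejer_def using abs_sinc_le_1[of "a * x"] by (auto simp: abs_square_le_1)

lemma fejer_even: "fejer a (- x) = fejer a x"
  by (simp add: fejer_def)

text \<open>Product-to-sum formulas turn the squared sine times the cosine into a second difference
  in the frequency of \<open>1 - cos\<close>, so three known integrals suffice.\<close>

lemma has_bochner_integral_fejer_cos:
  assumes "0 < a"
  shows "has_bochner_integral lborel (\<lambda>x. fejer a x * cos (x * y)) (hat_fun a y)"
proof -
  define h where "h x = (1 / (4 * a\<^sup>2)) * ((1 - cos ((y + 2 * a) * x)) / x\<^sup>2 + (1 - cos ((y - 2 * a) * x)) / x\<^sup>2
      - 2 * ((1 - cos (y * x)) / x\<^sup>2))" for x
  have "has_bochner_integral lborel h (1 / (4 * a\<^sup>2) * (pi * \<bar>y + 2 * a\<bar> + pi * \<bar>y - 2 * a\<bar> - 2 * (pi * \<bar>y\<bar>)))"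
    unfolding h_def by (intro has_bochner_integral_mult_right has_bochner_integral_diff has_bochner_integral_add
      has_bochner_integral_one_minus_cos)
  moreover have "\<dots> = hat_fun a y" by (simp add: hat_fun_def algebra_simps)
  moreover have "h x = fejer a x * cos (x * y)" if "x \<noteq> 0" for x
  proof -
    have "(1 - cos ((y + 2 * a) * x)) + (1 - cos ((y - 2 * a) * x)) - 2 * (1 - cos (y * x))
        = 2 * cos (y * x) - (cos (y * x + 2 * (a * x)) + cos (y * x - 2 * (a * x)))"
      by (simp add: algebra_simps)
    also have "\<dots> = 2 * cos (y * x) * (1 - cos (2 * (a * x)))"
      by (simp add: cos_add cos_diff algebra_simps)
    also have "\<dots> = 4 * (sin (a * x))\<^sup>2 * cos (y * x)"
      by (simp add: cos_double_sin)
    finally have eq: "(1 - cos ((y + 2 * a) * x)) + (1 - cos ((y - 2 * a) * x)) - 2 * (1 - cos (y * x))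
        = 4 * (sin (a * x))\<^sup>2 * cos (y * x)" .
    have "A / z + B / z - 2 * (C / z) = (A + B - 2 * C) / z" for A B C z :: real
      by (simp add: add_divide_distrib diff_divide_distrib)
    then have "h x = (1 / (4 * a\<^sup>2)) * ((4 * (sin (a * x))\<^sup>2 * cos (y * x)) / x\<^sup>2)"
      unfolding h_def eq[symmetric] by presburger
    then show ?thesis using that assms
      by (simp add: fejer_def field_simps power_mult_distrib power_divide)
  qed
  \<comment> \<open>At 0 the quotients in \<open>h\<close> are 0 by convention while
    \<open>fejer a 0\<close> is 1, so the integrands agree only almost everywhere.\<close>
  then have "AE x in lborel. h x = fejer a x * cos (x * y)"
    using AE_lborel_singleton[of 0] by (auto elim!: eventually_mono)
  ultimately show ?thesis
    by (subst has_bochner_integral_cong_AE[where g = h]) (auto simp: h_def)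
qed

lemma integrable_fejer: "0 < a \<Longrightarrow> integrable lborel (fejer a)"
  using has_bochner_integral_fejer_cos[of a 0] by (simp add: has_bochner_integral_iff)

lemma has_bochner_integral_fejer_iexp:
  assumes "0 < a"
  shows "has_bochner_integral lborel (\<lambda>x. complex_of_real (fejer a x) * iexp (x * y)) (complex_of_real (hat_fun a y))"
proof -
  have int: "integrable lborel (\<lambda>x. fejer a x * sin (x * y))"
    by (rule Bochner_Integration.integrable_bound[OF integrable_fejer[OF assms]])
      (use fejer_bounds in \<open>auto simp: abs_mult intro!: mult_left_le\<close>)
  have "integrable lborel (\<lambda>x. indicator {0..} x *\<^sub>R (fejer a x * sin (x * y)))"
    by (rule integrable_mult_indicator[OF _ int]) auto
  then have "has_bochner_integral lborel (\<lambda>x. indicator {0..} x *\<^sub>R (fejer a x * sin (x * y)))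
      (\<integral>x. indicator {0..} x *\<^sub>R (fejer a x * sin (x * y)) \<partial>lborel)"
    by (rule has_bochner_integral_integrable)
  then have "has_bochner_integral lborel (\<lambda>x. fejer a x * sin (x * y)) 0"
    by (rule has_bochner_integral_odd_function) (simp add: fejer_even)
  then have "has_bochner_integral lborel (\<lambda>x. complex_of_real (fejer a x * cos (x * y)) + \<i> * complex_of_real (fejer a x * sin (x * y)))
     (complex_of_real (hat_fun a y) + \<i> * complex_of_real 0)"
    using has_bochner_integral_fejer_cos[OF assms]
    by (intro has_bochner_integral_add has_bochner_integral_mult_right has_bochner_integral_of_real)
  moreover have "complex_of_real (fejer a x * cos (x * y)) + \<i> * complex_of_real (fejer a x * sin (x * y))
      = complex_of_real (fejer a x) * iexp (x * y)" for x
    by (simp add: complex_eq_iff Re_exp Im_exp)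
  ultimately show ?thesis by simp
qed

lemma hat_fun_nonneg: "0 < a \<Longrightarrow> 0 \<le> hat_fun a y"
  unfolding hat_fun_def by (intro mult_nonneg_nonneg) auto

lemma hat_fun_le: "0 < a \<Longrightarrow> hat_fun a y \<le> pi / a"
proof -
  assume "0 < a"
  then have "hat_fun a y \<le> pi / (4 * a\<^sup>2) * (4 * a)"
    unfolding hat_fun_def by (intro mult_left_mono) auto
  also have "\<dots> = pi / a" using \<open>0 < a\<close> by (simp add: power2_eq_square)
  finally show ?thesis .
qed

lemma hat_fun_eq_0: "0 < a \<Longrightarrow> \<bar>y\<bar> \<ge> 2 * a \<Longrightarrow> hat_fun a y = 0"
  unfolding hat_fun_def by (auto simp: abs_if split: if_splits)

text \<open>The area of a triangle with base 4 and height pi; it becomes the constant in the Fourier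
  inversion of the bump.\<close>

lemma has_bochner_integral_hat_fun_1: "has_bochner_integral lborel (hat_fun 1) (2 * pi)"
proof -
  have "has_bochner_integral lborel (\<lambda>x. (pi / 4 * (4 - 2 * x)) * indicator {0..2} x)
      ((pi / 4 * (4 * 2 - 2\<^sup>2)) - (pi / 4 * (4 * 0 - 0\<^sup>2)))"
    by (rule has_bochner_integral_FTC_Icc_real)
      (auto intro!: derivative_eq_intros continuous_intros)
  moreover have "(pi / 4 * (4 - 2 * x)) * indicator {0..2} x = indicator {0..} x *\<^sub>R hat_fun 1 x" for x
    by (auto simp: hat_fun_def abs_if field_simps split: split_indicator)
  ultimately have "has_bochner_integral lborel (\<lambda>x. indicator {0..} x *\<^sub>R hat_fun 1 x) pi"
    by simp
  moreover have "hat_fun 1 (- x) = hat_fun 1 x" for x by (simp add: hat_fun_def abs_if)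
  ultimately show ?thesis
    using has_bochner_integral_even_function[of "hat_fun 1" pi] by simp
qed

text \<open>Shows that \<open>hat_fun a\<close> acts as an approximate identity of mass 2 pi as
  \<open>a\<close> tends to 0.\<close>

lemma hat_fun_scale: "0 < a \<Longrightarrow> a * hat_fun a (a * s) = hat_fun 1 s"
proof -
  assume a: "0 < a"
  have 1: "a * s + 2 * a = a * (s + 2)" "a * s - 2 * a = a * (s - 2)" by (simp_all add: algebra_simps)
  have abs_a: "\<bar>a * u\<bar> = a * \<bar>u\<bar>" for u using a by (simp add: abs_mult)
  have 2: "a * A + a * B - 2 * (a * C) = a * (A + B - 2 * C)" for A B C :: real by (simp add: algebra_simps)
  have "a * hat_fun a (a * s) = a * (pi / (4 * a\<^sup>2)) * (a * (\<bar>s + 2\<bar> + \<bar>s - 2\<bar> - 2 * \<bar>s\<bar>))"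
    unfolding hat_fun_def 1 abs_a 2 by simp
  then show ?thesis using a by (simp add: hat_fun_def power2_eq_square)
qed

section \<open>A smooth bump function and its Fourier transform\<close>

lemma C_k_Suc_imp: "C_k (Suc k) f \<Longrightarrow> C_k k f"
proof (induction k arbitrary: f)
  case 0
  then show ?case
    by (auto intro!: continuous_at_imp_continuous_on differentiable_imp_continuous_within)
next
  case (Suc k)
  then show ?case by (metis C_k.simps(2))
qed

lemma C_k_const: "C_k k (\<lambda>x. c)"
  by (induction k arbitrary: c) auto

lemma C_k_add: "C_k k f \<Longrightarrow> C_k k g \<Longrightarrow> C_k k (\<lambda>x. f x + g x)"
proof (induction k arbitrary: f g)
  case (Suc k)
  have f: "(f has_derivative frechet_derivative f (at x)) (at x)"
    and g: "(g has_derivative frechet_derivative g (at x)) (at x)" for x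
    using Suc.prems by (auto simp: frechet_derivative_works)
  have fg: "((\<lambda>x. f x + g x) has_derivative
      (\<lambda>v. frechet_derivative f (at x) v + frechet_derivative g (at x) v)) (at x)" for x
    by (rule has_derivative_add[OF f g])
  then have "frechet_derivative (\<lambda>x. f x + g x) (at x) v
      = frechet_derivative f (at x) v + frechet_derivative g (at x) v" for x v
    using frechet_derivative_at[OF fg] by metis
  then show ?case using fg Suc by (auto simp: differentiable_def)
qed (auto intro: continuous_on_add)

lemma C_k_mult: "C_k k f \<Longrightarrow> C_k k g \<Longrightarrow> C_k k (\<lambda>x. f x * g x)"
proof (induction k arbitrary: f g)
  case (Suc k)
  have f: "(f has_derivative frechet_derivative f (at x)) (at x)"
    and g: "(g has_derivative frechet_derivative g (at x)) (at x)" for x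
    using Suc.prems by (auto simp: frechet_derivative_works)
  have fg: "((\<lambda>x. f x * g x) has_derivative
      (\<lambda>v. f x * frechet_derivative g (at x) v + frechet_derivative f (at x) v * g x)) (at x)" for x
    by (rule has_derivative_mult[OF f g])
  then have "frechet_derivative (\<lambda>x. f x * g x) (at x) v
      = f x * frechet_derivative g (at x) v + frechet_derivative f (at x) v * g x" for x v
    using frechet_derivative_at[OF fg] by metis
  moreover have "C_k k (\<lambda>x. f x * frechet_derivative g (at x) v + frechet_derivative f (at x) v * g x)" for v
    using Suc.prems by (intro C_k_add Suc.IH C_k_Suc_imp[OF Suc.prems(1)] C_k_Suc_imp[OF Suc.prems(2)]) auto
  moreover have "(\<lambda>x. f x * g x) differentiable at x" for x
    using fg unfolding differentiable_def by blast
  ultimately show ?case by simp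
qed (auto intro: continuous_on_mult)

lemma C_k_prod: "(\<And>i. i \<in> I \<Longrightarrow> C_k k (f i)) \<Longrightarrow> C_k k (\<lambda>x. \<Prod>i\<in>I. f i x)"
  by (induction I rule: infinite_finite_induct) (auto intro: C_k_mult C_k_const)

text \<open>Taking a whole sequence of successive derivatives \<open>g n\<close> closes the
  induction: each directional derivative is a constant multiple of the same expression with
  \<open>Suc n\<close>, up to the factor \<open>a \<bullet> v\<close>.\<close>

lemma C_k_compose_affine:
  assumes "\<And>n x. (g n has_real_derivative g (Suc n) x) (at x)"
  shows "C_k k (\<lambda>x. g n (c + a \<bullet> x))"
proof (induction k arbitrary: n)
  case 0
  have "continuous_on UNIV (g n)"
    using assms by (intro continuous_at_imp_continuous_on ballI) (metis DERIV_isCont)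
  then show ?case
    by (auto intro!: continuous_on_compose2[of UNIV "g n"] continuous_intros)
next
  case (Suc k)
  have D: "((\<lambda>x. g n (c + a \<bullet> x)) has_derivative (\<lambda>v. g (Suc n) (c + a \<bullet> x) * (a \<bullet> v))) (at x)" for x
  proof -
    have "((\<lambda>x. c + a \<bullet> x) has_derivative (\<lambda>v. a \<bullet> v)) (at x)"
      by (auto intro!: derivative_eq_intros)
    moreover have "(g n has_derivative (*) (g (Suc n) (c + a \<bullet> x))) (at (c + a \<bullet> x))"
      using assms by (simp add: has_field_derivative_def)
    ultimately show ?thesis by (rule has_derivative_compose)
  qed
  have "frechet_derivative (\<lambda>x. g n (c + a \<bullet> x)) (at x) v = g (Suc n) (c + a \<bullet> x) * (a \<bullet> v)" for x v
    using frechet_derivative_at[OF D] by metis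
  then show ?case using D Suc by (auto simp: differentiable_def intro!: C_k_mult C_k_const)
qed

text \<open>In the variable u = 1 / x, differentiating p(u) exp(-u) with respect to x multiplies by
  -u^2 and yields u^2 (p(u) - p'(u)) exp(-u); this is the recursion.\<close>

fun exp_poly :: "nat \<Rightarrow> real poly"
  where
    "exp_poly 0 = 1"
  | "exp_poly (Suc n) = [:0, 0, 1:] * (exp_poly n - pderiv (exp_poly n))"

text \<open>The \<open>n\<close>-th derivative of the smooth function \<open>x \<mapsto> exp (- 1 / x)\<close>, extended by \<open>0\<close> to \<open>x \<le> 0\<close>.\<close>

definition flat_exp :: "nat \<Rightarrow> real \<Rightarrow> real"
  where "flat_exp n x = (if 0 < x then poly (exp_poly n) (1 / x) * exp (- (1 / x)) else 0)"

lemma poly_times_exp_tendsto_0: "((\<lambda>u. poly p u * exp (- u)) \<longlongrightarrow> 0) (at_top :: real filter)"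
proof -
  have "((\<lambda>u. \<Sum>i\<le>degree p. coeff p i * (u ^ i / exp u)) \<longlongrightarrow> (\<Sum>i\<le>degree p. coeff p i * 0)) at_top"
    by (intro tendsto_sum tendsto_mult tendsto_const tendsto_power_div_exp_0)
  moreover have "(\<Sum>i\<le>degree p. coeff p i * (u ^ i / exp u)) = poly p u * exp (- u)" for u
    by (simp add: poly_altdef sum_distrib_right exp_minus divide_inverse mult.assoc)
  ultimately show ?thesis by simp
qed

lemma DERIV_flat_exp: "(flat_exp n has_real_derivative flat_exp (Suc n) x) (at x)"
proof (cases x "0 :: real" rule: linorder_cases)
  case greater
  have "((\<lambda>x. poly (exp_poly n) (1 / x) * exp (- (1 / x))) has_real_derivative flat_exp (Suc n) x) (at x)"
    using greater
    by (auto intro!: derivative_eq_intros DERIV_chain2[OF poly_DERIV] simp: flat_exp_def field_simps power2_eq_square)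
  then show ?thesis
    by (rule has_field_derivative_transform_within_open[of _ _ _ "{0<..}"])
      (use greater in \<open>auto simp: flat_exp_def\<close>)
next
  case less
  have "((\<lambda>x. 0) has_real_derivative flat_exp (Suc n) x) (at x)"
    using less by (simp add: flat_exp_def)
  then show ?thesis
    by (rule has_field_derivative_transform_within_open[of _ _ _ "{..<0}"])
      (use less in \<open>auto simp: flat_exp_def\<close>)
next
  case equal
  \<comment> \<open>The difference quotient at 0 from the right, rewritten in u = 1 / y: dividing by
    y multiplies the polynomial by u, and the exponential still wins.\<close>
  have "((\<lambda>u. poly ([:0, 1:] * exp_poly n) u * exp (- u)) \<longlongrightarrow> 0) at_top"
    by (rule poly_times_exp_tendsto_0)
  from filterlim_compose[OF this filterlim_inverse_at_top_right]
  have "((\<lambda>y. flat_exp n y / y) \<longlongrightarrow> 0) (at_right 0)"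
    by (rule filterlim_cong[THEN iffD1, rotated -1, OF _ refl refl])
      (auto simp: flat_exp_def field_simps intro!: eventually_mono[OF eventually_at_right_less])
  moreover have "((\<lambda>y. flat_exp n y / y) \<longlongrightarrow> 0) (at_left 0)"
    by (rule tendsto_eventually) (auto simp: flat_exp_def eventually_at_filter)
  ultimately have "((\<lambda>y. flat_exp n y / y) \<longlongrightarrow> 0) (at 0)" by (simp add: filterlim_split_at)
  then show ?thesis using equal by (simp add: has_field_derivative_iff flat_exp_def)
qed

lemma flat_exp_0_bounds: "0 \<le> flat_exp 0 x" "flat_exp 0 x \<le> 1"
  by (auto simp: flat_exp_def)

text \<open>The factor \<open>exp 2\<close> normalises the value at 0 to 1, so that the cutoffs
  built from it tend to 1.\<close>

definition bump :: "real \<Rightarrow> real"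
  where "bump x = exp 2 * flat_exp 0 (1 + x) * flat_exp 0 (1 - x)"

lemma bump_bounds: "0 \<le> bump x" "bump x \<le> exp 2"
  unfolding bump_def using flat_exp_0_bounds[of "1 + x"] flat_exp_0_bounds[of "1 - x"]
  by (auto simp: mult.assoc intro!: mult_left_le mult_le_one)

lemma bump_0: "bump 0 = 1"
  by (simp add: bump_def flat_exp_def mult_exp_exp)

lemma bump_eq_0: "1 \<le> \<bar>x\<bar> \<Longrightarrow> bump x = 0"
  by (auto simp: bump_def flat_exp_def)

lemma isCont_bump: "isCont bump x"
proof -
  have cont: "isCont (flat_exp 0) y" for y by (rule DERIV_isCont[OF DERIV_flat_exp])
  have "isCont (\<lambda>x. flat_exp 0 (1 + x)) x"
    by (rule isCont_o2[where g = "flat_exp 0", OF _ cont]) (intro continuous_intros)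
  moreover have "isCont (\<lambda>x. flat_exp 0 (1 - x)) x"
    by (rule isCont_o2[where g = "flat_exp 0", OF _ cont]) (intro continuous_intros)
  ultimately show ?thesis unfolding bump_def by (intro continuous_mult continuous_const)
qed

text \<open>Leibniz sums of the derivatives of the two flat factors. Order four is what the decay
  estimate of the transform uses.\<close>

lemma bump_derivatives:
  obtains b :: "nat \<Rightarrow> real \<Rightarrow> real" where "b 0 = bump"
    "\<And>n x. n < 4 \<Longrightarrow> (b n has_real_derivative b (Suc n) x) (at x)"
    "\<And>n x. n \<le> 4 \<Longrightarrow> isCont (b n) x" "\<And>n x. 1 \<le> \<bar>x\<bar> \<Longrightarrow> b n x = 0"
proof -
  define u where "u n x = exp 2 * flat_exp n (1 + x)" for n x
  define v where "v n x = (- 1) ^ n * flat_exp n (1 - x)" for n x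
  have u: "(u n has_real_derivative u (Suc n) x) (at x)" for n x
    unfolding u_def by (auto intro!: derivative_eq_intros DERIV_chain2[OF DERIV_flat_exp])
  have v: "(v n has_real_derivative v (Suc n) x) (at x)" for n x
    unfolding v_def by (auto intro!: derivative_eq_intros DERIV_chain2[OF DERIV_flat_exp])
  define b where "b n x = (\<Sum>k\<le>n. real (n choose k) * (u k x * v (n - k) x))" for n x
  have cont: "isCont (b n) x" for n x
    unfolding b_def using DERIV_isCont[OF u] DERIV_isCont[OF v] by (intro continuous_intros) auto
  have D: "(b n has_real_derivative b (Suc n) x) (at x)" if "n < 4" for n x
  proof -
    have b_Suc: "b (Suc n) x = (\<Sum>k\<le>n. real (n choose k) * (u k x * v (Suc (n - k)) x + u (Suc k) x * v (n - k) x))"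
    proof -
      \<comment> \<open>Pascal's rule, checked by expanding the sums in the four cases.\<close>
      have "n \<in> {0, 1, 2, 3}" using that by auto
      then show ?thesis by (auto simp: b_def eval_nat_numeral algebra_simps)
    qed
    have "((\<lambda>x. real (n choose k) * (u k x * v (n - k) x)) has_real_derivative
        real (n choose k) * (u k x * v (Suc (n - k)) x + u (Suc k) x * v (n - k) x)) (at x)" for k
      by (intro DERIV_cmult DERIV_cong[OF DERIV_mult[OF u v]]) (simp add: mult.commute)
    then show ?thesis unfolding b_Suc unfolding b_def by (intro DERIV_sum)
  qed
  have "u k x * v m x = 0" if "1 \<le> \<bar>x\<bar>" for k m x
    using that by (auto simp: u_def v_def flat_exp_def)
  then have zero: "b n x = 0" if "1 \<le> \<bar>x\<bar>" for n x using that by (auto simp: b_def intro!: sum.neutral)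
  show ?thesis
  proof (rule that)
    show "b 0 = bump" by (auto simp: b_def bump_def u_def v_def)
  qed (use cont D zero in auto)
qed

section \<open>Decay of the transform of the bump and its inversion at the origin\<close>

definition FT :: "(real \<Rightarrow> real) \<Rightarrow> real \<Rightarrow> complex"
  where "FT g \<eta> = (\<integral>x. iexp (- (\<eta> * x)) * complex_of_real (g x) \<partial>lborel)"

lemma integrable_compact_support:
  fixes g :: "real \<Rightarrow> 'b::{second_countable_topology, banach}"
  assumes "\<And>x. isCont g x" "\<And>x. 1 \<le> \<bar>x\<bar> \<Longrightarrow> g x = 0"
  shows "integrable lborel g"
proof -
  have "integrable lborel (\<lambda>x. indicator {-1..1} x *\<^sub>R g x)"
    using assms(1) by (intro borel_integrable_compact) (auto intro: continuous_at_imp_continuous_on)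
  moreover have "indicator {-1..1} x *\<^sub>R g x = g x" for x
    using assms(2)[of x] by (auto split: split_indicator)
  ultimately show ?thesis by simp
qed

lemma FT_bound:
  assumes "integrable lborel g"
  shows "cmod (FT g \<eta>) \<le> (\<integral>x. \<bar>g x\<bar> \<partial>lborel)"
  unfolding FT_def
  by (rule order_trans[OF integral_norm_bound]) (simp add: norm_mult)

text \<open>Integration by parts: the derivative of the exponential times \<open>g\<close>
  integrates to 0, since \<open>g\<close> vanishes at both ends of the interval from -1 to
  1.\<close>

lemma FT_derivative:
  assumes D: "\<And>x. (g has_real_derivative g' x) (at x)" and cont: "\<And>x. isCont g' x"
    and z: "\<And>x. 1 \<le> \<bar>x\<bar> \<Longrightarrow> g x = 0" "\<And>x. 1 \<le> \<bar>x\<bar> \<Longrightarrow> g' x = 0"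
  shows "FT g' \<eta> = \<i> * complex_of_real \<eta> * FT g \<eta>"
proof -
  have cont_g: "isCont g x" for x using D by (rule DERIV_isCont)
  define e where "e x = iexp (- (\<eta> * x))" for x :: real
  have De: "(e has_vector_derivative (- \<i> * complex_of_real \<eta>) * e x) (at x)" for x
  proof -
    have "((\<lambda>z. exp (- \<i> * complex_of_real \<eta> * z)) has_field_derivative
        (- \<i> * complex_of_real \<eta>) * exp (- \<i> * complex_of_real \<eta> * complex_of_real x)) (at (complex_of_real x))"
      by (auto intro!: derivative_eq_intros)
    from has_vector_derivative_real_field[OF this] show ?thesis
      by (simp add: e_def[abs_def] mult.assoc)
  qed
  have cont_e: "isCont e x" for x
    unfolding e_def by (intro continuous_intros)
  have Dg: "((\<lambda>x. complex_of_real (g x)) has_vector_derivative complex_of_real (g' x)) (at x)" for x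
    using D[of x] by (intro has_vector_derivative_of_real) (simp add: has_real_derivative_iff_has_vector_derivative)
  define f where "f x = e x * complex_of_real (g' x) + (- \<i> * complex_of_real \<eta>) * (e x * complex_of_real (g x))" for x
  have Df: "((\<lambda>x. e x * complex_of_real (g x)) has_vector_derivative f x) (at x)" for x
    using has_vector_derivative_mult[OF De Dg] by (simp add: f_def algebra_simps)
  have "isCont f x" for x
    unfolding f_def by (intro continuous_intros cont_e isCont_of_real cont cont_g)
  then have "has_bochner_integral lborel (\<lambda>x. indicator {-1..1} x *\<^sub>R f x)
      (e 1 * complex_of_real (g 1) - e (- 1) * complex_of_real (g (- 1)))"
    using Df by (intro has_bochner_integral_FTC_Icc)
      (auto intro: has_vector_derivative_at_within continuous_at_imp_continuous_on)
  moreover have "indicator {-1..1} x *\<^sub>R f x = f x" for x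
    using z[of x] by (auto simp: f_def split: split_indicator)
  ultimately have "has_bochner_integral lborel f 0" using z[of 1] z[of "-1"] by simp
  then have "0 = (\<integral>x. f x \<partial>lborel)" by (simp add: has_bochner_integral_iff)
  also have "\<dots> = (\<integral>x. e x * complex_of_real (g' x) \<partial>lborel)
      + (\<integral>x. (- \<i> * complex_of_real \<eta>) * (e x * complex_of_real (g x)) \<partial>lborel)"
    unfolding f_def
    by (intro Bochner_Integration.integral_add integrable_mult_right integrable_compact_support
        continuous_intros cont_e isCont_of_real cont cont_g) (auto simp: z)
  also have "(\<integral>x. (- \<i> * complex_of_real \<eta>) * (e x * complex_of_real (g x)) \<partial>lborel)
      = (- \<i> * complex_of_real \<eta>) * (\<integral>x. e x * complex_of_real (g x) \<partial>lborel)"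
    by (intro integral_mult_right_zero)
  finally show ?thesis by (simp add: FT_def e_def)
qed

lemma FT_measurable [measurable]:
  assumes [measurable]: "g \<in> borel_measurable borel"
  shows "FT g \<in> borel_measurable borel"
  unfolding FT_def[abs_def] by measurable

lemma bump_measurable [measurable]: "bump \<in> borel_measurable borel"
  by (intro borel_measurable_continuous_onI continuous_at_imp_continuous_on) (auto intro: isCont_bump)

lemma integrable_bump: "integrable lborel bump"
  by (intro integrable_compact_support isCont_bump bump_eq_0)

text \<open>Bounding the transforms of the bump and of its fourth derivative controls (1 + \<eta>^4)
  |FT|, hence (1 + \<eta>^2)^2 |FT|. One factor is the weight matching the quadratic growth of the
  symbol, the other is left over for integrability.\<close>

lemma FT_bump_decay:
  obtains C where "\<And>\<eta>. (1 + \<eta>\<^sup>2) * cmod (FT bump \<eta>) \<le> C * inverse (1 + \<eta>\<^sup>2)"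
proof -
  obtain b where b: "b 0 = bump"
    "\<And>n x. n < 4 \<Longrightarrow> (b n has_real_derivative b (Suc n) x) (at x)"
    "\<And>n x. n \<le> 4 \<Longrightarrow> isCont (b n) x" "\<And>n x. 1 \<le> \<bar>x\<bar> \<Longrightarrow> b n x = 0"
    using bump_derivatives by metis
  have step: "FT (b (Suc n)) \<eta> = \<i> * complex_of_real \<eta> * FT (b n) \<eta>" if "n < 4" for n \<eta>
    using that by (intro FT_derivative b) auto
  have "FT (b n) \<eta> = (\<i> * complex_of_real \<eta>) ^ n * FT bump \<eta>" if "n \<le> 4" for n \<eta>
    using that by (induction n) (auto simp: b(1) step)
  from this[of 4] have FT4: "FT (b 4) \<eta> = complex_of_real (\<eta> ^ 4) * FT bump \<eta>" for \<eta>
    by (simp add: power_mult_distrib)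
  define C where "C = (\<integral>x. \<bar>bump x\<bar> \<partial>lborel) + (\<integral>x. \<bar>b 4 x\<bar> \<partial>lborel)"
  have "integrable lborel (b 4)" by (intro integrable_compact_support b) auto
  then have le: "(1 + \<eta> ^ 4) * cmod (FT bump \<eta>) \<le> C" for \<eta>
    using FT_bound[of "b 4" \<eta>] FT_bound[OF integrable_bump, of \<eta>]
    by (simp add: C_def FT4 norm_mult norm_power distrib_right)
  have "(1 + \<eta>\<^sup>2) * cmod (FT bump \<eta>) \<le> (2 * C) * inverse (1 + \<eta>\<^sup>2)" for \<eta>
  proof -
    have "0 \<le> (1 - \<eta>\<^sup>2)\<^sup>2" by simp
    then have "(1 + \<eta>\<^sup>2) * (1 + \<eta>\<^sup>2) \<le> 2 * (1 + \<eta> ^ 4)"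
      by (simp add: power2_eq_square power4_eq_xxxx algebra_simps)
    then have "(1 + \<eta>\<^sup>2) * (1 + \<eta>\<^sup>2) * cmod (FT bump \<eta>) \<le> 2 * (1 + \<eta> ^ 4) * cmod (FT bump \<eta>)"
      by (intro mult_right_mono) auto
    also have "\<dots> \<le> 2 * C" using le[of \<eta>] by (simp only: mult.assoc)
    finally have *: "(1 + \<eta>\<^sup>2) * cmod (FT bump \<eta>) * (1 + \<eta>\<^sup>2) \<le> 2 * C" by (simp add: mult_ac)
    have "0 < 1 + \<eta>\<^sup>2" by (simp add: add_pos_nonneg)
    then show ?thesis using * by (simp add: field_simps)
  qed
  then show ?thesis by (rule that)
qed

lemma integrable_FT_bump_weighted: "integrable lborel (\<lambda>\<eta>. (1 + \<eta>\<^sup>2) * cmod (FT bump \<eta>))"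
proof -
  obtain C where C: "\<And>\<eta>. (1 + \<eta>\<^sup>2) * cmod (FT bump \<eta>) \<le> C * inverse (1 + \<eta>\<^sup>2)"
    using FT_bump_decay by metis
  have "integrable lborel (\<lambda>x::real. inverse (1 + x\<^sup>2))"
    using integrable_inverse_1_plus_square by (simp add: set_integrable_def einterval_def)
  then have "integrable lborel (\<lambda>x. C * inverse (1 + x\<^sup>2))" by (rule integrable_mult_right)
  then show ?thesis
  proof (rule Bochner_Integration.integrable_bound)
    show "AE x in lborel. norm ((1 + x\<^sup>2) * cmod (FT bump x)) \<le> norm (C * inverse (1 + x\<^sup>2))"
    proof (intro AE_I2)
      fix x :: real
      have "norm ((1 + x\<^sup>2) * cmod (FT bump x)) = (1 + x\<^sup>2) * cmod (FT bump x)" by simp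
      then show "norm ((1 + x\<^sup>2) * cmod (FT bump x)) \<le> norm (C * inverse (1 + x\<^sup>2))"
        using C[of x] by (simp add: order_trans[OF _ abs_ge_self])
    qed
  qed simp
qed

lemma integrable_FT_bump: "integrable lborel (FT bump)"
  by (rule Bochner_Integration.integrable_bound[OF integrable_FT_bump_weighted])
    (auto simp: algebra_simps)

text \<open>The damping \<open>fejer a\<close> makes the double integral absolutely convergent, so
  the order can be exchanged; the inner integral is then a triangle, rescaled to
  \<open>a = 1\<close>.\<close>

lemma integral_FT_bump_fejer:
  assumes a: "0 < a"
  shows "(\<integral>\<eta>. FT bump \<eta> * complex_of_real (fejer a \<eta>) \<partial>lborel)
    = complex_of_real (\<integral>s. bump (a * s) * hat_fun 1 s \<partial>lborel)"
proof -
  define f where "f x \<eta> = iexp (- (\<eta> * x)) * complex_of_real (bump x) * complex_of_real (fejer a \<eta>)" for x \<eta> :: real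
  have inner: "(\<integral>\<eta>. f x \<eta> \<partial>lborel) = complex_of_real (bump x * hat_fun a x)" for x
  proof -
    have "(\<integral>\<eta>. f x \<eta> \<partial>lborel) = (\<integral>\<eta>. complex_of_real (bump x) * (complex_of_real (fejer a \<eta>) * iexp (\<eta> * (- x))) \<partial>lborel)"
    proof -
      have "f x \<eta> = complex_of_real (bump x) * (complex_of_real (fejer a \<eta>) * iexp (\<eta> * (- x)))" for \<eta>
        by (simp add: f_def)
      then show ?thesis by presburger
    qed
    also have "\<dots> = complex_of_real (bump x) * complex_of_real (hat_fun a (- x))"
      using has_bochner_integral_fejer_iexp[OF a, of "- x"] by (simp add: has_bochner_integral_iff)
    also have "hat_fun a (- x) = hat_fun a x" by (simp add: hat_fun_def abs_if)
    finally show ?thesis by simp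
  qed
  have "integrable (lborel \<Otimes>\<^sub>M lborel) (\<lambda>(x, \<eta>). bump x * fejer a \<eta>)"
    by (rule lborel_pair.Fubini_integrable)
      (auto intro!: integrable_mult_right integrable_fejer[OF a] integrable_mult_left integrable_norm integrable_bump
        simp: abs_mult)
  then have int: "integrable (lborel \<Otimes>\<^sub>M lborel) (\<lambda>(x, \<eta>). f x \<eta>)"
    by (rule Bochner_Integration.integrable_bound) (auto simp: f_def case_prod_unfold norm_mult)
  have "(\<integral>\<eta>. FT bump \<eta> * complex_of_real (fejer a \<eta>) \<partial>lborel) = (\<integral>\<eta>. (\<integral>x. f x \<eta> \<partial>lborel) \<partial>lborel)"
    by (simp add: FT_def f_def)
  also have "\<dots> = (\<integral>x. (\<integral>\<eta>. f x \<eta> \<partial>lborel) \<partial>lborel)"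
    by (rule lborel_pair.Fubini_integral[OF int])
  also have "\<dots> = (\<integral>x. complex_of_real (bump x * hat_fun a x) \<partial>lborel)"
    by (simp only: inner)
  also have "(\<integral>x. complex_of_real (bump x * hat_fun a x) \<partial>lborel) = complex_of_real (\<integral>x. bump x * hat_fun a x \<partial>lborel)"
    by (rule integral_complex_of_real)
  also have "(\<integral>x. bump x * hat_fun a x \<partial>lborel) = a * (\<integral>s. bump (a * s) * hat_fun a (a * s) \<partial>lborel)"
    using lborel_integral_real_affine[of a "\<lambda>x. bump x * hat_fun a x" 0] a by simp
  also have "\<dots> = (\<integral>s. bump (a * s) * (a * hat_fun a (a * s)) \<partial>lborel)"
    by (subst integral_mult_right_zero[symmetric]) (simp add: mult_ac)
  finally show ?thesis by (simp add: hat_fun_scale[OF a])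
qed

text \<open>Fourier inversion at the origin by Fejer summation. As \<open>a\<close> tends to 0 the
  damping disappears on the frequency side, while on the other side the bump is evaluated at points
  tending to 0 and only \<open>bump 0 = 1\<close> times the mass of the triangle survives.\<close>

lemma has_bochner_integral_FT_bump: "has_bochner_integral lborel (FT bump) (2 * pi)"
proof -
  define a where "a n = 1 / real (Suc n)" for n
  have a: "0 < a n" for n by (simp add: a_def)
  have a0: "a \<longlonglongrightarrow> 0" unfolding a_def using LIMSEQ_inverse_real_of_nat by (simp add: inverse_eq_divide)
  have [measurable]: "hat_fun 1 \<in> borel_measurable borel"
    using borel_measurable_has_bochner_integral[OF has_bochner_integral_hat_fun_1] by simp
  have "(\<lambda>n. \<integral>\<eta>. FT bump \<eta> * complex_of_real (fejer (a n) \<eta>) \<partial>lborel) \<longlonglongrightarrow> (\<integral>\<eta>. FT bump \<eta> \<partial>lborel)"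
  proof (rule integral_dominated_convergence[where w = "\<lambda>\<eta>. cmod (FT bump \<eta>)"])
    show "AE \<eta> in lborel. (\<lambda>n. FT bump \<eta> * complex_of_real (fejer (a n) \<eta>)) \<longlonglongrightarrow> FT bump \<eta>"
    proof (intro AE_I2)
      fix \<eta> :: real
      have "(\<lambda>n. sinc (a n * \<eta>)) \<longlonglongrightarrow> sinc (0 * \<eta>)"
        by (intro isCont_tendsto_compose[OF isCont_sinc] tendsto_intros a0)
      then have "(\<lambda>n. fejer (a n) \<eta>) \<longlonglongrightarrow> 1" unfolding fejer_def by (auto intro: tendsto_eq_intros)
      then have "(\<lambda>n. FT bump \<eta> * complex_of_real (fejer (a n) \<eta>)) \<longlonglongrightarrow> FT bump \<eta> * complex_of_real 1"
        by (intro tendsto_intros)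
      then show "(\<lambda>n. FT bump \<eta> * complex_of_real (fejer (a n) \<eta>)) \<longlonglongrightarrow> FT bump \<eta>" by simp
    qed
    show "AE \<eta> in lborel. norm (FT bump \<eta> * complex_of_real (fejer (a n) \<eta>)) \<le> cmod (FT bump \<eta>)" for n
      using fejer_bounds by (intro AE_I2) (auto simp: norm_mult intro!: mult_left_le)
  qed (auto intro: integrable_norm integrable_FT_bump)
  moreover have "(\<lambda>n. \<integral>s. bump (a n * s) * hat_fun 1 s \<partial>lborel) \<longlonglongrightarrow> (\<integral>s. 1 * hat_fun 1 s \<partial>lborel)"
  proof (rule integral_dominated_convergence[where w = "\<lambda>s. exp 2 * hat_fun 1 s"])
    show "AE s in lborel. (\<lambda>n. bump (a n * s) * hat_fun 1 s) \<longlonglongrightarrow> 1 * hat_fun 1 s"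
    proof (intro AE_I2 tendsto_mult_right)
      fix s :: real
      have "(\<lambda>n. bump (a n * s)) \<longlonglongrightarrow> bump (0 * s)"
        by (intro isCont_tendsto_compose[OF isCont_bump] tendsto_intros a0)
      then show "(\<lambda>n. bump (a n * s)) \<longlonglongrightarrow> 1" by (simp add: bump_0)
    qed
    show "AE s in lborel. norm (bump (a n * s) * hat_fun 1 s) \<le> exp 2 * hat_fun 1 s" for n
      using bump_bounds hat_fun_nonneg[of 1] by (intro AE_I2) (auto simp: abs_mult intro!: mult_right_mono)
  qed (use has_bochner_integral_hat_fun_1 in \<open>auto simp: has_bochner_integral_iff\<close>)
  then have "(\<lambda>n. complex_of_real (\<integral>s. bump (a n * s) * hat_fun 1 s \<partial>lborel)) \<longlonglongrightarrow> complex_of_real (2 * pi)"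
    using has_bochner_integral_hat_fun_1 by (intro tendsto_of_real) (simp add: has_bochner_integral_iff)
  ultimately have "(\<integral>\<eta>. FT bump \<eta> \<partial>lborel) = complex_of_real (2 * pi)"
    using LIMSEQ_unique by (simp only: integral_FT_bump_fejer[OF a]) blast
  then show ?thesis using integrable_FT_bump by (simp add: has_bochner_integral_iff)
qed

section \<open>Products over coordinates and cutoffs at scale k\<close>

lemma one_plus_sum_le_prod:
  fixes a :: "'i \<Rightarrow> real"
  assumes "finite I" "\<And>i. i \<in> I \<Longrightarrow> 0 \<le> a i"
  shows "1 + (\<Sum>i\<in>I. a i) \<le> (\<Prod>i\<in>I. 1 + a i)"
  using assms
proof (induction I rule: finite_induct)
  case (insert i I)
  then have IH: "1 + (\<Sum>i\<in>I. a i) \<le> (\<Prod>i\<in>I. 1 + a i)" and nn: "0 \<le> (\<Sum>i\<in>I. a i)" "0 \<le> a i"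
    by (auto intro: sum_nonneg)
  have "1 + (\<Sum>i\<in>insert i I. a i) \<le> (1 + a i) * (1 + (\<Sum>i\<in>I. a i))"
    using insert nn by (simp add: algebra_simps)
  also have "\<dots> \<le> (1 + a i) * (\<Prod>i\<in>I. 1 + a i)" using IH nn by (intro mult_left_mono) auto
  finally show ?case using insert by simp
qed simp

lemma integral_lborel_affine:
  fixes f :: "'a::euclidean_space \<Rightarrow> 'b::{banach, second_countable_topology}"
  assumes [measurable]: "f \<in> borel_measurable borel" and c: "c \<noteq> 0"
  shows "(\<integral>x. f x \<partial>lborel) = \<bar>c\<bar> ^ DIM('a) *\<^sub>R (\<integral>x. f (t + c *\<^sub>R x) \<partial>lborel)"
  by (subst lborel_affine[OF c, of t]) (simp add: integral_density integral_distr)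

definition FT_bump_d :: "'a::euclidean_space \<Rightarrow> complex"
  where "FT_bump_d \<zeta> = (\<Prod>b\<in>Basis. FT bump (\<zeta> \<bullet> b))"

lemma FT_bump_d_measurable [measurable]: "FT_bump_d \<in> borel_measurable borel"
  unfolding FT_bump_d_def[abs_def] by measurable

lemma has_bochner_integral_FT_bump_d:
  "has_bochner_integral lborel (FT_bump_d :: 'a::euclidean_space \<Rightarrow> complex) ((2 * pi) ^ DIM('a))"
  using has_bochner_integral_lborel_prod[of "\<lambda>_::'a. FT bump" "\<lambda>_. 2 * pi"] has_bochner_integral_FT_bump
  by (simp add: FT_bump_d_def[abs_def] power_mult_distrib)

text \<open>The weight 1 + |\<zeta>|^2 is at most the product of the one-dimensional weights,
  because expanding that product only adds nonnegative mixed terms; the claim then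
  factorises.\<close>

lemma integrable_FT_bump_d_weighted:
  "integrable lborel (\<lambda>\<zeta>::'a::euclidean_space. (1 + (norm \<zeta>)\<^sup>2) * cmod (FT_bump_d \<zeta>))"
proof -
  have "integrable lborel (\<lambda>x::'a. \<Prod>b\<in>Basis. (1 + (x \<bullet> b)\<^sup>2) * cmod (FT bump (x \<bullet> b)))"
    using has_bochner_integral_lborel_prod[of "\<lambda>_::'a. \<lambda>\<eta>. (1 + \<eta>\<^sup>2) * cmod (FT bump \<eta>)"
        "\<lambda>_. \<integral>\<eta>. (1 + \<eta>\<^sup>2) * cmod (FT bump \<eta>) \<partial>lborel"] integrable_FT_bump_weighted
    by (simp add: has_bochner_integral_iff)
  then show ?thesis
  proof (rule Bochner_Integration.integrable_bound)
    show "AE \<zeta>::'a in lborel. norm ((1 + (norm \<zeta>)\<^sup>2) * cmod (FT_bump_d \<zeta>))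
        \<le> norm (\<Prod>b\<in>Basis. (1 + (\<zeta> \<bullet> b)\<^sup>2) * cmod (FT bump (\<zeta> \<bullet> b)))"
    proof (intro AE_I2)
      fix \<zeta> :: 'a
      have "(norm \<zeta>)\<^sup>2 = (\<Sum>b\<in>Basis. (\<zeta> \<bullet> b)\<^sup>2)"
        by (subst power2_norm_eq_inner, subst euclidean_inner) (simp add: power2_eq_square)
      then have "1 + (norm \<zeta>)\<^sup>2 \<le> (\<Prod>b\<in>Basis. 1 + (\<zeta> \<bullet> b)\<^sup>2)"
        using one_plus_sum_le_prod[of Basis "\<lambda>b. (\<zeta> \<bullet> b)\<^sup>2"] by simp
      then have "(1 + (norm \<zeta>)\<^sup>2) * cmod (FT_bump_d \<zeta>) \<le> (\<Prod>b\<in>Basis. 1 + (\<zeta> \<bullet> b)\<^sup>2) * cmod (FT_bump_d \<zeta>)"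
        by (intro mult_right_mono) auto
      also have "\<dots> = (\<Prod>b\<in>Basis. (1 + (\<zeta> \<bullet> b)\<^sup>2) * cmod (FT bump (\<zeta> \<bullet> b)))"
        by (simp add: FT_bump_d_def prod.distrib prod_norm)
      finally have *: "(1 + (norm \<zeta>)\<^sup>2) * cmod (FT_bump_d \<zeta>) \<le> (\<Prod>b\<in>Basis. (1 + (\<zeta> \<bullet> b)\<^sup>2) * cmod (FT bump (\<zeta> \<bullet> b)))" .
      have "norm ((1 + (norm \<zeta>)\<^sup>2) * cmod (FT_bump_d \<zeta>)) = (1 + (norm \<zeta>)\<^sup>2) * cmod (FT_bump_d \<zeta>)" by simp
      also note *
      also have "(\<Prod>b\<in>Basis. (1 + (\<zeta> \<bullet> b)\<^sup>2) * cmod (FT bump (\<zeta> \<bullet> b)))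
          \<le> norm (\<Prod>b\<in>Basis. (1 + (\<zeta> \<bullet> b)\<^sup>2) * cmod (FT bump (\<zeta> \<bullet> b)))"
        unfolding real_norm_def by (rule abs_ge_self)
      finally show "norm ((1 + (norm \<zeta>)\<^sup>2) * cmod (FT_bump_d \<zeta>))
        \<le> norm (\<Prod>b\<in>Basis. (1 + (\<zeta> \<bullet> b)\<^sup>2) * cmod (FT bump (\<zeta> \<bullet> b)))" .
    qed
  qed measurable
qed

text \<open>A product of bumps instead of a radial function, so that its transform is a product over
  the coordinates as well.\<close>

definition cutoff :: "real \<Rightarrow> real ^ 'n \<Rightarrow> real"
  where "cutoff k x = (\<Prod>b\<in>Basis. bump ((x \<bullet> b) / k))"

lemma cutoff_eq_0: "0 < k \<Longrightarrow> b \<in> Basis \<Longrightarrow> k \<le> \<bar>x \<bullet> b\<bar> \<Longrightarrow> cutoff k x = 0"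
  unfolding cutoff_def using bump_eq_0 by (intro prod_zero bexI[of _ b]) auto

lemma cutoff_bounds: "0 \<le> cutoff k x" "cutoff k (x :: real ^ 'n) \<le> exp 2 ^ CARD('n)"
proof -
  show "0 \<le> cutoff k x" unfolding cutoff_def by (intro prod_nonneg bump_bounds)
  have "cutoff k x \<le> (\<Prod>b\<in>(Basis :: (real ^ 'n) set). exp 2)"
    unfolding cutoff_def by (intro prod_mono) (auto intro: bump_bounds)
  then show "cutoff k x \<le> exp 2 ^ CARD('n)" by simp
qed

lemma cutoff_tendsto: "(\<lambda>n. cutoff (real (Suc n)) (x :: real ^ 'n)) \<longlonglongrightarrow> 1"
proof -
  have "(\<lambda>n. bump ((x \<bullet> b) / real (Suc n))) \<longlonglongrightarrow> bump 0" for b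
    by (intro isCont_tendsto_compose[OF isCont_bump] LIMSEQ_Suc[OF lim_const_over_n])
  then have "(\<lambda>n. cutoff (real (Suc n)) x) \<longlonglongrightarrow> (\<Prod>b\<in>(Basis :: (real ^ 'n) set). bump 0)"
    unfolding cutoff_def by (intro tendsto_prod)
  then show ?thesis by (simp add: bump_0)
qed

lemma cutoff_cos_smooth:
  assumes k: "0 < k"
  shows "(\<lambda>x. cutoff k x * cos (\<xi> \<bullet> x)) \<in> C_c_smooth"
proof -
  have flat: "C_k m (\<lambda>x::real ^ 'a. flat_exp 0 (c + a \<bullet> x))" for m c a
    by (intro C_k_compose_affine DERIV_flat_exp)
  have "C_k m (\<lambda>x::real ^ 'a. bump ((x \<bullet> b) / k))" for m b
  proof -
    \<comment> \<open>Each factor is brought to the affine form \<open>c + a \<bullet> x\<close>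
      inside a flat function.\<close>
    have "C_k m (\<lambda>x::real ^ 'a. exp 2 * flat_exp 0 (1 + ((1 / k) *\<^sub>R b) \<bullet> x) * flat_exp 0 (1 + ((- 1 / k) *\<^sub>R b) \<bullet> x))"
      by (intro C_k_mult C_k_const flat)
    then show ?thesis by (simp add: bump_def inner_commute)
  qed
  moreover have "C_k m (\<lambda>x::real ^ 'a. cos (\<xi> \<bullet> x))" for m
  proof -
    \<comment> \<open>Differentiation shifts the phase by pi / 2, which collects all derivatives of
      the cosine in one sequence.\<close>
    define g where "g n x = cos (x + real n * (pi / 2))" for n x
    have "(g n has_real_derivative g (Suc n) x) (at x)" for n x
    proof -
      have "x + real (Suc n) * (pi / 2) = (x + real n * (pi / 2)) + pi / 2" by (simp add: algebra_simps)
      then have "g (Suc n) x = - sin (x + real n * (pi / 2))"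
        unfolding g_def by (simp only: cos_add) simp
      then show ?thesis unfolding g_def by (auto intro!: derivative_eq_intros)
    qed
    from C_k_compose_affine[of g, OF this, of m 0 0 \<xi>] show ?thesis by (simp add: g_def)
  qed
  ultimately have "C_k m (\<lambda>x. cutoff k x * cos (\<xi> \<bullet> x))" for m
    unfolding cutoff_def by (intro C_k_mult C_k_prod)
  moreover have "bounded {x :: real ^ 'a. cutoff k x * cos (\<xi> \<bullet> x) \<noteq> 0}"
  proof (rule bounded_subset)
    show "bounded (cbox (- (k *\<^sub>R One)) (k *\<^sub>R One :: real ^ 'a))" by (rule bounded_cbox)
    show "{x. cutoff k x * cos (\<xi> \<bullet> x) \<noteq> 0} \<subseteq> cbox (- (k *\<^sub>R One)) (k *\<^sub>R One)"
    proof
      fix x :: "real ^ 'a" assume "x \<in> {x. cutoff k x * cos (\<xi> \<bullet> x) \<noteq> 0}"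
      then have "\<bar>x \<bullet> b\<bar> < k" if "b \<in> Basis" for b using cutoff_eq_0[OF k that, of x] by force
      then have "- k \<le> x \<bullet> b \<and> x \<bullet> b \<le> k" if "b \<in> Basis" for b
        using that by (meson abs_le_iff less_imp_le minus_le_iff)
      then show "x \<in> cbox (- (k *\<^sub>R One)) (k *\<^sub>R One)"
        by (auto simp: mem_box)
    qed
  qed
  ultimately show ?thesis by (simp add: C_c_smooth_def)
qed

lemma has_bochner_integral_iexp_cutoff:
  fixes \<theta> :: "real ^ 'n"
  assumes k: "0 < k"
  shows "has_bochner_integral lborel (\<lambda>x. iexp (- (\<theta> \<bullet> x)) * complex_of_real (cutoff k x))
    (complex_of_real (k ^ CARD('n)) * FT_bump_d (k *\<^sub>R \<theta>))"
proof -
  have one: "has_bochner_integral lborel (\<lambda>x. iexp (- (t * x)) * complex_of_real (bump (x / k)))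
      (complex_of_real k * FT bump (k * t))" for t :: real
  proof -
    have int: "integrable lborel (\<lambda>x. iexp (- ((k * t) * x)) * complex_of_real (bump x))"
      by (rule Bochner_Integration.integrable_bound[OF integrable_bump]) (auto simp: norm_mult)
    have "has_bochner_integral lborel (\<lambda>x. iexp (- ((k * t) * (0 + (1 / k) * x))) * complex_of_real (bump (0 + (1 / k) * x)))
        (FT bump (k * t) /\<^sub>R \<bar>1 / k\<bar>)"
      using lborel_has_bochner_integral_real_affine_iff[of "1 / k"
        "\<lambda>x. iexp (- ((k * t) * x)) * complex_of_real (bump x)" "FT bump (k * t)" 0] int k
      by (simp add: has_bochner_integral_iff FT_def)
    then show ?thesis using k by (simp add: scaleR_conv_of_real)
  qed
  have "has_bochner_integral lborel
      (\<lambda>x::real ^ 'n. \<Prod>b\<in>Basis. iexp (- ((\<theta> \<bullet> b) * (x \<bullet> b))) * complex_of_real (bump ((x \<bullet> b) / k)))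
      (\<Prod>b\<in>(Basis :: (real ^ 'n) set). complex_of_real k * FT bump (k * (\<theta> \<bullet> b)))"
    by (rule has_bochner_integral_lborel_prod[OF one])
  moreover have "(\<Prod>b\<in>Basis. iexp (- ((\<theta> \<bullet> b) * (x \<bullet> b))) * complex_of_real (bump ((x \<bullet> b) / k)))
      = iexp (- (\<theta> \<bullet> x)) * complex_of_real (cutoff k x)" for x :: "real ^ 'n"
  proof -
    have "(\<Prod>b\<in>Basis. iexp (- ((\<theta> \<bullet> b) * (x \<bullet> b)))) = iexp (- (\<theta> \<bullet> x))"
      by (subst exp_sum[symmetric])
        (simp_all add: euclidean_inner[of \<theta> x] sum_negf sum_distrib_left)
    then show ?thesis by (simp add: prod.distrib cutoff_def)
  qed
  moreover have "(\<Prod>b\<in>(Basis :: (real ^ 'n) set). complex_of_real k * FT bump (k * (\<theta> \<bullet> b)))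
      = complex_of_real (k ^ CARD('n)) * FT_bump_d (k *\<^sub>R \<theta>)"
    by (simp add: prod.distrib FT_bump_d_def)
  ultimately show ?thesis by simp
qed

text \<open>The cosine is half the sum of two exponentials, each of which translates the transform
  of the cutoff, to \<xi> and to -\<xi>.\<close>

lemma fourier_cutoff_cos:
  fixes \<xi> :: "real ^ 'n"
  assumes k: "0 < k"
  shows "fourier (\<lambda>x. cutoff k x * cos (\<xi> \<bullet> x)) \<eta>
    = complex_of_real (k ^ CARD('n) / (2 * (2 * pi) ^ CARD('n)))
      * (FT_bump_d (k *\<^sub>R (\<eta> - \<xi>)) + FT_bump_d (k *\<^sub>R (\<eta> + \<xi>)))"
proof -
  have "has_bochner_integral lborel
      (\<lambda>x. (iexp (- ((\<eta> - \<xi>) \<bullet> x)) * complex_of_real (cutoff k x) + iexp (- ((\<eta> + \<xi>) \<bullet> x)) * complex_of_real (cutoff k x)) * (1 / 2))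
      ((complex_of_real (k ^ CARD('n)) * FT_bump_d (k *\<^sub>R (\<eta> - \<xi>)) + complex_of_real (k ^ CARD('n)) * FT_bump_d (k *\<^sub>R (\<eta> + \<xi>))) * (1 / 2))"
    by (intro has_bochner_integral_mult_left has_bochner_integral_add has_bochner_integral_iexp_cutoff k)
  moreover have eq: "(iexp (- ((\<eta> - \<xi>) \<bullet> x)) * complex_of_real (cutoff k x) + iexp (- ((\<eta> + \<xi>) \<bullet> x)) * complex_of_real (cutoff k x)) * (1 / 2)
      = iexp (- (\<eta> \<bullet> x)) * complex_of_real (cutoff k x * cos (\<xi> \<bullet> x))" for x
  proof -
    have 1: "iexp (- ((\<eta> - \<xi>) \<bullet> x)) = iexp (- (\<eta> \<bullet> x)) * iexp (\<xi> \<bullet> x)"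
      and 2: "iexp (- ((\<eta> + \<xi>) \<bullet> x)) = iexp (- (\<eta> \<bullet> x)) * iexp (- (\<xi> \<bullet> x))"
      by (simp_all add: mult_exp_exp inner_diff_left inner_add_left algebra_simps)
    have 3: "complex_of_real (cos (\<xi> \<bullet> x)) = (iexp (\<xi> \<bullet> x) + iexp (- (\<xi> \<bullet> x))) / 2"
      unfolding cos_of_real[symmetric] cos_exp_eq by simp
    show ?thesis unfolding 1 2 of_real_mult 3 by (simp add: algebra_simps)
  qed
  ultimately have "has_bochner_integral lborel (\<lambda>x. iexp (- (\<eta> \<bullet> x)) * complex_of_real (cutoff k x * cos (\<xi> \<bullet> x)))
      ((complex_of_real (k ^ CARD('n)) * FT_bump_d (k *\<^sub>R (\<eta> - \<xi>)) + complex_of_real (k ^ CARD('n)) * FT_bump_d (k *\<^sub>R (\<eta> + \<xi>))) * (1 / 2))"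
    unfolding eq by simp
  from has_bochner_integral_integral_eq[OF this] show ?thesis
    unfolding fourier_def by (simp add: algebra_simps add_divide_distrib)
qed

text \<open>An average of \<open>H\<close> around \<xi> at scale 1 / k. The weight is complex-valued
  and has total mass (2 pi)^d, not 1.\<close>

definition smear :: "real \<Rightarrow> real ^ 'n \<Rightarrow> (real ^ 'n \<Rightarrow> complex) \<Rightarrow> complex"
  where "smear k \<xi> H = (\<integral>\<zeta>. H (\<xi> + (1 / k) *\<^sub>R \<zeta>) * FT_bump_d \<zeta> \<partial>lborel)"

text \<open>For \<open>k \<ge> 1\<close> one has 1 + |\<xi> + \<zeta>/k|^2 \<le> 2 (1 + |\<xi>|^2)
  (1 + |\<zeta>|^2), a majorant that does not depend on \<open>k\<close> and is integrable against
  the weight.\<close>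

lemma smear_integrable:
  fixes H :: "real ^ 'n \<Rightarrow> complex"
  assumes [measurable]: "H \<in> borel_measurable borel" and C: "\<And>\<eta>. cmod (H \<eta>) \<le> C * (1 + (norm \<eta>)\<^sup>2)"
    and C0: "0 \<le> C" and k: "1 \<le> k"
  shows smear_dominated: "cmod (H (\<xi> + (1 / k) *\<^sub>R \<zeta>) * FT_bump_d \<zeta>)
      \<le> 2 * C * (1 + (norm \<xi>)\<^sup>2) * ((1 + (norm \<zeta>)\<^sup>2) * cmod (FT_bump_d \<zeta>))"
    and "integrable lborel (\<lambda>\<zeta>. H (\<xi> + (1 / k) *\<^sub>R \<zeta>) * FT_bump_d \<zeta>)"
    and smear_bound: "cmod (smear k \<xi> H)
      \<le> 2 * C * (1 + (norm \<xi>)\<^sup>2) * (\<integral>\<zeta>. (1 + (norm \<zeta>)\<^sup>2) * cmod (FT_bump_d \<zeta>) \<partial>(lborel :: (real ^ 'n) measure))"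
proof -
  show dom: "cmod (H (\<xi> + (1 / k) *\<^sub>R \<zeta>) * FT_bump_d \<zeta>)
      \<le> 2 * C * (1 + (norm \<xi>)\<^sup>2) * ((1 + (norm \<zeta>)\<^sup>2) * cmod (FT_bump_d \<zeta>))" for \<zeta>
  proof -
    define s t where "s = norm \<xi>" and "t = norm \<zeta>"
    have st: "0 \<le> s" "0 \<le> t" by (auto simp: s_def t_def)
    have "norm (\<xi> + (1 / k) *\<^sub>R \<zeta>) \<le> s + (1 / k) * t"
      using norm_triangle_ineq[of \<xi> "(1 / k) *\<^sub>R \<zeta>"] k by (simp add: s_def t_def)
    also have "\<dots> \<le> s + t" using k st mult_right_mono[of "1 / k" 1 t] by simp
    finally have "(norm (\<xi> + (1 / k) *\<^sub>R \<zeta>))\<^sup>2 \<le> (s + t)\<^sup>2" by (intro power_mono) auto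
    also have "\<dots> \<le> 2 * s\<^sup>2 + 2 * t\<^sup>2" using zero_le_power2[of "s - t"] by (simp add: power2_eq_square algebra_simps)
    finally have "1 + (norm (\<xi> + (1 / k) *\<^sub>R \<zeta>))\<^sup>2 \<le> 2 * ((1 + s\<^sup>2) * (1 + t\<^sup>2))"
    proof -
      assume "(norm (\<xi> + (1 / k) *\<^sub>R \<zeta>))\<^sup>2 \<le> 2 * s\<^sup>2 + 2 * t\<^sup>2"
      moreover have "2 * ((1 + s\<^sup>2) * (1 + t\<^sup>2)) = 2 + 2 * s\<^sup>2 + 2 * t\<^sup>2 + 2 * (s\<^sup>2 * t\<^sup>2)"
        by (simp add: algebra_simps)
      moreover have "0 \<le> s\<^sup>2 * t\<^sup>2" by simp
      ultimately show ?thesis by linarith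
    qed
    then have "C * (1 + (norm (\<xi> + (1 / k) *\<^sub>R \<zeta>))\<^sup>2) \<le> C * (2 * ((1 + s\<^sup>2) * (1 + t\<^sup>2)))"
      using C0 by (rule mult_left_mono)
    with C[of "\<xi> + (1 / k) *\<^sub>R \<zeta>"] have "cmod (H (\<xi> + (1 / k) *\<^sub>R \<zeta>)) \<le> C * (2 * ((1 + s\<^sup>2) * (1 + t\<^sup>2)))"
      by linarith
    then have "cmod (H (\<xi> + (1 / k) *\<^sub>R \<zeta>)) * cmod (FT_bump_d \<zeta>) \<le> C * (2 * ((1 + s\<^sup>2) * (1 + t\<^sup>2))) * cmod (FT_bump_d \<zeta>)"
      by (rule mult_right_mono) simp
    then show ?thesis unfolding s_def t_def norm_mult by (simp only: mult_ac)
  qed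
  have intW: "integrable lborel (\<lambda>\<zeta>::real ^ 'n. 2 * C * (1 + (norm \<xi>)\<^sup>2) * ((1 + (norm \<zeta>)\<^sup>2) * cmod (FT_bump_d \<zeta>)))"
    by (intro integrable_mult_right integrable_FT_bump_d_weighted)
  show int: "integrable lborel (\<lambda>\<zeta>. H (\<xi> + (1 / k) *\<^sub>R \<zeta>) * FT_bump_d \<zeta>)"
    by (rule Bochner_Integration.integrable_bound[OF intW])
      (measurable, intro AE_I2, metis abs_ge_self dom order_trans real_norm_def)
  have "cmod (smear k \<xi> H) \<le> (\<integral>\<zeta>. cmod (H (\<xi> + (1 / k) *\<^sub>R \<zeta>) * FT_bump_d \<zeta>) \<partial>lborel)"
    unfolding smear_def by (rule integral_norm_bound)
  also have "\<dots> \<le> (\<integral>\<zeta>. 2 * C * (1 + (norm \<xi>)\<^sup>2) * ((1 + (norm \<zeta>)\<^sup>2) * cmod (FT_bump_d \<zeta>)) \<partial>(lborel :: (real ^ 'n) measure))"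
    by (intro integral_mono dom integrable_norm int intW)
  finally show "cmod (smear k \<xi> H)
      \<le> 2 * C * (1 + (norm \<xi>)\<^sup>2) * (\<integral>\<zeta>. (1 + (norm \<zeta>)\<^sup>2) * cmod (FT_bump_d \<zeta>) \<partial>(lborel :: (real ^ 'n) measure))"
    by simp
qed

lemma smear_tendsto:
  fixes H :: "real ^ 'n \<Rightarrow> complex"
  assumes [measurable]: "H \<in> borel_measurable borel" and C: "\<And>\<eta>. cmod (H \<eta>) \<le> C * (1 + (norm \<eta>)\<^sup>2)"
    and C0: "0 \<le> C" and cont: "isCont H \<xi>"
  shows "(\<lambda>n. smear (real (Suc n)) \<xi> H) \<longlonglongrightarrow> complex_of_real ((2 * pi) ^ CARD('n)) * H \<xi>"
proof -
  have "(\<lambda>n. smear (real (Suc n)) \<xi> H) \<longlonglongrightarrow> (\<integral>\<zeta>. H \<xi> * FT_bump_d \<zeta> \<partial>(lborel :: (real ^ 'n) measure))"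
    unfolding smear_def
  proof (rule integral_dominated_convergence[where
        w = "\<lambda>\<zeta>. 2 * C * (1 + (norm \<xi>)\<^sup>2) * ((1 + (norm \<zeta>)\<^sup>2) * cmod (FT_bump_d \<zeta>))"])
    show "integrable lborel (\<lambda>\<zeta>::real ^ 'n. 2 * C * (1 + (norm \<xi>)\<^sup>2) * ((1 + (norm \<zeta>)\<^sup>2) * cmod (FT_bump_d \<zeta>)))"
      by (intro integrable_mult_right integrable_FT_bump_d_weighted)
    show "AE \<zeta> in lborel. norm (H (\<xi> + (1 / real (Suc n)) *\<^sub>R \<zeta>) * FT_bump_d \<zeta>)
        \<le> 2 * C * (1 + (norm \<xi>)\<^sup>2) * ((1 + (norm \<zeta>)\<^sup>2) * cmod (FT_bump_d \<zeta>))" for n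
      by (intro AE_I2 smear_dominated C C0) auto
    show "AE \<zeta> in lborel. (\<lambda>n. H (\<xi> + (1 / real (Suc n)) *\<^sub>R \<zeta>) * FT_bump_d \<zeta>) \<longlonglongrightarrow> H \<xi> * FT_bump_d \<zeta>"
    proof (intro AE_I2 tendsto_mult_right)
      fix \<zeta> :: "real ^ 'n"
      have "(\<lambda>n. \<xi> + (1 / real (Suc n)) *\<^sub>R \<zeta>) \<longlonglongrightarrow> \<xi> + 0 *\<^sub>R \<zeta>"
        using LIMSEQ_inverse_real_of_nat by (intro tendsto_intros) (simp add: inverse_eq_divide)
      then show "(\<lambda>n. H (\<xi> + (1 / real (Suc n)) *\<^sub>R \<zeta>)) \<longlonglongrightarrow> H \<xi>"
        by (intro isCont_tendsto_compose[OF cont]) simp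
    qed
  qed measurable
  moreover have "(\<integral>\<zeta>. FT_bump_d \<zeta> \<partial>(lborel :: (real ^ 'n) measure)) = complex_of_real ((2 * pi) ^ CARD('n))"
    using has_bochner_integral_integral_eq[OF has_bochner_integral_FT_bump_d[where 'a = "real ^ 'n"]] by simp
  ultimately show ?thesis by (simp add: mult.commute)
qed

text \<open>The substitution \<eta> = \<theta> + \<zeta>/k, with \<theta> one of the two peaks, has
  Jacobian k^(-d), which cancels the k^d in the transform of the cutoff.\<close>

lemma integral_fourier_cutoff_cos:
  fixes \<xi> :: "real ^ 'n" and H :: "real ^ 'n \<Rightarrow> complex"
  assumes [measurable]: "H \<in> borel_measurable borel" and C: "\<And>\<eta>. cmod (H \<eta>) \<le> C * (1 + (norm \<eta>)\<^sup>2)"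
    and C0: "0 \<le> C" and k: "1 \<le> k"
  shows "(\<integral>\<eta>. H \<eta> * fourier (\<lambda>x. cutoff k x * cos (\<xi> \<bullet> x)) \<eta> \<partial>lborel)
    = (smear k \<xi> H + smear k (- \<xi>) H) / complex_of_real (2 * (2 * pi) ^ CARD('n))"
proof -
  have k': "0 < k" using k by simp
  define D where "D = complex_of_real (k ^ CARD('n) / (2 * (2 * pi) ^ CARD('n)))"
  define J where "J \<theta> = (\<lambda>\<eta>. H \<eta> * FT_bump_d (k *\<^sub>R (\<eta> - \<theta>)))" for \<theta>
  have [measurable]: "J \<theta> \<in> borel_measurable borel" for \<theta> unfolding J_def by measurable
  have Jeq: "J \<theta> (\<theta> + (1 / k) *\<^sub>R \<zeta>) = H (\<theta> + (1 / k) *\<^sub>R \<zeta>) * FT_bump_d \<zeta>" for \<theta> \<zeta>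
    using k by (simp add: J_def)
  have J: "(\<integral>\<eta>. J \<theta> \<eta> \<partial>lborel) = complex_of_real ((1 / k) ^ CARD('n)) * smear k \<theta> H" for \<theta>
    using integral_lborel_affine[of "J \<theta>" "1 / k" \<theta>] k
    unfolding Jeq smear_def[symmetric] by (simp add: scaleR_conv_of_real)
  have int: "integrable lborel (J \<theta>)" for \<theta>
  proof -
    have "integrable (distr lborel borel (\<lambda>x. \<theta> + (1 / k) *\<^sub>R x)) (J \<theta>)"
      by (subst integrable_distr_eq) (auto simp: Jeq intro!: smear_integrable C C0 k)
    then show ?thesis
      using k by (subst lborel_affine[of "1 / k" \<theta>]) (auto simp: integrable_density intro!: integrable_scaleR_right)
  qed
  have "(\<integral>\<eta>. H \<eta> * fourier (\<lambda>x. cutoff k x * cos (\<xi> \<bullet> x)) \<eta> \<partial>lborel) = (\<integral>\<eta>. D * (J \<xi> \<eta> + J (- \<xi>) \<eta>) \<partial>lborel)"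
    by (intro Bochner_Integration.integral_cong) (simp_all add: fourier_cutoff_cos[OF k', of \<xi>, folded D_def] J_def algebra_simps)
  also have "\<dots> = D * ((\<integral>\<eta>. J \<xi> \<eta> \<partial>lborel) + (\<integral>\<eta>. J (- \<xi>) \<eta> \<partial>lborel))"
    using int by simp
  also have "\<dots> = D * complex_of_real ((1 / k) ^ CARD('n)) * (smear k \<xi> H + smear k (- \<xi>) H)"
    by (simp add: J algebra_simps)
  also have "D * complex_of_real ((1 / k) ^ CARD('n)) = 1 / complex_of_real (2 * (2 * pi) ^ CARD('n))"
    using k by (simp add: D_def power_divide)
  finally show ?thesis by simp
qed

section \<open>Dynkin's formula\<close>

lemma levy_khintchine_minus: "levy_khintchine a b c \<nu> (- \<xi>) = cnj (levy_khintchine a b c \<nu> \<xi>)"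
proof -
  have eq: "(\<integral>y. iexp ((- \<xi>) \<bullet> y) - 1 - \<i> * complex_of_real (((- \<xi>) \<bullet> y) * indicator {y. norm y \<le> 1} y) \<partial>\<nu>)
      = cnj (\<integral>y. iexp (\<xi> \<bullet> y) - 1 - \<i> * complex_of_real ((\<xi> \<bullet> y) * indicator {y. norm y \<le> 1} y) \<partial>\<nu>)"
    unfolding Bochner_Integration.integral_cnj[symmetric]
    by (intro Bochner_Integration.integral_cong) (simp_all add: exp_cnj)
  show ?thesis
    unfolding levy_khintchine_def eq by (simp add: linear_neg[OF matrix_vector_mul_linear])
qed

text \<open>Second-order Taylor estimate inside the unit ball, the trivial bound 2 outside, where
  the compensator is absent.\<close>

lemma levy_integrand_bound:
  fixes \<xi> y :: "real ^ 'n"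
  shows "cmod (iexp (\<xi> \<bullet> y) - 1 - \<i> * complex_of_real ((\<xi> \<bullet> y) * indicator {y. norm y \<le> 1} y))
    \<le> (2 + (norm \<xi>)\<^sup>2) * min 1 ((norm y)\<^sup>2)"
proof (cases "norm y \<le> 1")
  case True
  have "cmod (iexp (\<xi> \<bullet> y) - (\<Sum>k\<le>1. (\<i> * (\<xi> \<bullet> y)) ^ k / fact k)) \<le> \<bar>\<xi> \<bullet> y\<bar> ^ Suc 1 / fact (Suc 1)"
    by (rule iexp_approx1)
  then have "cmod (iexp (\<xi> \<bullet> y) - 1 - \<i> * complex_of_real (\<xi> \<bullet> y)) \<le> (\<xi> \<bullet> y)\<^sup>2 / 2"
    by (simp add: diff_diff_eq power2_eq_square)
  also have "\<dots> \<le> (\<xi> \<bullet> y)\<^sup>2" by simp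
  also have "\<dots> \<le> (norm \<xi>)\<^sup>2 * (norm y)\<^sup>2"
    using power_mono[OF Cauchy_Schwarz_ineq2[of \<xi> y], of 2] by (simp add: power_mult_distrib)
  also have "\<dots> \<le> (2 + (norm \<xi>)\<^sup>2) * (norm y)\<^sup>2" by (intro mult_right_mono) auto
  also have "(norm y)\<^sup>2 = min 1 ((norm y)\<^sup>2)"
    using True by (intro min_absorb2[symmetric] power_le_one) auto
  finally show ?thesis using True by simp
next
  case False
  then have "1 \<le> (norm y)\<^sup>2" by (simp add: one_le_power)
  moreover have "cmod (iexp (\<xi> \<bullet> y) - 1) \<le> 2"
    using norm_triangle_ineq4[of "iexp (\<xi> \<bullet> y)" 1] by simp
  ultimately show ?thesis using False by (simp add: min_def add_increasing2)
qed

text \<open>Along a convergent sequence of frequencies the norms stay below some \<open>R\<close>,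
  so a single multiple of \<open>min 1 ((norm y)\<^sup>2)\<close> dominates all integrands.\<close>

lemma isCont_levy_khintchine:
  fixes \<nu> :: "(real ^ 'n) measure"
  assumes sets[measurable_cong]: "sets \<nu> = sets borel"
    and fin: "(\<integral>\<^sup>+ y. ennreal (min 1 ((norm y)\<^sup>2)) \<partial>\<nu>) < \<infinity>"
  shows "isCont (levy_khintchine a b c \<nu>) \<xi>"
proof -
  define g where "g \<xi> y = iexp (\<xi> \<bullet> y) - 1 - \<i> * complex_of_real ((\<xi> \<bullet> y) * indicator {y. norm y \<le> 1} y)"
    for \<xi> y :: "real ^ 'n"
  have [measurable]: "{y :: real ^ 'n. norm y \<le> 1} \<in> sets borel" by measurable
  have meas: "g \<xi> \<in> borel_measurable \<nu>" for \<xi> unfolding g_def by measurable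
  have int: "integrable \<nu> (\<lambda>y. min 1 ((norm y)\<^sup>2))"
    using fin by (intro integrableI_nonneg) auto
  have "isCont (\<lambda>\<xi>. \<integral>y. g \<xi> y \<partial>\<nu>) \<xi>"
    unfolding continuous_at_sequentially o_def
  proof (intro allI impI)
    fix u assume u: "u \<longlonglongrightarrow> \<xi>"
    then obtain R where R: "\<And>n. norm (u n) \<le> R"
      using Bseq_def convergentI convergent_imp_Bseq by metis
    show "(\<lambda>n. \<integral>y. g (u n) y \<partial>\<nu>) \<longlonglongrightarrow> (\<integral>y. g \<xi> y \<partial>\<nu>)"
    proof (rule integral_dominated_convergence[where w = "\<lambda>y. (2 + R\<^sup>2) * min 1 ((norm y)\<^sup>2)"])
      show "AE y in \<nu>. (\<lambda>n. g (u n) y) \<longlonglongrightarrow> g \<xi> y"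
        unfolding g_def using u by (intro AE_I2 tendsto_intros)
      show "AE y in \<nu>. norm (g (u n) y) \<le> (2 + R\<^sup>2) * min 1 ((norm y)\<^sup>2)" for n
      proof (intro AE_I2)
        fix y :: "real ^ 'n"
        have "(norm (u n))\<^sup>2 \<le> R\<^sup>2" using R[of n] by (intro power_mono) auto
        then have "(2 + (norm (u n))\<^sup>2) * min 1 ((norm y)\<^sup>2) \<le> (2 + R\<^sup>2) * min 1 ((norm y)\<^sup>2)"
          by (intro mult_right_mono) auto
        with levy_integrand_bound[of "u n" y] show "norm (g (u n) y) \<le> (2 + R\<^sup>2) * min 1 ((norm y)\<^sup>2)"
          unfolding g_def by linarith
      qed
    qed (use meas int in auto)
  qed
  moreover have "isCont (\<lambda>\<xi>. c *v \<xi>) \<xi>"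
    by (intro linear_continuous_at matrix_vector_mul_bounded_linear)
  ultimately have "isCont (\<lambda>\<xi>. complex_of_real a - \<i> * complex_of_real (\<xi> \<bullet> b)
      + complex_of_real (\<xi> \<bullet> (c *v \<xi>)) / 2 - (\<integral>y. g \<xi> y \<partial>\<nu>)) \<xi>"
    by (intro continuous_intros) auto
  then show ?thesis by (simp add: levy_khintchine_def[abs_def] g_def)
qed

section \<open>Generator, Dynkin's formula and bounded limits\<close>

context feller_kernels
begin

text \<open>The error at time \<open>s\<close> is \<open>K s\<close> applied to the error at time 0,
  which the definition of the generator bounds uniformly; hence one \<open>d\<close> serves all
  \<open>s\<close> and \<open>x\<close>.\<close>

lemma semigroup_first_order:
  assumes f: "f \<in> C_infinity" and g: "g \<in> C_infinity"
    and gen: "uniform_limit UNIV (\<lambda>t x. ((\<integral>y. f y \<partial>K t x) - f x) / t) g (at_right 0)" and e: "0 < e"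
  obtains d where "0 < d" "\<And>s t x. 0 \<le> s \<Longrightarrow> s \<le> t \<Longrightarrow> t - s < d \<Longrightarrow>
    \<bar>(\<integral>y. f y \<partial>K t x) - (\<integral>y. f y \<partial>K s x) - (t - s) * (\<integral>y. g y \<partial>K s x)\<bar> \<le> e * (t - s)"
proof -
  obtain B where B: "B > 0" "\<And>x. \<bar>f x\<bar> \<le> B" using C_infinity_bounded[OF f] by metis
  obtain B' where B': "B' > 0" "\<And>x. \<bar>g x\<bar> \<le> B'" using C_infinity_bounded[OF g] by metis
  from uniform_limitD[OF gen e]
  obtain d where d: "d > 0" "\<And>t x. 0 < t \<Longrightarrow> t < d \<Longrightarrow> \<bar>((\<integral>y. f y \<partial>K t x) - f x) / t - g x\<bar> < e"
    by (auto simp: eventually_at_right[of 0 1] dist_real_def)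
  show ?thesis
  proof (rule that[OF d(1)])
    fix s t x assume st: "0 \<le> s" "s \<le> t" "t - s < d"
    show "\<bar>(\<integral>y. f y \<partial>K t x) - (\<integral>y. f y \<partial>K s x) - (t - s) * (\<integral>y. g y \<partial>K s x)\<bar> \<le> e * (t - s)"
    proof (cases "s = t")
      case False
      define h where "h = t - s"
      have h: "0 < h" "h < d" "t = s + h" using st False by (auto simp: h_def)
      have Pf: "(\<lambda>y. \<integral>z. f z \<partial>K h y) \<in> C_infinity" using h f by (intro feller) auto
      have "(\<integral>y. f y \<partial>K t x) = (\<integral>y. (\<integral>z. f z \<partial>K h y) \<partial>K s x)"
        using integral_K_add[of s h f B x] st f B h by auto
      moreover have "integrable (K s x) (\<lambda>y. \<integral>z. f z \<partial>K h y)"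
        using st f B Pf h by (intro integrable_K[where B = B]) (auto intro!: integral_K_bound)
      moreover have "integrable (K s x) f" using st f B by (intro integrable_K[where B = B]) auto
      moreover have "integrable (K s x) g" using st g B' by (intro integrable_K[where B = B']) auto
      ultimately have "(\<integral>y. f y \<partial>K t x) - (\<integral>y. f y \<partial>K s x) - h * (\<integral>y. g y \<partial>K s x)
          = (\<integral>y. ((\<integral>z. f z \<partial>K h y) - f y - h * g y) \<partial>K s x)"
        by simp
      moreover have "\<bar>\<integral>y. ((\<integral>z. f z \<partial>K h y) - f y - h * g y) \<partial>K s x\<bar> \<le> e * h"
      proof (rule integral_K_bound[OF st(1)])
        show "(\<lambda>y. (\<integral>z. f z \<partial>K h y) - f y - h * g y) \<in> borel_measurable borel"
          using f g Pf by simp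
        show "\<bar>(\<integral>z. f z \<partial>K h y) - f y - h * g y\<bar> \<le> e * h" for y
        proof -
          have "(\<integral>z. f z \<partial>K h y) - f y - h * g y = h * (((\<integral>z. f z \<partial>K h y) - f y) / h - g y)"
            using h by (simp add: field_simps)
          then show ?thesis using d(2)[of h y] h by (simp add: abs_mult mult.commute)
        qed
      qed
      ultimately show ?thesis by (simp add: h_def)
    qed simp
  qed
qed

text \<open>The fundamental theorem of calculus for the time evolution of \<open>f\<close> at a
  fixed starting point, whose derivative is the evolution of \<open>g\<close>.\<close>

lemma dynkin_formula:
  assumes f: "f \<in> C_infinity" and g: "g \<in> C_infinity"
    and gen: "uniform_limit UNIV (\<lambda>t x. ((\<integral>y. f y \<partial>K t x) - f x) / t) g (at_right 0)" and T: "0 \<le> T"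
  shows "(\<integral>s. indicator {0..T} s * (\<integral>y. g y \<partial>K (max 0 s) x) \<partial>lborel) = (\<integral>y. f y \<partial>K T x) - f x"
proof -
  define u where "u s = (\<integral>y. f y \<partial>K (max 0 s) x)" for s
  define v where "v s = (\<integral>y. g y \<partial>K (max 0 s) x)" for s
  have D: "(u has_vector_derivative v s) (at s within {0..T})" if s: "s \<in> {0..T}" for s
    unfolding has_vector_derivative_def has_derivative_within_alt
  proof (intro conjI allI impI)
    fix e :: real assume e: "0 < e"
    obtain d where d: "0 < d" "\<And>s t x. 0 \<le> s \<Longrightarrow> s \<le> t \<Longrightarrow> t - s < d \<Longrightarrow>
      \<bar>(\<integral>y. f y \<partial>K t x) - (\<integral>y. f y \<partial>K s x) - (t - s) * (\<integral>y. g y \<partial>K s x)\<bar> \<le> e / 2 * (t - s)"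
      using semigroup_first_order[OF f g gen, of "e / 2"] e by auto
    obtain d' where d': "0 < d'"
      "\<And>s t x. 0 \<le> s \<Longrightarrow> s \<le> t \<Longrightarrow> t - s < d' \<Longrightarrow> \<bar>(\<integral>y. g y \<partial>K t x) - (\<integral>y. g y \<partial>K s x)\<bar> \<le> e / 2"
      using uniformly_continuous_semigroup[OF g, of "e / 2"] e by auto
    show "\<exists>d>0. \<forall>t\<in>{0..T}. norm (t - s) < d \<longrightarrow> norm (u t - u s - (t - s) *\<^sub>R v s) \<le> e * norm (t - s)"
    proof (intro exI[of _ "min d d'"] conjI ballI impI)
      fix t assume t: "t \<in> {0..T}" and ts: "norm (t - s) < min d d'"
      show "norm (u t - u s - (t - s) *\<^sub>R v s) \<le> e * norm (t - s)"
      proof (cases "s \<le> t")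
        case True
        have "\<bar>u t - u s - (t - s) * v s\<bar> \<le> e / 2 * (t - s)"
          using d(2)[of s t x] s t ts True by (auto simp: u_def v_def)
        also have "\<dots> \<le> e * (t - s)" using e True by (intro mult_right_mono) auto
        finally show ?thesis using True by simp
      next
        case False
        \<comment> \<open>To the left of \<open>s\<close> the expansion is available only from the
          earlier time \<open>t\<close> and involves \<open>v t\<close>; continuity of
          \<open>v\<close> replaces it by \<open>v s\<close>, which is why each error gets half of
          \<open>e\<close>.\<close>
        have 1: "\<bar>u s - u t - (s - t) * v t\<bar> \<le> e / 2 * (s - t)"
          using d(2)[of t s x] s t ts False by (auto simp: u_def v_def)
        have "\<bar>v s - v t\<bar> \<le> e / 2"
          using d'(2)[of t s x] s t ts False by (auto simp: v_def)
        then have 2: "\<bar>(s - t) * (v s - v t)\<bar> \<le> e / 2 * (s - t)"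
          using False by (simp add: abs_mult mult.commute mult_right_mono)
        have "u t - u s - (t - s) * v s = - (u s - u t - (s - t) * v t) + (s - t) * (v s - v t)"
          by (simp add: algebra_simps)
        then have "\<bar>u t - u s - (t - s) * v s\<bar> \<le> e / 2 * (s - t) + e / 2 * (s - t)"
          using 1 2 by linarith
        also have "\<dots> = e * \<bar>t - s\<bar>" using False by (simp add: algebra_simps)
        finally show ?thesis by simp
      qed
    qed (use d d' in auto)
  qed (rule bounded_linear_scaleR_left)
  have "continuous_on UNIV (\<lambda>s. case (s, x) of (t, x) \<Rightarrow> \<integral>y. g y \<partial>K (max 0 t) x)"
    by (rule continuous_on_compose2[OF continuous_semigroup_max[OF g]]) (auto intro!: continuous_intros)
  then have "continuous_on {0..T} v" unfolding v_def by (auto intro: continuous_on_subset)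
  from has_bochner_integral_FTC_Icc[OF T D this]
  have "has_bochner_integral lborel (\<lambda>s. indicator {0..T} s *\<^sub>R v s) (u T - u 0)" by simp
  then show ?thesis
    using T by (simp add: has_bochner_integral_iff u_def v_def initial integral_return C_infinity_measurable[OF f])
qed

lemma measurable_integral_K:
  fixes g :: "real ^ 'n \<Rightarrow> real"
  assumes "g \<in> borel_measurable borel"
  shows "(\<lambda>s. \<integral>y. g y \<partial>K (max 0 s) x) \<in> borel_measurable borel"
proof -
  have "(\<lambda>s. (s, x)) \<in> borel \<rightarrow>\<^sub>M borel \<Otimes>\<^sub>M borel" by measurable
  from measurable_compose[OF this measurable_compose[OF measurable_K_joint integral_measurable_subprob_algebra[OF assms]]]
  show ?thesis by simp
qed

text \<open>Carries Dynkin's formula to bounded pointwise limits, which may lie outside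
  \<open>C_infinity\<close>, as the cosine does. Dominated convergence is used twice, under the
  kernel and in time; the lower bound on \<open>g'\<close> then integrates to
  \<open>- T * q\<close>.\<close>

lemma semigroup_lower_bound:
  fixes f g :: "nat \<Rightarrow> real ^ 'n \<Rightarrow> real"
  assumes f: "\<And>n. f n \<in> C_infinity" and g: "\<And>n. g n \<in> C_infinity"
    and gen: "\<And>n. uniform_limit UNIV (\<lambda>t x. ((\<integral>y. f n y \<partial>K t x) - f n x) / t) (g n) (at_right 0)"
    and B: "\<And>n y. \<bar>f n y\<bar> \<le> B" "\<And>n y. \<bar>g n y\<bar> \<le> B"
    and lim: "\<And>y. (\<lambda>n. f n y) \<longlonglongrightarrow> f' y" "\<And>y. (\<lambda>n. g n y) \<longlonglongrightarrow> g' y"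
    and low: "\<And>y. - q \<le> g' y" and T: "0 \<le> T"
  shows "f' x - T * q \<le> (\<integral>y. f' y \<partial>K T x)"
proof -
  have fm [measurable]: "f n \<in> borel_measurable borel" and gm [measurable]: "g n \<in> borel_measurable borel" for n
    using f g by auto
  have f'm [measurable]: "f' \<in> borel_measurable borel" and g'm [measurable]: "g' \<in> borel_measurable borel"
    using borel_measurable_LIMSEQ_real[where u = f, OF _ fm] borel_measurable_LIMSEQ_real[where u = g, OF _ gm] lim
    by auto
  have "\<bar>g' y\<bar> \<le> B" for y
    using lim(2)[of y] B(2) by (intro LIMSEQ_le_const2[OF tendsto_rabs]) auto
  note B' = this
  have conv: "(\<lambda>n. \<integral>y. h n y \<partial>K t x) \<longlonglongrightarrow> (\<integral>y. h' y \<partial>K t x)"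
    if "0 \<le> t" and [measurable]: "\<And>n. h n \<in> borel_measurable borel" "h' \<in> borel_measurable borel"
      and "\<And>n y. \<bar>h n y\<bar> \<le> B" "\<And>y. (\<lambda>n. h n y) \<longlonglongrightarrow> h' y" for h h' t
  proof (rule integral_dominated_convergence[where w = "\<lambda>_. B"])
    show "integrable (K t x) (\<lambda>_. B)" using that by (intro integrable_K[where B = "\<bar>B\<bar>"]) auto
  qed (use that in \<open>auto intro: measurable_K\<close>)
  have eq: "(\<integral>s. indicator {0..T} s * (\<integral>y. g n y \<partial>K (max 0 s) x) \<partial>lborel) = (\<integral>y. f n y \<partial>K T x) - f n x" for n
    by (rule dynkin_formula[OF f g gen T])
  have ind: "integrable lborel (\<lambda>s. c * indicator {0..T} s)" for c :: real
    using T by (intro integrable_mult_right integrable_real_indicator) auto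
  have gK: "\<bar>\<integral>y. g n y \<partial>K (max 0 s) x\<bar> \<le> B" for n s
    by (intro integral_K_bound B) auto
  have gK': "\<bar>\<integral>y. g' y \<partial>K (max 0 s) x\<bar> \<le> B" for s
    by (intro integral_K_bound B') auto
  have "(\<lambda>n. \<integral>s. indicator {0..T} s * (\<integral>y. g n y \<partial>K (max 0 s) x) \<partial>lborel)
      \<longlonglongrightarrow> (\<integral>s. indicator {0..T} s * (\<integral>y. g' y \<partial>K (max 0 s) x) \<partial>lborel)"
  proof (rule integral_dominated_convergence[where w = "\<lambda>s. B * indicator {0..T} s"])
    show "AE s in lborel. (\<lambda>n. indicator {0..T} s * (\<integral>y. g n y \<partial>K (max 0 s) x))
        \<longlonglongrightarrow> indicator {0..T} s * (\<integral>y. g' y \<partial>K (max 0 s) x)"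
      using B(2) lim(2) by (intro AE_I2 tendsto_mult_left conv) auto
    show "AE s in lborel. norm (indicator {0..T} s * (\<integral>y. g n y \<partial>K (max 0 s) x)) \<le> B * indicator {0..T} s" for n
    proof (intro AE_I2)
      fix s show "norm (indicator {0..T} s * (\<integral>y. g n y \<partial>K (max 0 s) x)) \<le> B * indicator {0..T} s"
        using gK[where n = n and s = s] by (auto simp: indicator_def)
    qed
  qed (use ind measurable_integral_K in auto)
  moreover have "(\<lambda>n. (\<integral>y. f n y \<partial>K T x) - f n x) \<longlonglongrightarrow> (\<integral>y. f' y \<partial>K T x) - f' x"
    by (intro tendsto_diff conv lim B T) auto
  ultimately have "(\<integral>y. f' y \<partial>K T x) - f' x = (\<integral>s. indicator {0..T} s * (\<integral>y. g' y \<partial>K (max 0 s) x) \<partial>lborel)"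
    unfolding eq using LIMSEQ_unique by blast
  also have "\<dots> \<ge> (\<integral>s. (- q) * indicator {0..T} s \<partial>lborel)"
  proof (rule integral_mono[OF ind])
    show "integrable lborel (\<lambda>s. indicator {0..T} s * (\<integral>y. g' y \<partial>K (max 0 s) x))"
    proof (rule Bochner_Integration.integrable_bound[OF ind[of B]])
      show "AE s in lborel. norm (indicator {0..T} s * (\<integral>y. g' y \<partial>K (max 0 s) x)) \<le> norm (B * indicator {0..T} s)"
      proof (intro AE_I2)
        fix s show "norm (indicator {0..T} s * (\<integral>y. g' y \<partial>K (max 0 s) x)) \<le> norm (B * indicator {0..T} s)"
          using gK'[where s = s] by (auto simp: indicator_def)
      qed
    qed (use measurable_integral_K[OF g'm] in simp)
    show "- q * indicator {0..T} s \<le> indicator {0..T} s * (\<integral>y. g' y \<partial>K (max 0 s) x)" for s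
    proof -
      interpret prob_space "K (max 0 s) x" by (rule prob_K) simp
      have "integrable (K (max 0 s) x) g'" using B' by (intro integrable_K[where B = B]) auto
      then have "- q \<le> (\<integral>y. g' y \<partial>K (max 0 s) x)" using low by (intro integral_ge_const) auto
      then show ?thesis by (auto split: split_indicator)
    qed
  qed
  also have "(\<integral>s. (- q) * indicator {0..T} s \<partial>lborel) = - q * T" using T by simp
  finally show ?thesis by (simp add: algebra_simps)
qed

end

section \<open>From the process to its transition kernels\<close>

lemma feller_process_measurable:
  assumes "feller_process M P F" and "0 \<le> t"
  shows "F t \<in> P x \<rightarrow>\<^sub>M borel"
proof -
  have "sets (P x) = sets M" "F t \<in> M \<rightarrow>\<^sub>M borel"
    using assms by (auto simp: feller_process_def markov_process_def)
  then show ?thesis using measurable_cong_sets by blast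
qed

lemma feller_kernels_distr:
  assumes "feller_process M P F"
  shows "feller_kernels (\<lambda>t x. distr (P x) borel (F t))"
proof -
  have mp: "markov_process M P F"
    and fl: "\<And>t f. 0 \<le> t \<Longrightarrow> f \<in> C_infinity \<Longrightarrow> transition_semigroup P F t f \<in> C_infinity"
    and sc: "\<And>f. f \<in> C_infinity \<Longrightarrow> uniform_limit UNIV (\<lambda>t. transition_semigroup P F t f) f (at_right 0)"
    using assms unfolding feller_process_def by auto
  have ps: "prob_space (P x)" and sets: "sets (P x) = sets M" for x
    using mp unfolding markov_process_def by auto
  have space: "space (P x) = space M" for x using sets by (rule sets_eq_imp_space_eq)
  note F = feller_process_measurable[OF assms]
  have hit: "emeasure (distr (P x) borel (F t)) B = hit_prob P F t x B" if "0 \<le> t" "B \<in> sets borel" for t x B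
    using emeasure_distr[OF F[OF that(1)] that(2)] unfolding hit_prob_def
    by (simp add: vimage_def Int_def conj_commute)
  have hm: "(\<lambda>x. hit_prob P F t x B) \<in> borel_measurable borel" if "0 \<le> t" "B \<in> sets borel" for t B
    using mp that unfolding markov_process_def by auto
  have pk: "prob_space (distr (P x) borel (F t))" if "0 \<le> t" for t x
    using prob_space.prob_space_distr[OF ps F[OF that]] .
  have mk: "(\<lambda>x. distr (P x) borel (F t)) \<in> borel \<rightarrow>\<^sub>M subprob_algebra borel" if "0 \<le> t" for t
    using pk hm that by (intro measurable_subprob_algebra)
      (auto simp: hit prob_space_imp_subprob_space)
  have ts: "(\<integral>y. f y \<partial>distr (P x) borel (F t)) = transition_semigroup P F t f x"
    if "0 \<le> t" "f \<in> C_infinity" for t f x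
    unfolding transition_semigroup_def using F that by (intro integral_distr) auto
  show ?thesis
  proof (rule feller_kernels.intro)
    fix s t :: real and x assume st: "0 \<le> s" "0 \<le> t"
    show "distr (P x) borel (F (s + t)) = distr (P x) borel (F s) \<bind> (\<lambda>x. distr (P x) borel (F t))"
    proof (rule measure_eqI)
      have mk': "(\<lambda>x. distr (P x) borel (F t)) \<in> distr (P x) borel (F s) \<rightarrow>\<^sub>M subprob_algebra borel" for x
        using mk[OF st(2)] by simp
      show "sets (distr (P x) borel (F (s + t))) = sets (distr (P x) borel (F s) \<bind> (\<lambda>x. distr (P x) borel (F t)))"
        by (subst sets_bind[where N = borel]) auto
      fix A assume "A \<in> sets (distr (P x) borel (F (s + t)))"
      then have A: "A \<in> sets borel" by simp
      \<comment> \<open>Chapman-Kolmogorov is the Markov property with the whole space as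
        conditioning event.\<close>
      have "space M \<in> sets (natural_filtration M F (ennreal s))"
        using filtration.space_F[OF filtration_natural_filtration, of M F "ennreal s"] sets.top by metis
      then have "emeasure (P x) {\<omega> \<in> space M. F (s + t) \<omega> \<in> A}
          = (\<integral>\<^sup>+\<omega>\<in>space M. hit_prob P F t (F s \<omega>) A \<partial>P x)"
        using mp st A unfolding markov_process_def by blast
      moreover have "emeasure (distr (P x) borel (F (s + t))) A = emeasure (P x) {\<omega> \<in> space M. F (s + t) \<omega> \<in> A}"
        using st A by (simp add: hit hit_prob_def space)
      moreover have "emeasure (distr (P x) borel (F s) \<bind> (\<lambda>x. distr (P x) borel (F t))) A
          = (\<integral>\<^sup>+y. hit_prob P F t y A \<partial>distr (P x) borel (F s))"
        using st A by (subst emeasure_bind[OF _ mk' A]) (simp_all add: hit)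
      moreover have "\<dots> = (\<integral>\<^sup>+\<omega>. hit_prob P F t (F s \<omega>) A \<partial>P x)"
        using st A F hm by (intro nn_integral_distr) auto
      moreover have "\<dots> = (\<integral>\<^sup>+\<omega>\<in>space M. hit_prob P F t (F s \<omega>) A \<partial>P x)"
        by (intro nn_integral_cong) (simp add: space)
      ultimately show "emeasure (distr (P x) borel (F (s + t))) A
          = emeasure (distr (P x) borel (F s) \<bind> (\<lambda>x. distr (P x) borel (F t))) A"
        by simp
    qed
  next
    fix x
    interpret prob_space "P x" by (rule ps)
    have AE0: "AE \<omega> in P x. F 0 \<omega> = x" using mp unfolding markov_process_def by auto
    have "distr (P x) borel (F 0) = distr (P x) borel (\<lambda>_. x)"
      using AE0 F by (intro distr_cong_AE) auto
    also have "\<dots> = return borel x"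
      by (rule measure_eqI) (auto simp: emeasure_distr emeasure_space_1 vimage_def split: split_indicator)
    finally show "distr (P x) borel (F 0) = return borel x" .
  next
    fix f :: "real ^ 'b \<Rightarrow> real" assume f: "f \<in> C_infinity"
    show "uniform_limit UNIV (\<lambda>t x. \<integral>y. f y \<partial>distr (P x) borel (F t)) f (at_right 0)"
    proof (rule uniform_limit_cong[THEN iffD1, OF _ _ sc[OF f]])
      show "\<forall>\<^sub>F t in at_right 0. \<forall>x\<in>UNIV. transition_semigroup P F t f x = (\<integral>y. f y \<partial>distr (P x) borel (F t))"
        using eventually_at_right_less[of 0] by eventually_elim (use ts f in auto)
    qed simp
  next
    fix f :: "real ^ 'b \<Rightarrow> real" and t :: real assume "0 \<le> t" "f \<in> C_infinity"
    then show "(\<lambda>x. \<integral>y. f y \<partial>distr (P x) borel (F t)) \<in> C_infinity"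
      using fl ts by simp
  next
    fix t :: real and x assume "0 \<le> t"
    then show "prob_space (distr (P x) borel (F t))" by (rule pk)
  next
    fix t :: real assume "0 \<le> t"
    then show "(\<lambda>x. distr (P x) borel (F t)) \<in> borel \<rightarrow>\<^sub>M subprob_algebra borel" by (rule mk)
  qed
qed

section \<open>The d-dimensional Fejer kernel and the occupation time of a cube\<close>

definition fejer_d :: "real \<Rightarrow> 'a::euclidean_space \<Rightarrow> real"
  where "fejer_d a \<xi> = (\<Prod>b\<in>Basis. fejer a (\<xi> \<bullet> b))"

definition hat_fun_d :: "real \<Rightarrow> 'a::euclidean_space \<Rightarrow> real"
  where "hat_fun_d a y = (\<Prod>b\<in>Basis. hat_fun a (y \<bullet> b))"

lemma fejer_d_nonneg: "0 \<le> fejer_d a \<xi>"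
  unfolding fejer_d_def by (intro prod_nonneg ballI fejer_bounds)

lemma measurable_fejer_d [measurable]: "fejer_d a \<in> borel_measurable borel"
  unfolding fejer_d_def[abs_def] by measurable

lemma measurable_hat_fun_d [measurable]: "hat_fun_d a \<in> borel_measurable borel"
  unfolding hat_fun_d_def[abs_def] hat_fun_def by measurable

lemma has_bochner_integral_fejer_d:
  fixes y :: "'a::euclidean_space"
  assumes a: "0 < a"
  shows "has_bochner_integral lborel (\<lambda>\<xi>. fejer_d a \<xi> * cos (\<xi> \<bullet> y)) (hat_fun_d a y)"
proof -
  have "has_bochner_integral lborel
      (\<lambda>\<xi>::'a. \<Prod>b\<in>Basis. complex_of_real (fejer a (\<xi> \<bullet> b)) * iexp ((\<xi> \<bullet> b) * (y \<bullet> b)))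
      (\<Prod>b\<in>Basis. complex_of_real (hat_fun a (y \<bullet> b)))"
    by (intro has_bochner_integral_lborel_prod has_bochner_integral_fejer_iexp a)
  moreover have "(\<Prod>b\<in>Basis. complex_of_real (fejer a (\<xi> \<bullet> b)) * iexp ((\<xi> \<bullet> b) * (y \<bullet> b)))
      = complex_of_real (fejer_d a \<xi>) * iexp (\<xi> \<bullet> y)" for \<xi> :: 'a
  proof -
    have "(\<Prod>b\<in>Basis. iexp ((\<xi> \<bullet> b) * (y \<bullet> b))) = iexp (\<xi> \<bullet> y)"
      by (subst exp_sum[symmetric]) (simp_all add: euclidean_inner[of \<xi> y] sum_distrib_left)
    then show ?thesis by (simp add: prod.distrib fejer_d_def)
  qed
  ultimately have "has_bochner_integral lborel (\<lambda>\<xi>. complex_of_real (fejer_d a \<xi>) * iexp (\<xi> \<bullet> y))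
      (complex_of_real (hat_fun_d a y))"
    by (simp add: hat_fun_d_def)
  from has_bochner_integral_Re[OF this] show ?thesis by (simp add: Re_exp)
qed

lemma integrable_fejer_d: "0 < a \<Longrightarrow> integrable lborel (fejer_d a :: 'a::euclidean_space \<Rightarrow> real)"
  using has_bochner_integral_fejer_d[of a "0::'a"] by (simp add: has_bochner_integral_iff)

lemma hat_fun_d_le_indicator:
  fixes y :: "'a::euclidean_space"
  assumes a: "0 < a"
  shows "hat_fun_d a y \<le> (pi / a) ^ DIM('a) * indicator (cbox (- ((2 * a) *\<^sub>R One)) ((2 * a) *\<^sub>R One)) y"
proof (cases "\<forall>b\<in>Basis. \<bar>y \<bullet> b\<bar> \<le> 2 * a")
  case True
  then have "y \<in> cbox (- ((2 * a) *\<^sub>R One)) ((2 * a) *\<^sub>R One)"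
    by (auto simp: mem_box abs_le_iff minus_le_iff)
  moreover have "hat_fun_d a y \<le> (\<Prod>b\<in>(Basis::'a set). pi / a)"
    unfolding hat_fun_d_def by (intro prod_mono conjI hat_fun_nonneg hat_fun_le a)
  ultimately show ?thesis by simp
next
  case False
  then obtain b where "b \<in> Basis" "2 * a \<le> \<bar>y \<bullet> b\<bar>" by (auto simp: not_le intro: less_imp_le)
  then have "hat_fun_d a y = 0"
    unfolding hat_fun_d_def using hat_fun_eq_0[OF a] by (intro prod_zero) auto
  then show ?thesis using a by simp
qed

text \<open>As 1 < pi, \<open>sinc\<close> is positive on the interval from -1 to 1, and it attains
  its minimum there.\<close>

lemma sinc_lower_bound:
  obtains c where "0 < c" "\<And>s. \<bar>s\<bar> \<le> 1 \<Longrightarrow> c \<le> sinc s"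
proof -
  have pos: "0 < sinc s" if "\<bar>s\<bar> \<le> 1" for s
  proof (cases "s = 0")
    case False
    have *: "0 < sin u / u" if "0 < u" "u \<le> 1" for u :: real
      using that pi_gt3 by (intro divide_pos_pos sin_gt_zero) auto
    show ?thesis using *[of s] *[of "- s"] that False by (cases "0 < s") auto
  qed simp
  have "continuous_on {-1..1::real} sinc"
    by (intro continuous_at_imp_continuous_on ballI isCont_sinc)
  then obtain s0 where s0: "s0 \<in> {-1..1}" "\<And>s. s \<in> {-1..1} \<Longrightarrow> sinc s0 \<le> sinc s"
    using continuous_attains_inf[of "{-1..1::real}" sinc] by auto
  show ?thesis
  proof (rule that)
    show "0 < sinc s0" using s0(1) by (intro pos) auto
    show "sinc s0 \<le> sinc s" if "\<bar>s\<bar> \<le> 1" for s using s0(2)[of s] that by (auto simp: abs_le_iff)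
  qed
qed

text \<open>The scale \<open>1 / r\<close> maps every coordinate of a point in the ball into the
  interval on which \<open>sinc\<close> is bounded below.\<close>

lemma fejer_d_lower_bound:
  assumes r: "0 < r"
  obtains d where "0 < d" "\<And>\<xi>::'a::euclidean_space. norm \<xi> < r \<Longrightarrow> d \<le> fejer_d (1 / r) \<xi>"
proof -
  obtain c where c: "0 < c" "\<And>s. \<bar>s\<bar> \<le> 1 \<Longrightarrow> c \<le> sinc s" using sinc_lower_bound by metis
  show ?thesis
  proof (rule that)
    show "0 < (\<Prod>b\<in>(Basis::'a set). c\<^sup>2)" using c by simp
    fix \<xi> :: 'a assume \<xi>: "norm \<xi> < r"
    show "(\<Prod>b\<in>(Basis::'a set). c\<^sup>2) \<le> fejer_d (1 / r) \<xi>"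
      unfolding fejer_d_def
    proof (intro prod_mono conjI)
      fix b :: 'a assume "b \<in> Basis"
      then have "\<bar>\<xi> \<bullet> b\<bar> \<le> r" using Basis_le_norm[of b \<xi>] \<xi> by linarith
      then have "\<bar>1 / r * (\<xi> \<bullet> b)\<bar> \<le> 1" using r by (simp add: abs_mult field_simps)
      then show "c\<^sup>2 \<le> fejer (1 / r) (\<xi> \<bullet> b)"
        unfolding fejer_def by (intro power_mono[OF c(2)] less_imp_le[OF c(1)])
    qed simp
  qed
qed

text \<open>Up to time 1 / (2q) the integrand is at least d / 2, which accounts for the constant d /
  4. When q = 0 this holds up to every time, in accordance with the convention that 1 / 0 is
  infinite.\<close>

lemma nn_integral_linear_decay:
  fixes q d :: real
  assumes q: "0 \<le> q" and d: "0 \<le> d"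
  shows "ennreal (d / 4) * (1 / ennreal q) \<le> (\<integral>\<^sup>+t\<in>{0..}. ennreal (d * max 0 (1 - t * q)) \<partial>lborel)" (is "_ \<le> ?I")
proof -
  have T: "ennreal (d / 2 * T) \<le> ?I" if "0 \<le> T" "T * q \<le> 1 / 2" for T
  proof -
    have "ennreal (d / 2 * T) = (\<integral>\<^sup>+t. ennreal (d / 2) * indicator {0..T} t \<partial>lborel)"
      using that d by (simp add: nn_integral_cmult_indicator ennreal_mult[symmetric])
    also have "\<dots> \<le> ?I"
    proof (intro nn_integral_mono)
      fix t :: real
      show "ennreal (d / 2) * indicator {0..T} t \<le> ennreal (d * max 0 (1 - t * q)) * indicator {0..} t"
      proof (cases "t \<in> {0..T}")
        case True
        have "t * q \<le> T * q" using True q by (intro mult_right_mono) auto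
        then have "1 / 2 \<le> max 0 (1 - t * q)" using that(2) by linarith
        from mult_left_mono[OF this d] True show ?thesis by (auto intro!: ennreal_leI)
      qed simp
    qed
    finally show ?thesis .
  qed
  show ?thesis
  proof (cases "q = 0")
    case True
    show ?thesis
    proof (cases "d = 0")
      case False
      have "?I = \<infinity>"
      proof (rule ccontr)
        assume "?I \<noteq> \<infinity>"
        then obtain i where i: "?I = ennreal i" "0 \<le> i" by (cases ?I) auto
        \<comment> \<open>This horizon makes the lower bound equal to i + 1, above the supposed
          value i.\<close>
        have "ennreal (d / 2 * (2 * (i + 1) / d)) \<le> ?I" using True i(2) d by (intro T) auto
        then show False using i False by (simp add: ennreal_le_iff2)
      qed
      then show ?thesis by simp
    qed simp
  next
    case False
    then have "ennreal (d / 4) * (1 / ennreal q) = ennreal (d / 2 * (1 / (2 * q)))"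
      using q d by (simp add: divide_ennreal[of 1, simplified] ennreal_mult[symmetric])
    also have "\<dots> \<le> ?I" using q False by (intro T) auto
    finally show ?thesis .
  qed
qed

context feller_kernels
begin

text \<open>Integrating the cosine transform of the law against the Fejer kernel and exchanging
  integrals gives the mean of a function that is at most \<open>(pi / a) ^ CARD('n)\<close> and
  vanishes off the cube. Restricting the frequency integral to the ball only lowers it, because
  kernel and transform are both nonnegative everywhere.\<close>

lemma fejer_occupation_bound:
  fixes q :: "real ^ 'n \<Rightarrow> real"
  assumes t: "0 \<le> t" and r: "0 < r" and a: "a = 1 / r"
    and pos: "\<And>\<xi>. 0 \<le> (\<integral>y. cos (\<xi> \<bullet> y) \<partial>K t 0)"
    and low: "\<And>\<xi>. 1 - t * q \<xi> \<le> (\<integral>y. cos (\<xi> \<bullet> y) \<partial>K t 0)"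
    and d: "0 < d" "\<And>\<xi> :: real ^ 'n. norm \<xi> < r \<Longrightarrow> d \<le> fejer_d a \<xi>"
  shows "(\<integral>\<^sup>+\<xi>\<in>ball 0 r. ennreal (d * max 0 (1 - t * q \<xi>)) \<partial>lborel)
    \<le> ennreal ((pi / a) ^ CARD('n)) * emeasure (K t 0) (cbox (- ((2 * a) *\<^sub>R One)) ((2 * a) *\<^sub>R One))"
proof -
  have a0: "0 < a" using r a by simp
  define S :: "(real ^ 'n) set" where "S = cbox (- ((2 * a) *\<^sub>R One)) ((2 * a) *\<^sub>R One)"
  define g where "g \<xi> = (\<integral>y. cos (\<xi> \<bullet> y) \<partial>K t 0)" for \<xi>
  interpret Kt: prob_space "K t 0" using prob_K t .
  interpret pair_sigma_finite lborel "K t 0" by standard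
  have sets [measurable_cong]: "sets (K t 0) = sets borel" using sets_K t .
  have "integrable (lborel \<Otimes>\<^sub>M K t 0) (\<lambda>(\<xi> :: real ^ 'n, y). fejer_d a \<xi>)"
    using fejer_d_nonneg[of a] integrable_fejer_d[OF a0] Kt.prob_space
    by (intro Fubini_integrable) (auto simp: case_prod_unfold)
  then have int: "integrable (lborel \<Otimes>\<^sub>M K t 0) (\<lambda>(\<xi>, y). fejer_d a \<xi> * cos (\<xi> \<bullet> y))"
  proof (rule Bochner_Integration.integrable_bound)
    show "AE p in lborel \<Otimes>\<^sub>M K t 0. norm (case p of (\<xi>, y) \<Rightarrow> fejer_d a \<xi> * cos (\<xi> \<bullet> y))
        \<le> norm (case p of (\<xi> :: real ^ 'n, y) \<Rightarrow> fejer_d a \<xi>)"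
      by (intro AE_I2) (auto simp: abs_mult intro!: mult_left_le)
  qed measurable
  have int_gw: "integrable lborel (\<lambda>\<xi>. fejer_d a \<xi> * g \<xi>)"
    using integrable_fst'[OF int] by (simp add: g_def)
  have "(\<integral>\<^sup>+\<xi>\<in>ball 0 r. ennreal (d * max 0 (1 - t * q \<xi>)) \<partial>lborel) \<le> (\<integral>\<^sup>+\<xi>. ennreal (fejer_d a \<xi> * g \<xi>) \<partial>lborel)"
  proof (intro nn_integral_mono)
    fix \<xi> :: "real ^ 'n"
    have "d * max 0 (1 - t * q \<xi>) \<le> fejer_d a \<xi> * g \<xi>" if "norm \<xi> < r"
      using d pos low that unfolding g_def by (intro mult_mono) (auto intro: order_trans less_imp_le)
    then show "ennreal (d * max 0 (1 - t * q \<xi>)) * indicator (ball 0 r) \<xi> \<le> ennreal (fejer_d a \<xi> * g \<xi>)"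
      by (auto split: split_indicator intro!: ennreal_leI)
  qed
  also have "\<dots> = ennreal (\<integral>\<xi>. fejer_d a \<xi> * g \<xi> \<partial>lborel)"
    using int_gw fejer_d_nonneg pos unfolding g_def by (intro nn_integral_eq_integral AE_I2 mult_nonneg_nonneg)
  also have "(\<integral>\<xi>. fejer_d a \<xi> * g \<xi> \<partial>lborel) = (\<integral>y. (\<integral>\<xi>. fejer_d a \<xi> * cos (\<xi> \<bullet> y) \<partial>lborel) \<partial>K t 0)"
    using Fubini_integral[OF int] by (simp add: g_def)
  also have "\<dots> = (\<integral>y. hat_fun_d a y \<partial>K t 0)"
    by (intro Bochner_Integration.integral_cong refl
        has_bochner_integral_integral_eq[OF has_bochner_integral_fejer_d[OF a0]])
  also have "\<dots> \<le> (\<integral>y. (pi / a) ^ CARD('n) * indicator S y \<partial>K t 0)"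
  proof (rule integral_mono_AE')
    show "integrable (K t 0) (\<lambda>y. (pi / a) ^ CARD('n) * indicator S y)"
      by (intro integrable_mult_right integrable_real_indicator) (auto simp: S_def sets Kt.emeasure_finite less_top[symmetric])
    show "AE y in K t 0. hat_fun_d a y \<le> (pi / a) ^ CARD('n) * indicator S y"
      using hat_fun_d_le_indicator[OF a0, where 'a = "real ^ 'n"] unfolding S_def by (intro AE_I2) simp
    show "AE y in K t 0. 0 \<le> (pi / a) ^ CARD('n) * indicator S y"
      using a0 by (intro AE_I2) simp
  qed
  also have "\<dots> = (pi / a) ^ CARD('n) * measure (K t 0) S"
    by (simp add: S_def sets)
  finally show ?thesis
    using a0 by (simp add: S_def[symmetric] Kt.emeasure_eq_measure ennreal_mult ennreal_leI)
qed

text \<open>The cube depends on \<open>r\<close> but not on \<open>t\<close>, so the bound at each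
  fixed time can be integrated over time; Tonelli then trades the time integral for
  \<open>1 / q\<close>, up to a constant.\<close>

lemma infinite_occupation_of_cube:
  fixes q :: "real ^ 'n \<Rightarrow> real"
  assumes [measurable]: "q \<in> borel_measurable borel" and q: "\<And>\<xi>. 0 \<le> q \<xi>" and r: "0 < r"
    and pos: "\<And>t \<xi>. 0 \<le> t \<Longrightarrow> 0 \<le> (\<integral>y. cos (\<xi> \<bullet> y) \<partial>K t 0)"
    and low: "\<And>t \<xi>. 0 \<le> t \<Longrightarrow> 1 - t * q \<xi> \<le> (\<integral>y. cos (\<xi> \<bullet> y) \<partial>K t 0)"
    and div: "(\<integral>\<^sup>+\<xi>\<in>ball 0 r. 1 / ennreal (q \<xi>) \<partial>lborel) = \<infinity>"
  shows "\<exists>S. compact S \<and> potential (indicator S) 0 = \<infinity>"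
proof -
  define a where "a = 1 / r"
  define S :: "(real ^ 'n) set" where "S = cbox (- ((2 * a) *\<^sub>R One)) ((2 * a) *\<^sub>R One)"
  obtain d where d: "0 < d" "\<And>\<xi> :: real ^ 'n. norm \<xi> < r \<Longrightarrow> d \<le> fejer_d a \<xi>"
    using fejer_d_lower_bound[OF r, where 'a = "real ^ 'n"] unfolding a_def by metis
  define c where "c = ennreal ((pi / a) ^ CARD('n))"
  have [measurable]: "S \<in> sets borel" by (simp add: S_def)
  have [measurable]: "ball 0 r \<in> sets (borel :: (real ^ 'n) measure)" by simp
  have [measurable]: "(\<lambda>\<xi>. 1 / ennreal (q \<xi>)) \<in> borel_measurable borel"
    unfolding divide_ennreal_def by measurable
  have "\<infinity> = ennreal (d / 4) * (\<integral>\<^sup>+\<xi>\<in>ball 0 r. 1 / ennreal (q \<xi>) \<partial>lborel)"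
    using d by (simp add: div ennreal_mult_top)
  also have "\<dots> = (\<integral>\<^sup>+\<xi>\<in>ball 0 r. ennreal (d / 4) * (1 / ennreal (q \<xi>)) \<partial>lborel)"
    unfolding mult.assoc by (intro nn_integral_cmult[symmetric]) measurable
  also have "\<dots> \<le> (\<integral>\<^sup>+\<xi>\<in>ball 0 r. (\<integral>\<^sup>+t\<in>{0..}. ennreal (d * max 0 (1 - t * q \<xi>)) \<partial>lborel) \<partial>lborel)"
    using d q by (intro nn_integral_mono mult_right_mono nn_integral_linear_decay) auto
  also have "\<dots> = (\<integral>\<^sup>+\<xi>. (\<integral>\<^sup>+t. ennreal (d * max 0 (1 - t * q \<xi>)) * indicator {0..} t * indicator (ball 0 r) \<xi> \<partial>lborel) \<partial>lborel)"
    by (intro nn_integral_cong nn_integral_multc[symmetric]) measurable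
  also have "\<dots> = (\<integral>\<^sup>+t. (\<integral>\<^sup>+\<xi>. ennreal (d * max 0 (1 - t * q \<xi>)) * indicator {0..} t * indicator (ball 0 r) \<xi> \<partial>lborel) \<partial>lborel)"
    by (rule lborel_pair.Fubini'[symmetric]) measurable
  also have "\<dots> \<le> (\<integral>\<^sup>+t. c * (transition t (indicator S) 0 * indicator {0..} t) \<partial>lborel)"
  proof (intro nn_integral_mono)
    fix t :: real
    show "(\<integral>\<^sup>+\<xi>. ennreal (d * max 0 (1 - t * q \<xi>)) * indicator {0..} t * indicator (ball 0 r) \<xi> \<partial>lborel)
        \<le> c * (transition t (indicator S) 0 * indicator {0..} t)"
    proof (cases "0 \<le> t")
      case True
      have "transition t (indicator S) 0 = emeasure (K t 0) S"
        using True sets_K[OF True] by (simp add: transition_def S_def)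
      then show ?thesis
        using True fejer_occupation_bound[OF True r a_def pos low d] by (simp add: S_def c_def)
    qed simp
  qed
  also have "\<dots> = c * potential (indicator S) 0"
    unfolding potential_def by (intro nn_integral_cmult) measurable
  finally have "c * potential (indicator S) 0 = \<infinity>" by (simp add: top_unique)
  then have "potential (indicator S) 0 = \<infinity>" by (auto simp: ennreal_mult_eq_top_iff c_def)
  moreover have "compact S" unfolding S_def by (rule compact_cbox)
  ultimately show ?thesis by blast
qed

end

section \<open>Regularity of the symbol in the frequency variable\<close>

lemma has_symbol_isCont:
  assumes "has_symbol P F q"
  shows "isCont (q x) \<xi>"
proof -
  obtain a b c \<nu> where lc: "levy_characteristics a b c \<nu>"
    and q: "\<And>x \<xi>. q x \<xi> = levy_khintchine (a x) (b x) (c x) (\<nu> x) \<xi>"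
    using assms unfolding has_symbol_def by blast
  have "q x = levy_khintchine (a x) (b x) (c x) (\<nu> x)" using q by auto
  then show ?thesis
    using lc isCont_levy_khintchine[of "\<nu> x"] unfolding levy_characteristics_def by simp
qed

lemma has_symbol_minus: "has_symbol P F q \<Longrightarrow> q x (- \<xi>) = cnj (q x \<xi>)"
  unfolding has_symbol_def by (auto simp: levy_khintchine_minus)

text \<open>The supremum runs over uncountably many \<open>x\<close>, but a supremum of continuous
  functions is lower semicontinuous: its strict superlevel sets are unions of open sets.\<close>

lemma measurable_sup_symbol:
  fixes q :: "real ^ 'n \<Rightarrow> real ^ 'n \<Rightarrow> complex"
  assumes "\<And>x \<xi>. isCont (q x) \<xi>"
  shows "sup_symbol q \<in> borel_measurable borel"
proof (rule borel_measurableI_greater)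
  fix c :: ennreal
  have "open {\<xi>. c < ennreal (cmod (q x \<xi>))}" for x
    using assms by (intro open_Collect_less continuous_at_imp_continuous_on ballI continuous_const continuous_at_ennreal)
      (auto intro!: continuous_intros)
  then have "open (\<Union>x. {\<xi>. c < ennreal (cmod (q x \<xi>))})" by blast
  moreover have "{\<xi> \<in> space borel. c < sup_symbol q \<xi>} = (\<Union>x. {\<xi>. c < ennreal (cmod (q x \<xi>))})"
    by (auto simp: sup_symbol_def less_SUP_iff)
  ultimately show "{\<xi> \<in> space borel. c < sup_symbol q \<xi>} \<in> sets borel" by simp
qed

section \<open>The characteristic function\<close>

text \<open>The symbol formula expresses the generator as two averages of \<eta> \<mapsto> q(x,
  \<eta>) exp(i \<langle>\<eta>, x\<rangle>), near \<xi> and near -\<xi>. Their bound comes from the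
  growth of the symbol and is uniform in \<open>x\<close> and \<open>n\<close>; their limit comes
  from continuity in the frequency.\<close>

lemma generator_cutoff_cos:
  fixes q :: "real ^ 'n \<Rightarrow> real ^ 'n \<Rightarrow> complex"
  assumes sym: "has_symbol P F q" and C0: "0 \<le> C" and C: "\<And>x \<eta>. cmod (q x \<eta>) \<le> C * (1 + (norm \<eta>)\<^sup>2)"
  shows generator_cutoff_cos_bounded: "\<exists>B. \<forall>n x. \<bar>generator P F (\<lambda>x. cutoff (real (Suc n)) x * cos (\<xi> \<bullet> x)) x\<bar> \<le> B"
    and generator_cutoff_cos_tendsto: "(\<lambda>n. generator P F (\<lambda>x. cutoff (real (Suc n)) x * cos (\<xi> \<bullet> x)) x)
      \<longlonglongrightarrow> - Re (q x \<xi> * iexp (\<xi> \<bullet> x))"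
proof -
  define H where "H x \<eta> = q x \<eta> * iexp (\<eta> \<bullet> x)" for x \<eta>
  define N where "N = 2 * (2 * pi) ^ CARD('n)"
  have N: "0 < N" by (simp add: N_def)
  have contH: "isCont (H x) \<eta>" for x \<eta>
    unfolding H_def by (intro continuous_mult has_symbol_isCont[OF sym] continuous_intros)
  then have [measurable]: "H x \<in> borel_measurable borel" for x
    by (intro borel_measurable_continuous_onI continuous_at_imp_continuous_on) auto
  have CH: "cmod (H x \<eta>) \<le> C * (1 + (norm \<eta>)\<^sup>2)" for x \<eta>
    using C[of x \<eta>] by (simp add: H_def norm_mult)
  have gen: "complex_of_real (generator P F (\<lambda>x. cutoff (real (Suc n)) x * cos (\<xi> \<bullet> x)) x)
      = - ((smear (real (Suc n)) \<xi> (H x) + smear (real (Suc n)) (- \<xi>) (H x)) / complex_of_real N)" for n x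
  proof -
    have "complex_of_real (generator P F (\<lambda>x. cutoff (real (Suc n)) x * cos (\<xi> \<bullet> x)) x)
        = - (\<integral>\<eta>. H x \<eta> * fourier (\<lambda>x. cutoff (real (Suc n)) x * cos (\<xi> \<bullet> x)) \<eta> \<partial>lborel)"
      using sym cutoff_cos_smooth[of "real (Suc n)" \<xi>] unfolding has_symbol_def H_def by simp
    then show ?thesis
      using integral_fourier_cutoff_cos[of "H x" C "real (Suc n)" \<xi>, OF _ CH C0] by (simp add: N_def)
  qed
  define W where "W = 2 * C * (1 + (norm \<xi>)\<^sup>2) * (\<integral>\<zeta>. (1 + (norm \<zeta>)\<^sup>2) * cmod (FT_bump_d \<zeta>) \<partial>(lborel :: (real ^ 'n) measure))"
  have "\<bar>generator P F (\<lambda>x. cutoff (real (Suc n)) x * cos (\<xi> \<bullet> x)) x\<bar> \<le> (W + W) / N" for n x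
  proof -
    have "\<bar>generator P F (\<lambda>x. cutoff (real (Suc n)) x * cos (\<xi> \<bullet> x)) x\<bar>
        = cmod (smear (real (Suc n)) \<xi> (H x) + smear (real (Suc n)) (- \<xi>) (H x)) / N"
      using arg_cong[OF gen[of n x], of cmod] N by (simp add: norm_divide)
    also have "\<dots> \<le> (W + W) / N"
      using smear_bound[of "H x" C "real (Suc n)" \<xi>, OF _ CH C0] smear_bound[of "H x" C "real (Suc n)" "- \<xi>", OF _ CH C0] N
      by (intro divide_right_mono order_trans[OF norm_triangle_ineq] add_mono) (auto simp: W_def)
    finally show ?thesis .
  qed
  then show "\<exists>B. \<forall>n x. \<bar>generator P F (\<lambda>x. cutoff (real (Suc n)) x * cos (\<xi> \<bullet> x)) x\<bar> \<le> B" by blast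
  \<comment> \<open>The contributions of the two peaks are complex conjugates, so their mean is a
    real part.\<close>
  have "H x (- \<xi>) = cnj (H x \<xi>)"
    by (simp add: H_def has_symbol_minus[OF sym] exp_cnj)
  then have sum: "H x \<xi> + H x (- \<xi>) = complex_of_real (2 * Re (H x \<xi>))"
    by (simp add: complex_add_cnj)
  have "(\<lambda>n. complex_of_real (generator P F (\<lambda>x. cutoff (real (Suc n)) x * cos (\<xi> \<bullet> x)) x))
      \<longlonglongrightarrow> - ((complex_of_real ((2 * pi) ^ CARD('n)) * H x \<xi> + complex_of_real ((2 * pi) ^ CARD('n)) * H x (- \<xi>))
        / complex_of_real N)"
    unfolding gen using N by (intro tendsto_intros smear_tendsto[OF _ CH C0 contH]) auto
  also have "- ((complex_of_real ((2 * pi) ^ CARD('n)) * H x \<xi> + complex_of_real ((2 * pi) ^ CARD('n)) * H x (- \<xi>))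
        / complex_of_real N) = complex_of_real (- Re (H x \<xi>))"
    unfolding distrib_left[symmetric] sum by (simp add: N_def)
  finally show "(\<lambda>n. generator P F (\<lambda>x. cutoff (real (Suc n)) x * cos (\<xi> \<bullet> x)) x)
      \<longlonglongrightarrow> - Re (q x \<xi> * iexp (\<xi> \<bullet> x))"
    unfolding H_def tendsto_of_real_iff by simp
qed

text \<open>At the starting point 0 the cosine equals 1, and the limit of the generators, being
  minus the real part of a number of modulus |q(y, \<xi>)|, never falls below
  \<open>- Q\<close>.\<close>

lemma char_lower_bound:
  fixes q :: "real ^ 'n \<Rightarrow> real ^ 'n \<Rightarrow> complex"
  assumes fp: "feller_process M P F" and dom: "C_c_smooth \<subseteq> generator_domain P F"
    and sym: "has_symbol P F q" and C0: "0 \<le> C" and C: "\<And>x \<eta>. cmod (q x \<eta>) \<le> C * (1 + (norm \<eta>)\<^sup>2)"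
    and Q: "\<And>x. cmod (q x \<xi>) \<le> Q" and t: "0 \<le> t"
  shows "1 - t * Q \<le> (\<integral>y. cos (\<xi> \<bullet> y) \<partial>distr (P 0) borel (F t))"
proof -
  interpret feller_kernels "\<lambda>t x. distr (P x) borel (F t)" by (rule feller_kernels_distr[OF fp])
  define f where "f n x = cutoff (real (Suc n)) x * cos (\<xi> \<bullet> x)" for n and x :: "real ^ 'n"
  define g where "g n = generator P F (f n)" for n
  have gen: "generates P F (f n) (g n)" for n
  proof -
    have "f n \<in> generator_domain P F"
      using dom cutoff_cos_smooth[of "real (Suc n)" \<xi>] unfolding f_def by auto
    then obtain h where "generates P F (f n) h" by (auto simp: generator_domain_def)
    then show ?thesis using generator_eqI by (metis g_def)
  qed
  have fC: "f n \<in> C_infinity" and gC: "g n \<in> C_infinity" for n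
    using gen[of n] by (auto simp: generates_def)
  note Ft = feller_process_measurable[OF fp]
  have ul: "uniform_limit UNIV (\<lambda>t x. ((\<integral>y. f n y \<partial>distr (P x) borel (F t)) - f n x) / t) (g n) (at_right 0)" for n
  proof (rule uniform_limit_cong[THEN iffD1])
    show "uniform_limit UNIV (\<lambda>t x. (transition_semigroup P F t (f n) x - f n x) / t) (g n) (at_right 0)"
      using gen[of n] by (simp add: generates_def)
    show "\<forall>\<^sub>F t in at_right 0. \<forall>x\<in>UNIV. (transition_semigroup P F t (f n) x - f n x) / t
        = ((\<integral>y. f n y \<partial>distr (P x) borel (F t)) - f n x) / t"
      using eventually_at_right_less[of 0]
    proof eventually_elim
      case (elim t)
      then show ?case
        using Ft[of t] C_infinity_measurable[OF fC[of n]]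
        by (simp add: transition_semigroup_def integral_distr)
    qed
  qed simp
  obtain B where B: "\<And>n x. \<bar>g n x\<bar> \<le> B"
    using generator_cutoff_cos_bounded[OF sym C0 C, of \<xi>] unfolding g_def f_def by auto
  have "cos (\<xi> \<bullet> 0) - t * Q \<le> (\<integral>y. cos (\<xi> \<bullet> y) \<partial>distr (P 0) borel (F t))"
  proof (rule semigroup_lower_bound[OF fC gC ul])
    show "\<bar>f n y\<bar> \<le> max B (exp 2 ^ CARD('n))" for n y
    proof -
      have "\<bar>f n y\<bar> \<le> exp 2 ^ CARD('n) * 1"
        unfolding f_def abs_mult using cutoff_bounds[of "real (Suc n)" y] by (intro mult_mono) auto
      then show ?thesis by simp
    qed
    show "\<bar>g n y\<bar> \<le> max B (exp 2 ^ CARD('n))" for n y using B[of n y] by simp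
    show "(\<lambda>n. f n y) \<longlonglongrightarrow> cos (\<xi> \<bullet> y)" for y
      using tendsto_mult_right[OF cutoff_tendsto[of y], of "cos (\<xi> \<bullet> y)"] by (simp add: f_def)
    show "(\<lambda>n. g n y) \<longlonglongrightarrow> - Re (q y \<xi> * iexp (\<xi> \<bullet> y))" for y
      using generator_cutoff_cos_tendsto[OF sym C0 C, of \<xi> y] unfolding g_def f_def .
    show "- Q \<le> - Re (q y \<xi> * iexp (\<xi> \<bullet> y))" for y
    proof -
      have "Re (q y \<xi> * iexp (\<xi> \<bullet> y)) \<le> cmod (q y \<xi> * iexp (\<xi> \<bullet> y))" by (rule complex_Re_le_cmod)
      also have "\<dots> \<le> Q" using Q[of y] by (simp add: norm_mult)
      finally show ?thesis by simp
    qed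
  qed (rule t)
  then show ?thesis by simp
qed

theorem theorem1p2:
  fixes M :: "'w measure"
    and P :: "real ^ 'n \<Rightarrow> 'w measure"
    and F :: "real \<Rightarrow> 'w \<Rightarrow> real ^ 'n"
    and q :: "real ^ 'n \<Rightarrow> real ^ 'n \<Rightarrow> complex"
  assumes "nice_feller_process M P F q"
    and "\<forall>t\<ge>0. \<forall>\<xi>. Re (\<integral>\<omega>. iexp (\<xi> \<bullet> F t \<omega>) \<partial>P 0) \<ge> 0"
    and "\<exists>r>0. (\<integral>\<^sup>+ \<xi>\<in>ball 0 r. 1 / sup_symbol q \<xi> \<partial>lborel) = \<infinity>"
  shows "recurrent P F"
proof -
  have fp: "feller_process M P F" and dom: "C_c_smooth \<subseteq> generator_domain P F" and sym: "has_symbol P F q"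
    using assms(1) by (auto simp: nice_feller_process_def)
  obtain C where C0: "0 \<le> C" and C: "\<And>\<xi>. sup_symbol q \<xi> \<le> ennreal (C * (1 + (norm \<xi>)\<^sup>2))"
    using assms(1) by (auto simp: nice_feller_process_def)
  obtain \<psi> where max: "maximal_irreducibility_measure P F \<psi>"
    and op: "\<And>U. open U \<Longrightarrow> U \<noteq> {} \<Longrightarrow> emeasure \<psi> U > 0"
    using assms(1) by (auto simp: nice_feller_process_def)
  obtain r where r: "0 < r" and div: "(\<integral>\<^sup>+ \<xi>\<in>ball 0 r. 1 / sup_symbol q \<xi> \<partial>lborel) = \<infinity>"
    using assms(3) by auto
  interpret feller_kernels "\<lambda>t x. distr (P x) borel (F t)" by (rule feller_kernels_distr[OF fp])
  note Ft = feller_process_measurable[OF fp]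
  have occ: "occupation P F x B = potential (indicator B) x" if "B \<in> sets borel" for x B
    unfolding occupation_def potential_def
  proof (intro nn_integral_cong)
    fix t :: real
    show "hit_prob P F t x B * indicator {0..} t = transition t (indicator B) x * indicator {0..} t"
    proof (cases "0 \<le> t")
      case True
      have "hit_prob P F t x B = emeasure (distr (P x) borel (F t)) B"
        using that emeasure_distr[OF Ft[OF True], of B x] unfolding hit_prob_def
        by (simp add: vimage_def Int_def conj_commute)
      then show ?thesis using True that by (simp add: transition_def)
    qed simp
  qed
  have cmod_le: "ennreal (cmod (q x \<xi>)) \<le> sup_symbol q \<xi>" for x \<xi>
    unfolding sup_symbol_def by (rule SUP_upper) simp
  \<comment> \<open>Quadratic growth makes the supremum finite at every frequency, so it can be
    handled as the real-valued \<open>Q\<close>.\<close>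
  have fin: "sup_symbol q \<xi> < \<infinity>" for \<xi>
    using C[of \<xi>] ennreal_less_top by (auto intro: le_less_trans)
  define Q where "Q \<xi> = enn2real (sup_symbol q \<xi>)" for \<xi>
  have sup_eq: "sup_symbol q \<xi> = ennreal (Q \<xi>)" for \<xi>
    using fin[of \<xi>] by (simp add: Q_def)
  have cmod_Q: "cmod (q x \<xi>) \<le> Q \<xi>" for x \<xi>
    using cmod_le[of x \<xi>] unfolding sup_eq by (simp add: ennreal_le_iff Q_def)
  have cmod_C: "cmod (q x \<xi>) \<le> C * (1 + (norm \<xi>)\<^sup>2)" for x \<xi>
    using order_trans[OF cmod_le C, of x \<xi>] C0 by (simp add: ennreal_le_iff)
  have [measurable]: "sup_symbol q \<in> borel_measurable borel"
    by (intro measurable_sup_symbol has_symbol_isCont[OF sym])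
  have "\<exists>S. compact S \<and> potential (indicator S) 0 = \<infinity>"
  proof (rule infinite_occupation_of_cube[where q = Q, OF _ _ r])
    show "Q \<in> borel_measurable borel" unfolding Q_def by measurable
    show "0 \<le> Q \<xi>" for \<xi> by (simp add: Q_def)
    show "(\<integral>\<^sup>+\<xi>\<in>ball 0 r. 1 / ennreal (Q \<xi>) \<partial>lborel) = \<infinity>"
      using div by (simp only: sup_eq)
    fix t :: real and \<xi> :: "real ^ 'n" assume t: "0 \<le> t"
    show "1 - t * Q \<xi> \<le> (\<integral>y. cos (\<xi> \<bullet> y) \<partial>distr (P 0) borel (F t))"
      by (rule char_lower_bound[OF fp dom sym C0 cmod_C cmod_Q t])
    interpret P0: prob_space "P 0"
      using fp unfolding feller_process_def markov_process_def by blast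
    note [measurable] = Ft[OF t]
    have int: "integrable (P 0) (\<lambda>\<omega>. iexp (\<xi> \<bullet> F t \<omega>))"
      by (rule P0.integrable_const_bound[of _ 1]) auto
    have "(\<integral>y. cos (\<xi> \<bullet> y) \<partial>distr (P 0) borel (F t)) = (\<integral>\<omega>. cos (\<xi> \<bullet> F t \<omega>) \<partial>P 0)"
      by (intro integral_distr) auto
    also have "\<dots> = Re (\<integral>\<omega>. iexp (\<xi> \<bullet> F t \<omega>) \<partial>P 0)"
      using integral_Re[OF int] by (simp add: Re_exp)
    finally show "0 \<le> (\<integral>y. cos (\<xi> \<bullet> y) \<partial>distr (P 0) borel (F t))"
      using assms(2) t by simp
  qed
  then obtain S where S: "compact S" "potential (indicator S) 0 = \<infinity>" by blast
  have psi: "sets \<psi> = sets borel" "sigma_finite_measure \<psi>"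
    using max by (auto simp: maximal_irreducibility_measure_def)
  have "irreducible_wrt P F \<psi>"
    using max psi unfolding maximal_irreducibility_measure_def absolutely_continuous_def by blast
  then have irr: "potential (indicator B) x > 0" if "B \<in> sets borel" "emeasure \<psi> B > 0" for B x
    using that by (auto simp: irreducible_wrt_def occ)
  show ?thesis
    unfolding recurrent_def
  proof (intro exI[of _ \<psi>] conjI ballI impI allI max)
    fix B x assume B: "B \<in> sets borel" "emeasure \<psi> B > 0"
    \<comment> \<open>The infinite potential found at the starting point 0 is spread by the
      criterion to every starting point and every set of positive measure.\<close>
    show "occupation P F x B = \<infinity>"
      unfolding occ[OF B(1)] by (rule recurrence_criterion[OF psi irr op S B])
  qed
qed

end
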